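(* Let $f,g:\mathbb{R}\to\mathbb{R}$ satisfy: $f,g\in C^\infty(\mathbb{R})$; $f(0)=0$ and $f''(x)\ge 0$ for all $x\in\mathbb{R}$; $g(x)\ge 0$ for all $x\in\mathbb{R}$, and $g(x)=0$ if and only if $x=0$. Let $T>0$, $2\le p\le\infty$, $s>3/2$, $u_0\in H^s(\mathbb{R})$, and let $\phi$ be a $v$-moderate weight function such that $$\phi^{1/2}u_0,\ \phi^{1/2}u_0'\in L^2(\mathbb{R})\qquad\text{and}\qquad \phi u_0,\ \phi u_0'\in L^p(\mathbb{R}).$$ Suppose that $e^{-|\cdot|}v(\cdot)\in L^p(\mathbb{R})$, let $u\in C^0([0,T];H^s(\mathbb{R}))$ be the corresponding solution of $$u_t+f'(u)u_x+\partial_x\Lambda^{-2}\Big(g(u)+\frac{f''(u)}{2}u_x^2\Big)=0$$ with $u(0,x)=u_0(x)$, and suppose that $g(u(t,x))\le c\,u(t,x)^2$ for all $(t,x)\in[0,T]\times\mathbb{R}$, for some $c>0$. Then there exists a constant $K>0$, depending on $\phi$, $v$, $f$, $g$, $T$ and $u_0$ (and its $L^p(\mathbb{R})$ norm), such that $$\sup_{t\in[0,T]}\Big(\|\phi(\cdot)^{1/2}u(t,\cdot)\|_2+\|\phi(\cdot)^{1/2}u_x(t,\cdot)\|_2\Big)\le K,$$ and $$\sup_{t\in[0,T]}\Big(\|\phi(\cdot)u(t,\cdot)\|_p+\|\phi(\cdot)u_x(t,\cdot)\|_p\Big)<\infty .$$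
   Context: Functions are real-valued, $t$ denotes time and $x$ space; $\|\cdot\|_p$ is the $L^p(\mathbb{R})$ norm. $\Lambda^{-2}=(1-\partial_x^2)^{-1}$: $\Lambda^{-2}h=q\ast h$ and $\partial_x\Lambda^{-2}h=(\partial_x q)\ast h$, where $q(x)=\tfrac12 e^{-|x|}$, $\partial_xq(x)=-\mathrm{sgn}(x)q(x)$ and $\ast$ is convolution in $x$. By local well-posedness theory such solutions also belong to $C^1([0,T];H^{s-1}(\mathbb{R}))$. A weight function is a continuous positive function $\mathbb{R}\to\mathbb{R}$. Given a weight function $v$, a function $\phi:\mathbb{R}\to\mathbb{R}$ is $v$-moderate if it is positive and there is a constant $c_0>0$ with $\phi(x+y)\le c_0\,v(x)\,\phi(y)$ for all $x,y\in\mathbb{R}$. *)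

theory Defs
  imports "HOL-Analysis.Analysis" "HOL-Probability.Essential_Supremum"
begin

section \<open>Smooth functions and Lebesgue spaces on the line\<close>

definition smooth :: "(real \<Rightarrow> real) \<Rightarrow> bool" where
  "smooth f \<longleftrightarrow> (\<forall>n x. (deriv ^^ n) f differentiable (at x))"

text \<open>The \<open>L\<^sup>p\<close> norm takes values in \<open>[0, \<infinity>]\<close>; the exponent \<open>p = \<infinity>\<close> is included.\<close>

definition Lp_norm :: "ennreal \<Rightarrow> (real \<Rightarrow> 'a::real_normed_vector) \<Rightarrow> ennreal" where
  "Lp_norm p h =
    (if p = \<infinity> then esssup lborel (\<lambda>x. ennreal (norm (h x)))
     else let I = (\<integral>\<^sup>+ x. ennreal (norm (h x) powr enn2real p) \<partial>lborel)
          in if I = \<infinity> then \<infinity> else ennreal (enn2real I powr (1 / enn2real p)))"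

definition in_Lp :: "ennreal \<Rightarrow> (real \<Rightarrow> 'a::real_normed_vector) \<Rightarrow> bool" where
  "in_Lp p h \<longleftrightarrow> h \<in> borel_measurable lborel \<and> Lp_norm p h < \<infinity>"

section \<open>Fourier transform and Sobolev spaces\<close>

definition fourier_truncated :: "real \<Rightarrow> (real \<Rightarrow> real) \<Rightarrow> real \<Rightarrow> complex" where
  "fourier_truncated R h \<xi> =
    (1 / sqrt (2 * pi)) *\<^sub>R (LINT x:{-R..R}|lborel. complex_of_real (h x) * cis (- (x * \<xi>)))"

text \<open>
  The Fourier transform of an \<open>L\<^sup>2\<close> function is the \<open>L\<^sup>2\<close> limit of its truncated Fourier
  integrals. It is unique up to equality almost everywhere.
\<close>

definition is_fourier_L2 :: "(real \<Rightarrow> real) \<Rightarrow> (real \<Rightarrow> complex) \<Rightarrow> bool" where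
  "is_fourier_L2 h w \<longleftrightarrow> in_Lp 2 h \<and> in_Lp 2 w \<and>
     ((\<lambda>R. Lp_norm 2 (\<lambda>\<xi>. w \<xi> - fourier_truncated R h \<xi>)) \<longlongrightarrow> 0) at_top"

definition fourier_L2 :: "(real \<Rightarrow> real) \<Rightarrow> real \<Rightarrow> complex" where
  "fourier_L2 h = (SOME w. is_fourier_L2 h w)"

text \<open>
  \<open>H\<^sup>s(\<real>)\<close> for \<open>s \<ge> 0\<close>, as a set of functions rather than of classes modulo equality almost
  everywhere. The norm is meaningful only for members of the space, and does not depend on
  the choice made in \<^const>\<open>fourier_L2\<close>.
\<close>

definition sobolev :: "real \<Rightarrow> (real \<Rightarrow> real) set" where
  "sobolev s = {h. in_Lp 2 h \<and>
     (\<exists>w. is_fourier_L2 h w \<and> in_Lp 2 (\<lambda>\<xi>. (1 + \<xi>\<^sup>2) powr (s / 2) *\<^sub>R w \<xi>))}"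

definition sobolev_norm :: "real \<Rightarrow> (real \<Rightarrow> real) \<Rightarrow> ennreal" where
  "sobolev_norm s h = Lp_norm 2 (\<lambda>\<xi>. (1 + \<xi>\<^sup>2) powr (s / 2) *\<^sub>R fourier_L2 h \<xi>)"

text \<open>\<open>u \<in> C\<^sup>0([0,T]; H\<^sup>s(\<real>))\<close>\<close>

definition C0_sobolev :: "real \<Rightarrow> real \<Rightarrow> (real \<Rightarrow> real \<Rightarrow> real) \<Rightarrow> bool" where
  "C0_sobolev T s u \<longleftrightarrow>
     (\<forall>t\<in>{0..T}. u t \<in> sobolev s \<and>
        ((\<lambda>\<tau>. sobolev_norm s (\<lambda>x. u \<tau> x - u t x)) \<longlongrightarrow> 0) (at t within {0..T}))"

section \<open>The equation\<close>

definition q :: "real \<Rightarrow> real" where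
  "q x = exp (- \<bar>x\<bar>) / 2"

definition dq :: "real \<Rightarrow> real" where
  "dq x = - sgn x * q x"

definition conv :: "(real \<Rightarrow> real) \<Rightarrow> (real \<Rightarrow> real) \<Rightarrow> real \<Rightarrow> real" where
  "conv a b x = (LINT y|lborel. a (x - y) * b y)"

text \<open>
  Solutions in \<open>C\<^sup>0([0,T]; H\<^sup>s)\<close> of
  \<open>u\<^sub>t + f'(u) u\<^sub>x + \<partial>\<^sub>x \<Lambda>\<^sup>-\<^sup>2 (g(u) + f''(u)/2 u\<^sub>x\<^sup>2) = 0\<close>, \<open>u(0,\<cdot>) = u\<^sub>0\<close>, where \<open>s > 3/2\<close> and
  \<open>\<partial>\<^sub>x \<Lambda>\<^sup>-\<^sup>2 h = \<partial>\<^sub>x q * h\<close>.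

  Each \<open>u(t,\<cdot>)\<close> is taken to be the continuous representative of its class, which is
  continuously differentiable since \<open>s > 3/2\<close>. The equation is read pointwise, with one-sided
  time derivatives at \<open>0\<close> and \<open>T\<close>. A solution in \<open>C\<^sup>1([0,T]; H\<^sup>s\<^sup>-\<^sup>1)\<close> satisfies it in this sense,
  because \<open>s - 1 > 1/2\<close> makes evaluation at a point continuous on \<open>H\<^sup>s\<^sup>-\<^sup>1\<close>.
\<close>

definition is_solution ::
  "(real \<Rightarrow> real) \<Rightarrow> (real \<Rightarrow> real) \<Rightarrow> real \<Rightarrow> real \<Rightarrow> (real \<Rightarrow> real) \<Rightarrow> (real \<Rightarrow> real \<Rightarrow> real) \<Rightarrow> bool"
  where
  "is_solution f g T s u0 u \<longleftrightarrow>
     C0_sobolev T s u \<and>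
     (\<forall>t\<in>{0..T}. continuous_on UNIV (u t)) \<and>
     (\<forall>x. u 0 x = u0 x) \<and>
     (\<forall>t\<in>{0..T}. \<forall>x. \<exists>ut. ((\<lambda>\<tau>. u \<tau> x) has_real_derivative ut) (at t within {0..T}) \<and>
        ut + deriv f (u t x) * deriv (u t) x
           + conv dq (\<lambda>y. g (u t y) + (deriv ^^ 2) f (u t y) / 2 * (deriv (u t) y)\<^sup>2) x = 0)"

section \<open>Weights\<close>

definition weight_function :: "(real \<Rightarrow> real) \<Rightarrow> bool" where
  "weight_function w \<longleftrightarrow> continuous_on UNIV w \<and> (\<forall>x. w x > 0)"

definition moderate :: "(real \<Rightarrow> real) \<Rightarrow> (real \<Rightarrow> real) \<Rightarrow> bool" where
  "moderate v \<phi> \<longleftrightarrow> (\<forall>x. \<phi> x > 0) \<and> (\<exists>c0>0. \<forall>x y. \<phi> (x + y) \<le> c0 * v x * \<phi> y)"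

end

theory Submission
  imports Defs "HOL-Probability.Characteristic_Functions" "HOL-Real_Asymp.Real_Asymp"
begin

text \<open>
  Write \<open>X\<close> for the flow of the velocity \<open>f'(u)\<close> and \<open>U\<close>, \<open>V\<close>, \<open>J\<close> for \<open>u\<close>, \<open>u\<^sub>x\<close> along the flow and
  the Jacobian of \<open>X\<close>. In these variables no derivative is lost: \<open>(X, U, V, J)\<close> solves
  a locally Lipschitz ordinary differential equation in the space of bounded functions, because
  \<open>\<partial>\<^sub>x\<^sup>2 \<Lambda>\<^sup>-\<^sup>2 F = \<Lambda>\<^sup>-\<^sup>2 F - F\<close>. This yields uniqueness, which is what makes \<open>K\<close> independent of \<open>s\<close> and of
  the solution. Since the flow moves points by a bounded amount, moderate weights and the kernel
  \<open>exp (- \<bar>x\<bar>)\<close> are comparable in Eulerian and Lagrangian coordinates, and \<open>S = \<bar>U\<bar> + \<bar>V\<bar>\<close> satisfies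
  \<open>S(t) \<le> S(0) + C \<integral>\<^sub>0\<^sup>t (S + exp (- \<bar>x\<bar>) * S\<^sup>2)\<close>. Bounding \<open>S\<^sup>2\<close> by a multiple of \<open>S\<close> and
  using \<open>v\<^bsup>1/2\<^esup> exp (- \<bar>x\<bar>) \<in> L\<^sup>1\<close> gives the \<open>L\<^sup>2\<close> bound with weight \<open>\<phi>\<^bsup>1/2\<^esup>\<close>. It puts \<open>\<phi> S\<^sup>2\<close> in \<open>L\<^sup>1\<close>,
  and Young's inequality with \<open>v exp (- \<bar>x\<bar>) \<in> L\<^sup>p\<close> gives the second bound.
\<close>

section \<open>Fourier inversion for continuous square integrable functions\<close>

text \<open>The kernel \<open>exp (- \<bar>x\<bar>) * v x\<close> is only known to lie in L^p and
  need not be integrable, so a weighted L^p norm of \<open>S\<close> cannot be closed by Gronwall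
  directly. The square in the source is what helps: \<open>\<phi> * S^2\<close> is the square of
  \<open>sqrt \<phi> * S\<close>, and \<open>sqrt \<phi>\<close> is moderate with respect to
  \<open>sqrt v\<close>, whose kernel is integrable. So the L^2 norm is closed first; afterwards the
  nonlocal term is a known forcing and Gronwall acts only in time, label by label.

  Gronwall in L^2 absorbs a norm into itself and so needs it finite beforehand. Nothing of the kind
  is known for \<open>t > 0\<close>, so the weight is first cut off to
  \<open>min (\<phi> x) (n * exp (- \<bar>x\<bar>))\<close>, with constants free of
  \<open>n\<close>.

  Uniqueness compares two flows label by label. The kernel \<open>dq\<close> jumps at 0, but both
  flows preserve the order of labels, so the jump sits at the same label for both and cancels.

  Since the Sobolev norm rests on a chosen Fourier transform, pointwise facts about \<open>u\<close>
  require an inversion theorem. It is made quantitative, so that applied to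
  \<open>u \<tau> - u t\<close> it yields uniform continuity in time.\<close>

lemma ennreal_power2_le_iff: "(x::ennreal)\<^sup>2 \<le> y\<^sup>2 \<longleftrightarrow> x \<le> y"
proof
  assume h: "x\<^sup>2 \<le> y\<^sup>2"
  show "x \<le> y"
  proof (cases y)
    case (real s)
    with h have "x\<^sup>2 \<le> ennreal (s\<^sup>2)" by (simp only: ennreal_power)
    hence "x\<^sup>2 < \<infinity>" using le_less_trans[OF _ ennreal_less_top] by auto
    hence "x < \<infinity>" by (simp add: power_less_top_ennreal)
    then obtain r where r: "x = ennreal r" "0 \<le> r" by (cases x) auto
    hence "r\<^sup>2 \<le> s\<^sup>2" using h real by (simp only: ennreal_power ennreal_le_iff zero_le_power2)
    thus ?thesis using r real by (auto intro: ennreal_leI power2_le_imp_le)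
  qed simp
qed (rule power_mono_ennreal)

text \<open>Squaring removes the case split on infinity and the \<open>enn2real\<close> conversions,
  so L^2 estimates can be carried out in \<open>ennreal\<close> with no finiteness side
  condition.\<close>

lemma Lp_norm_2_power2: "(Lp_norm 2 h)\<^sup>2 = (\<integral>\<^sup>+ x. ennreal ((norm (h x))\<^sup>2) \<partial>lborel)"
proof -
  have two: "enn2real 2 = 2"
    by (metis enn2real_ennreal ennreal_numeral zero_le_numeral)
  have "Lp_norm 2 h = (let I = (\<integral>\<^sup>+ x. ennreal ((norm (h x))\<^sup>2) \<partial>lborel)
          in if I = \<infinity> then \<infinity> else ennreal (sqrt (enn2real I)))"
    by (simp add: Lp_norm_def powr_half_sqrt two cong: if_cong)
  thus ?thesis
    by (cases "\<integral>\<^sup>+ x. ennreal ((norm (h x))\<^sup>2) \<partial>lborel")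
      (auto simp: Let_def ennreal_power)
qed

lemma Lp_norm_2_le_iff:
  "Lp_norm 2 h \<le> K \<longleftrightarrow> (\<integral>\<^sup>+ x. ennreal ((norm (h x))\<^sup>2) \<partial>lborel) \<le> K\<^sup>2"
  by (simp flip: Lp_norm_2_power2 add: ennreal_power2_le_iff)

lemma Lp_norm_2_finite_iff:
  "Lp_norm 2 h < \<infinity> \<longleftrightarrow> (\<integral>\<^sup>+ x. ennreal ((norm (h x))\<^sup>2) \<partial>lborel) < \<infinity>"
  by (simp flip: Lp_norm_2_power2 add: power_less_top_ennreal)

text \<open>A crude form of Minkowski's inequality from
  \<open>(a + b)^2 \<le> 2 * a^2 + 2 * b^2\<close>. The lost factor is harmless, because the bound
  is used only for finiteness and for limits equal to 0.\<close>

lemma Lp_norm_2_diff_le: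
  fixes a b :: "real \<Rightarrow> 'a :: {real_normed_vector, second_countable_topology}"
  assumes [measurable]: "a \<in> borel_measurable borel" "b \<in> borel_measurable borel"
  shows "Lp_norm 2 (\<lambda>x. a x - b x) \<le> 2 * (Lp_norm 2 a + Lp_norm 2 b)"
  unfolding Lp_norm_2_le_iff
proof -
  have "ennreal ((norm (a x - b x))\<^sup>2) \<le> 2 * ennreal ((norm (a x))\<^sup>2) + 2 * ennreal ((norm (b x))\<^sup>2)" for x
  proof -
    have "(norm (a x - b x))\<^sup>2 \<le> (norm (a x) + norm (b x))\<^sup>2"
      by (intro power_mono norm_triangle_ineq4) auto
    also have "\<dots> \<le> 2 * (norm (a x))\<^sup>2 + 2 * (norm (b x))\<^sup>2"
      using zero_le_power2[of "norm (a x) - norm (b x)"] by (simp add: power2_eq_square algebra_simps)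
    finally have "ennreal ((norm (a x - b x))\<^sup>2) \<le> ennreal (2 * (norm (a x))\<^sup>2 + 2 * (norm (b x))\<^sup>2)"
      by (rule ennreal_leI)
    thus ?thesis by (simp add: ennreal_mult)
  qed
  hence "(\<integral>\<^sup>+ x. ennreal ((norm (a x - b x))\<^sup>2) \<partial>lborel)
      \<le> (\<integral>\<^sup>+ x. 2 * ennreal ((norm (a x))\<^sup>2) + 2 * ennreal ((norm (b x))\<^sup>2) \<partial>lborel)"
    by (intro nn_integral_mono) auto
  also have "\<dots> = 2 * (Lp_norm 2 a)\<^sup>2 + 2 * (Lp_norm 2 b)\<^sup>2"
    by (simp add: Lp_norm_2_power2 nn_integral_add nn_integral_cmult)
  also have "\<dots> \<le> (2 * (Lp_norm 2 a + Lp_norm 2 b))\<^sup>2"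
  proof -
    let ?A = "Lp_norm 2 a" and ?B = "Lp_norm 2 b"
    have "2 * ?A\<^sup>2 + 2 * ?B\<^sup>2 \<le> 2 * (?A + ?B)\<^sup>2 + 2 * (?A + ?B)\<^sup>2"
      by (intro add_mono mult_left_mono power_mono_ennreal) auto
    also have "\<dots> = (2 * (?A + ?B))\<^sup>2"
      unfolding power_mult_distrib distrib_right[symmetric] by simp
    finally show ?thesis .
  qed
  finally show "(\<integral>\<^sup>+ x. ennreal ((norm (a x - b x))\<^sup>2) \<partial>lborel) \<le> (2 * (Lp_norm 2 a + Lp_norm 2 b))\<^sup>2" .
qed

lemma borel_measurable_cis [measurable]: "cis \<in> borel_measurable borel"
  by (intro borel_measurable_continuous_onI continuous_intros)

lemma measurable_fourier_truncated:
  assumes [measurable]: "h \<in> borel_measurable borel"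
  shows "fourier_truncated R h \<in> borel_measurable borel"
  unfolding fourier_truncated_def set_lebesgue_integral_def by measurable

lemma integrable_truncated:
  fixes h :: "real \<Rightarrow> real"
  assumes "continuous_on UNIV h"
  shows "integrable lborel (\<lambda>x. indicator {-R..R} x * h x)"
  using borel_integrable_atLeastAtMost'[of "-R" R h] continuous_on_subset[OF assms]
  unfolding set_integrable_def by (simp)

lemma integrable_truncated_cis:
  fixes h :: "real \<Rightarrow> real"
  assumes "continuous_on UNIV h"
  shows "integrable lborel (\<lambda>x. indicator {-R..R} x *\<^sub>R (complex_of_real (h x) * cis (- (x * \<xi>))))"
  unfolding set_integrable_def[symmetric]
  by (intro borel_integrable_atLeastAtMost' continuous_intros continuous_on_subset[OF assms]) simp

lemma fourier_truncated_diff: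
  assumes "continuous_on UNIV h1" "continuous_on UNIV h2"
  shows "fourier_truncated R (\<lambda>x. h1 x - h2 x) \<xi> = fourier_truncated R h1 \<xi> - fourier_truncated R h2 \<xi>"
proof -
  have "(\<lambda>x. indicator {-R..R} x *\<^sub>R (complex_of_real (h1 x - h2 x) * cis (- (x * \<xi>)))) =
      (\<lambda>x. indicator {-R..R} x *\<^sub>R (complex_of_real (h1 x) * cis (- (x * \<xi>))) -
        indicator {-R..R} x *\<^sub>R (complex_of_real (h2 x) * cis (- (x * \<xi>))))"
    by (auto simp: algebra_simps)
  thus ?thesis
    unfolding fourier_truncated_def set_lebesgue_integral_def
    by (simp add: Bochner_Integration.integral_diff[OF integrable_truncated_cis[OF assms(1)] integrable_truncated_cis[OF assms(2)]]
        scaleR_diff_right)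
qed

text \<open>The function \<open>fourier_L2\<close> is defined by choice, so a statement about
  \<open>sobolev_norm\<close> of \<open>u \<tau> - u t\<close> has content only once some transform
  of this difference is known to exist.\<close>

lemma is_fourier_L2_diff:
  assumes h: "continuous_on UNIV h1" "continuous_on UNIV h2"
    and w: "is_fourier_L2 h1 w1" "is_fourier_L2 h2 w2"
  shows "is_fourier_L2 (\<lambda>x. h1 x - h2 x) (\<lambda>\<xi>. w1 \<xi> - w2 \<xi>)"
proof -
  have [measurable]: "w1 \<in> borel_measurable borel" "w2 \<in> borel_measurable borel"
    "h1 \<in> borel_measurable borel" "h2 \<in> borel_measurable borel"
    using w by (auto simp: is_fourier_L2_def in_Lp_def)
  note measurable_fourier_truncated[measurable]
  have fin: "Lp_norm 2 h1 < \<infinity>" "Lp_norm 2 h2 < \<infinity>" "Lp_norm 2 w1 < \<infinity>" "Lp_norm 2 w2 < \<infinity>"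
    using w by (auto simp: is_fourier_L2_def in_Lp_def)
  have *: "2 * (a + b) < \<infinity>" if "a < \<infinity>" "b < \<infinity>" for a b :: ennreal
    using that by (auto simp: ennreal_mult_less_top)
  have "in_Lp 2 (\<lambda>x. h1 x - h2 x)"
    unfolding in_Lp_def using le_less_trans[OF Lp_norm_2_diff_le[of h1 h2] *] fin by simp
  moreover have "in_Lp 2 (\<lambda>x. w1 x - w2 x)"
    unfolding in_Lp_def using le_less_trans[OF Lp_norm_2_diff_le[of w1 w2] *] fin by simp
  moreover have "((\<lambda>R. Lp_norm 2 (\<lambda>\<xi>. (w1 \<xi> - w2 \<xi>) - fourier_truncated R (\<lambda>x. h1 x - h2 x) \<xi>)) \<longlongrightarrow> 0) at_top"
  proof (rule tendsto_sandwich[OF _ _ tendsto_const])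
    let ?F = "\<lambda>R. 2 * (Lp_norm 2 (\<lambda>\<xi>. w1 \<xi> - fourier_truncated R h1 \<xi>) + Lp_norm 2 (\<lambda>\<xi>. w2 \<xi> - fourier_truncated R h2 \<xi>))"
    have "Lp_norm 2 (\<lambda>\<xi>. (w1 \<xi> - w2 \<xi>) - fourier_truncated R (\<lambda>x. h1 x - h2 x) \<xi>) \<le> ?F R" for R
    proof -
      have "(\<lambda>\<xi>. (w1 \<xi> - w2 \<xi>) - fourier_truncated R (\<lambda>x. h1 x - h2 x) \<xi>) =
         (\<lambda>\<xi>. (w1 \<xi> - fourier_truncated R h1 \<xi>) - (w2 \<xi> - fourier_truncated R h2 \<xi>))"
        by (auto simp: fourier_truncated_diff[OF h])
      thus ?thesis by (simp only:) (intro Lp_norm_2_diff_le; measurable)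
    qed
    thus "\<forall>\<^sub>F R in at_top. Lp_norm 2 (\<lambda>\<xi>. (w1 \<xi> - w2 \<xi>) - fourier_truncated R (\<lambda>x. h1 x - h2 x) \<xi>) \<le> ?F R"
      by simp
    have "(?F \<longlongrightarrow> 2 * (0 + 0)) at_top"
      using w by (intro ennreal_tendsto_cmult tendsto_add) (auto simp: is_fourier_L2_def)
    thus "(?F \<longlongrightarrow> 0) at_top" by simp
  qed auto
  ultimately show ?thesis by (simp add: is_fourier_L2_def)
qed

lemma integrable_L2_mult:
  fixes a :: "real \<Rightarrow> 'a :: {real_normed_algebra, banach, second_countable_topology}"
  assumes [measurable]: "a \<in> borel_measurable borel" "b \<in> borel_measurable borel"
    and "integrable lborel (\<lambda>x. (norm (a x))\<^sup>2)" "integrable lborel (\<lambda>x. (norm (b x))\<^sup>2)"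
  shows "integrable lborel (\<lambda>x. a x * b x)"
proof (rule Bochner_Integration.integrable_bound)
  show "integrable lborel (\<lambda>x. (norm (a x))\<^sup>2 + (norm (b x))\<^sup>2)"
    using assms by simp
  have "norm (a x * b x) \<le> (norm (a x))\<^sup>2 + (norm (b x))\<^sup>2" for x
  proof -
    have "norm (a x * b x) \<le> norm (a x) * norm (b x)" by (rule norm_mult_ineq)
    also have "\<dots> \<le> (norm (a x))\<^sup>2 + (norm (b x))\<^sup>2"
    proof -
      have "2 * (norm (a x) * norm (b x)) \<le> (norm (a x))\<^sup>2 + (norm (b x))\<^sup>2"
        using zero_le_power2[of "norm (a x) - norm (b x)"] by (simp add: power2_eq_square algebra_simps)
      moreover have "0 \<le> norm (a x) * norm (b x)" by simp
      ultimately show ?thesis by linarith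
    qed
    finally show ?thesis .
  qed
  thus "AE x in lborel. norm (a x * b x) \<le> norm ((norm (a x))\<^sup>2 + (norm (b x))\<^sup>2)" by simp
qed simp

lemma in_Lp_2_integrable:
  assumes "in_Lp 2 h"
  shows "integrable lborel (\<lambda>x. (norm (h x))\<^sup>2)"
  using assms Lp_norm_2_finite_iff[of h] by (auto simp: in_Lp_def integrable_iff_bounded)

section \<open>Gaussian regularisation of the Fourier integral\<close>

lemma integral_gauss: "(LINT x|lborel. exp (- x\<^sup>2 / 2)) = sqrt (2 * pi)"
  and integrable_gauss: "integrable lborel (\<lambda>x::real. exp (- x\<^sup>2 / 2))"
proof -
  have eq: "(\<lambda>x. exp (- x\<^sup>2 / 2)) = (\<lambda>x. sqrt (2 * pi) * std_normal_density x)"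
    by (auto simp: std_normal_density_def)
  show "(LINT x|lborel. exp (- x\<^sup>2 / 2)) = sqrt (2 * pi)"
    unfolding eq by (simp add: integral_normal_density)
  show "integrable lborel (\<lambda>x::real. exp (- x\<^sup>2 / 2))"
    unfolding eq by simp
qed

lemma fourier_gauss:
  fixes t :: real
  shows "(CLINT \<xi>|lborel. std_normal_density \<xi> *\<^sub>R cis (t * \<xi>)) = exp (- t\<^sup>2 / 2)"
proof -
  have "(CLINT \<xi>|lborel. std_normal_density \<xi> *\<^sub>R cis (t * \<xi>)) = char std_normal_distribution t"
    unfolding char_def
    by (subst integral_density) (auto simp: cis_conv_exp normal_density_nonneg mult.commute)
  thus ?thesis by (simp add: char_std_normal_distribution)
qed

text \<open>Damping the frequencies at scale \<open>n\<close> produces an approximate identity of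
  width \<open>1 / n\<close>; the formula is the self-duality of the Gaussian after rescaling
  \<open>\<xi>\<close>.\<close>

lemma gauss_kernel_fourier:
  fixes y x :: real and n :: real
  assumes "n > 0"
  shows "(CLINT \<xi>|lborel. std_normal_density (\<xi> / n) *\<^sub>R (cis (x * \<xi>) * cis (- (y * \<xi>)))) =
    n * exp (- (n * (x - y))\<^sup>2 / 2)"
proof -
  have "(CLINT \<xi>|lborel. std_normal_density (\<xi> / n) *\<^sub>R (cis (x * \<xi>) * cis (- (y * \<xi>)))) =
     n *\<^sub>R (CLINT \<xi>|lborel. std_normal_density \<xi> *\<^sub>R cis (n * (x - y) * \<xi>))"
    using assms
    by (subst lborel_integral_real_affine[where c = n and t = 0])
      (auto simp: cis_mult algebra_simps)
  thus ?thesis unfolding fourier_gauss by (simp add: scaleR_conv_of_real)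
qed

text \<open>Cauchy-Schwarz. If the product is not integrable, its Bochner integral is 0 by
  convention and the bound is trivial.\<close>

lemma integral_L2_norm_bound:
  fixes a b :: "real \<Rightarrow> complex"
  assumes [measurable]: "a \<in> borel_measurable borel" "b \<in> borel_measurable borel"
  shows "ennreal (norm (LINT x|lborel. a x * b x)) \<le> Lp_norm 2 a * Lp_norm 2 b"
proof -
  have "(ennreal (norm (LINT x|lborel. a x * b x)))\<^sup>2 \<le> (\<integral>\<^sup>+x. ennreal (norm (a x * b x)) \<partial>lborel)\<^sup>2"
    by (cases "integrable lborel (\<lambda>x. a x * b x)")
      (auto intro!: power_mono_ennreal integral_norm_bound_ennreal simp: not_integrable_integral_eq)
  also have "\<dots> = (\<integral>\<^sup>+x. ennreal (norm (a x)) * ennreal (norm (b x)) \<partial>lborel)\<^sup>2"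
    by (simp add: norm_mult ennreal_mult)
  also have "\<dots> \<le> (\<integral>\<^sup>+x. (ennreal (norm (a x)))\<^sup>2 \<partial>lborel) * (\<integral>\<^sup>+x. (ennreal (norm (b x)))\<^sup>2 \<partial>lborel)"
    by (rule Cauchy_Schwarz_nn_integral) auto
  also have "\<dots> = (Lp_norm 2 a * Lp_norm 2 b)\<^sup>2"
    by (simp add: Lp_norm_2_power2 power_mult_distrib ennreal_power)
  finally show ?thesis by (simp add: ennreal_power2_le_iff)
qed

text \<open>Fubini is legitimate because the truncation makes \<open>h\<close> absolutely integrable
  and the Gaussian does the same in \<open>\<xi>\<close>. For \<open>h\<close> itself, which is
  merely in L^2, the exchange would not be available.\<close>

lemma fourier_truncated_gauss:
  fixes h :: "real \<Rightarrow> real" and n x R :: real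
  assumes h: "continuous_on UNIV h" and n: "n > 0"
  shows "(CLINT \<xi>|lborel. fourier_truncated R h \<xi> * (std_normal_density (\<xi> / n) *\<^sub>R cis (x * \<xi>))) =
     (1 / sqrt (2 * pi)) *\<^sub>R (CLINT y|lborel. indicator {-R..R} y *\<^sub>R complex_of_real (h y) * (n * exp (- (n * (x - y))\<^sup>2 / 2)))"
proof -
  have [measurable]: "h \<in> borel_measurable borel"
    using h by (rule borel_measurable_continuous_onI)
  let ?f = "\<lambda>y \<xi>. (indicator {-R..R} y *\<^sub>R complex_of_real (h y)) * (std_normal_density (\<xi> / n) *\<^sub>R (cis (x * \<xi>) * cis (- (y * \<xi>))))"
  have g: "integrable lborel (\<lambda>\<xi>. std_normal_density (\<xi> / n))"
    using lborel_integrable_real_affine[of std_normal_density "1/n" 0] n by simp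
  have int: "integrable (lborel \<Otimes>\<^sub>M lborel) (\<lambda>(y, \<xi>). ?f y \<xi>)"
  proof (rule lborel_pair.Fubini_integrable)
    show "(\<lambda>(y, \<xi>). ?f y \<xi>) \<in> borel_measurable (lborel \<Otimes>\<^sub>M lborel)" by measurable
    have "integrable lborel (\<lambda>y. \<bar>indicator {-R..R} y * h y\<bar> * (\<integral>\<xi>. std_normal_density (\<xi> / n) \<partial>lborel))"
      using integrable_truncated[OF h, of R] by simp
    also have "(\<lambda>y. \<bar>indicator {-R..R} y * h y\<bar> * (\<integral>\<xi>. std_normal_density (\<xi> / n) \<partial>lborel)) =
       (\<lambda>y. \<integral>\<xi>. norm ((\<lambda>(y, \<xi>). ?f y \<xi>) (y, \<xi>)) \<partial>lborel)"
      by (auto simp: norm_mult abs_mult normal_density_nonneg)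
    finally show "integrable lborel (\<lambda>y. \<integral>\<xi>. norm ((\<lambda>(y, \<xi>). ?f y \<xi>) (y, \<xi>)) \<partial>lborel)" .
    have "integrable lborel (\<lambda>\<xi>. ?f y \<xi>)" for y
    proof (intro integrable_mult_right)
      show "integrable lborel (\<lambda>\<xi>. std_normal_density (\<xi> / n) *\<^sub>R (cis (x * \<xi>) * cis (- (y * \<xi>))))"
        by (rule Bochner_Integration.integrable_bound[OF g]) (auto simp: norm_mult)
    qed
    thus "AE y in lborel. integrable lborel (\<lambda>\<xi>. (\<lambda>(y, \<xi>). ?f y \<xi>) (y, \<xi>))" by simp
  qed
  have "(CLINT \<xi>|lborel. fourier_truncated R h \<xi> * (std_normal_density (\<xi> / n) *\<^sub>R cis (x * \<xi>))) =
     (CLINT \<xi>|lborel. (1 / sqrt (2 * pi)) *\<^sub>R (CLINT y|lborel. ?f y \<xi>))"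
  proof (rule Bochner_Integration.integral_cong[OF refl])
    fix \<xi> :: real
    have "(CLINT y|lborel. ?f y \<xi>) = (CLINT y|lborel. (indicator {-R..R} y *\<^sub>R (complex_of_real (h y) * cis (- (y * \<xi>)))) * (std_normal_density (\<xi> / n) *\<^sub>R cis (x * \<xi>)))"
      by (rule Bochner_Integration.integral_cong) (auto simp: algebra_simps)
    thus "fourier_truncated R h \<xi> * (std_normal_density (\<xi> / n) *\<^sub>R cis (x * \<xi>)) =
       (1 / sqrt (2 * pi)) *\<^sub>R (CLINT y|lborel. ?f y \<xi>)"
      unfolding fourier_truncated_def set_lebesgue_integral_def integral_mult_left_zero by simp
  qed
  also have "\<dots> = (1 / sqrt (2 * pi)) *\<^sub>R (CLINT \<xi>|lborel. CLINT y|lborel. ?f y \<xi>)"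
    by simp
  also have "(CLINT \<xi>|lborel. CLINT y|lborel. ?f y \<xi>) = (CLINT y|lborel. CLINT \<xi>|lborel. ?f y \<xi>)"
    using lborel_pair.Fubini_integral[OF int] by simp
  also have "\<dots> = (CLINT y|lborel. indicator {-R..R} y *\<^sub>R complex_of_real (h y) * (n * exp (- (n * (x - y))\<^sup>2 / 2)))"
    unfolding integral_mult_right_zero gauss_kernel_fourier[OF n] ..
  finally show ?thesis .
qed

lemma integrable_gauss_mult:
  fixes h :: "real \<Rightarrow> real" and x :: real
  assumes h: "continuous_on UNIV h" and h2: "integrable lborel (\<lambda>x. (h x)\<^sup>2)"
  shows "integrable lborel (\<lambda>y. h y * (real (Suc n) * exp (- (real (Suc n) * (x - y))\<^sup>2 / 2)))"
proof (rule integrable_L2_mult)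
  show "h \<in> borel_measurable borel"
    using h by (rule borel_measurable_continuous_onI)
  let ?m = "real (Suc n)"
  \<comment> \<open>Squaring the Gaussian doubles its exponent, which is a dilation by
    \<open>sqrt 2\<close>.\<close>
  let ?a = "sqrt 2 * ?m"
  have "integrable lborel (\<lambda>y::real. ?m\<^sup>2 * exp (- (?a * x + (- ?a) * y)\<^sup>2 / 2))"
    using lborel_integrable_real_affine[OF integrable_gauss, of "- ?a" "?a * x"] by simp
  also have "(\<lambda>y::real. ?m\<^sup>2 * exp (- (?a * x + (- ?a) * y)\<^sup>2 / 2)) = (\<lambda>y. (norm (?m * exp (- (?m * (x - y))\<^sup>2 / 2)))\<^sup>2)"
  proof
    fix y :: real
    have "?a * x + (- ?a) * y = sqrt 2 * (?m * (x - y))" by (simp add: algebra_simps)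
    hence "(?a * x + (- ?a) * y)\<^sup>2 = 2 * (?m * (x - y))\<^sup>2" by (simp only: power_mult_distrib) simp
    thus "?m\<^sup>2 * exp (- (?a * x + (- ?a) * y)\<^sup>2 / 2) = (norm (?m * exp (- (?m * (x - y))\<^sup>2 / 2)))\<^sup>2"
      by (simp add: power_mult_distrib flip: exp_double)
  qed
  finally show "integrable lborel (\<lambda>y. (norm (?m * exp (- (?m * (x - y))\<^sup>2 / 2)))\<^sup>2)" .
qed (use h2 in auto)

text \<open>The line is split at the unit neighbourhood \<open>A\<close> of \<open>x\<close>. On
  \<open>A\<close> the function is bounded and the substitution \<open>y = x + z / n\<close> gives a
  fixed Gaussian as majorant; off \<open>A\<close> all kernels are dominated by the first
  one.\<close>

lemma gauss_approx:
  fixes h :: "real \<Rightarrow> real" and x :: real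
  assumes h: "continuous_on UNIV h" and h2: "integrable lborel (\<lambda>x. (h x)\<^sup>2)"
  shows "(\<lambda>n. LINT y|lborel. h y * (real (Suc n) * exp (- (real (Suc n) * (x - y))\<^sup>2 / 2))) \<longlonglongrightarrow> sqrt (2 * pi) * h x"
proof -
  have [measurable]: "h \<in> borel_measurable borel"
    using h by (rule borel_measurable_continuous_onI)
  define k where "k = (\<lambda>n y. h y * (real (Suc n) * exp (- (real (Suc n) * (x - y))\<^sup>2 / 2)))"
  have [measurable]: "k n \<in> borel_measurable borel" for n unfolding k_def by measurable
  define A where "A = {x-1..x+1}"
  have [measurable]: "A \<in> sets borel" by (simp add: A_def)
  have dom: "integrable lborel (\<lambda>y. h y * exp (- (x - y)\<^sup>2 / 2))"
    using integrable_gauss_mult[OF h h2, of 0 x] by simp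
  have tail: "(\<lambda>n. LINT y|lborel. indicator (- A) y * k n y) \<longlonglongrightarrow> integral\<^sup>L lborel (\<lambda>y::real. 0)"
  proof (rule integral_dominated_convergence[where w = "\<lambda>y. norm (h y * exp (- (x - y)\<^sup>2 / 2))"])
    show "integrable lborel (\<lambda>y. norm (h y * exp (- (x - y)\<^sup>2 / 2)))" using dom by (rule integrable_norm)
    show "AE y in lborel. (\<lambda>n. indicator (- A) y * k n y) \<longlonglongrightarrow> 0"
    proof (rule AE_I2)
      fix y
      show "(\<lambda>n. indicator (- A) y * k n y) \<longlonglongrightarrow> 0"
      proof (cases "y \<in> A")
        case False
        define c where "c = (x - y)\<^sup>2 / 2"
        have c: "c > 0" using False by (auto simp: c_def A_def)
        have "(\<lambda>n. real (Suc n) * exp (- c * (real (Suc n))\<^sup>2)) \<longlonglongrightarrow> 0"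
          using c by real_asymp
        hence "(\<lambda>n. h y * (real (Suc n) * exp (- c * (real (Suc n))\<^sup>2))) \<longlonglongrightarrow> h y * 0"
          by (intro tendsto_mult_left)
        moreover have "indicator (- A) y * k n y = h y * (real (Suc n) * exp (- c * (real (Suc n))\<^sup>2))" for n
          using False unfolding k_def c_def by (simp only: power_mult_distrib) (simp add: mult_ac)
        ultimately show ?thesis by simp
      qed simp
    qed
    fix n
    show "AE y in lborel. norm (indicator (- A) y * k n y) \<le> norm (h y * exp (- (x - y)\<^sup>2 / 2))"
    proof (rule AE_I2)
      fix y
      \<comment> \<open>With \<open>m = real (Suc n)\<close> and \<open>(x - y)^2 \<ge> 1\<close>
        one has \<open>m \<le> 1 + (m^2 - 1) / 2 \<le> exp ((m^2 - 1) * (x - y)^2 / 2)\<close>, so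
        the kernel with parameter \<open>m\<close> lies below the one with parameter 1.\<close>
      have "real (Suc n) * exp (- (real (Suc n) * (x - y))\<^sup>2 / 2) \<le> exp (- (x - y)\<^sup>2 / 2)" if "y \<notin> A"
      proof -
        let ?m = "real (Suc n)"
        have z: "(x - y)\<^sup>2 \<ge> 1" using that by (auto simp: A_def abs_le_iff not_le intro!: abs_square_le_1[THEN iffD1]
            simp flip: abs_le_square_iff[of 1, simplified])
        have "?m \<le> 1 + (?m\<^sup>2 - 1) / 2"
          using zero_le_power2[of "?m - 1"] by (simp add: power2_eq_square field_simps)
        also have "\<dots> \<le> 1 + (?m\<^sup>2 - 1) * (x - y)\<^sup>2 / 2"
          using mult_left_mono[OF z, of "?m\<^sup>2 - 1"] by simp
        also have "\<dots> \<le> exp ((?m\<^sup>2 - 1) * (x - y)\<^sup>2 / 2)"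
          by (rule exp_ge_add_one_self)
        finally have "?m * exp (- (?m * (x - y))\<^sup>2 / 2) \<le> exp ((?m\<^sup>2 - 1) * (x - y)\<^sup>2 / 2) * exp (- (?m * (x - y))\<^sup>2 / 2)"
          by (rule mult_right_mono) simp
        also have "\<dots> = exp (- (x - y)\<^sup>2 / 2)"
          unfolding exp_add[symmetric] power_mult_distrib by (simp add: field_simps)
        finally show ?thesis .
      qed
      thus "norm (indicator (- A) y * k n y) \<le> norm (h y * exp (- (x - y)\<^sup>2 / 2))"
        by (auto simp: k_def abs_mult indicator_def intro!: mult_left_mono)
    qed
  qed auto
  obtain B where B: "\<And>y. y \<in> A \<Longrightarrow> \<bar>h y\<bar> \<le> B" and "B \<ge> 0"
  proof -
    have "compact (h ` A)" unfolding A_def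
      by (intro compact_continuous_image continuous_on_subset[OF h]) auto
    from compact_imp_bounded[OF this] that show ?thesis
      unfolding bounded_pos by (metis imageI less_imp_le real_norm_def)
  qed
  have main: "(\<lambda>n. LINT y|lborel. indicator A y * k n y) \<longlonglongrightarrow> (LINT z|lborel. h x * exp (- z\<^sup>2 / 2))"
  proof -
    let ?y = "\<lambda>n z. x + (1 / real (Suc n)) * z"
    let ?f = "\<lambda>n z. indicator A (?y n z) * h (?y n z) * exp (- z\<^sup>2 / 2)"
    have eq: "(LINT y|lborel. indicator A y * k n y) =
      (LINT z|lborel. ?f n z)" for n
      by (subst lborel_integral_real_affine[where c = "1 / real (Suc n)" and t = x])
        (auto simp: k_def integral_mult_right_zero[symmetric] simp del: integral_mult_right_zero intro!: Bochner_Integration.integral_cong)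
    have lim: "(\<lambda>n. x + (1 / real (Suc n)) * z) \<longlonglongrightarrow> x" for z
      by real_asymp
    show ?thesis unfolding eq
    proof (rule integral_dominated_convergence)
      show "integrable lborel (\<lambda>z::real. B * exp (- z\<^sup>2 / 2))"
        using integrable_gauss by simp
      show "AE z in lborel. (\<lambda>n. ?f n z)
          \<longlonglongrightarrow> h x * exp (- z\<^sup>2 / 2)"
      proof (rule AE_I2)
        fix z :: real
        have "(\<lambda>n. h (?y n z) * exp (- z\<^sup>2 / 2)) \<longlonglongrightarrow> h x * exp (- z\<^sup>2 / 2)"
          using continuous_on_tendsto_compose[OF h lim] by (intro tendsto_mult_right) auto
        moreover have "\<forall>\<^sub>F n in sequentially. h (?y n z) * exp (- z\<^sup>2 / 2) =
            ?f n z"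
          using eventually_conj[OF order_tendstoD(1)[OF lim[of z], of "x-1"] order_tendstoD(2)[OF lim[of z], of "x+1"]]
          by (simp only: A_def) (auto elim!: eventually_mono)
        ultimately show "(\<lambda>n. ?f n z)
          \<longlonglongrightarrow> h x * exp (- z\<^sup>2 / 2)"
          by (rule Lim_transform_eventually)
      qed
      fix n
      show "AE z in lborel. norm (?f n z)
          \<le> B * exp (- z\<^sup>2 / 2)"
        using B \<open>B \<ge> 0\<close> by (auto simp: indicator_def abs_mult intro!: AE_I2 mult_right_mono)
    qed measurable
  qed
  have "integrable lborel (k n)" for n
    unfolding k_def by (rule integrable_gauss_mult[OF h h2])
  hence i: "integrable lborel (\<lambda>y. indicator A y * k n y)" "integrable lborel (\<lambda>y. indicator (- A) y * k n y)" for n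
    using integrable_mult_indicator[of A lborel "k n"] integrable_mult_indicator[of "- A" lborel "k n"] by auto
  have "(LINT y|lborel. k n y) = (LINT y|lborel. indicator A y * k n y) + (LINT y|lborel. indicator (- A) y * k n y)" for n
  proof -
    have "(LINT y|lborel. k n y) = (LINT y|lborel. indicator A y * k n y + indicator (- A) y * k n y)"
      by (intro Bochner_Integration.integral_cong) (auto simp: indicator_def)
    thus ?thesis using Bochner_Integration.integral_add[OF i(1)[of n] i(2)[of n]] by simp
  qed
  with tendsto_add[OF main tail]
  have "(\<lambda>n. LINT y|lborel. k n y) \<longlonglongrightarrow> (LINT z|lborel. h x * exp (- z\<^sup>2 / 2))" by simp
  thus ?thesis unfolding k_def integral_mult_right_zero integral_gauss by (simp only: mult.commute)
qed

text \<open>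
  Pairing the truncated transforms with the Gaussians \<open>\<psi> n\<close> turns inversion into the convergence
  of an approximate identity; only continuity of \<open>h\<close> and \<open>h \<in> L\<^sup>2\<close> are available, so the
  mass away from \<open>x\<close> is handled by domination rather than by boundedness of \<open>h\<close>.
\<close>

lemma fourier_inversion:
  fixes h :: "real \<Rightarrow> real" and w :: "real \<Rightarrow> complex"
  assumes hw: "is_fourier_L2 h w" and h: "continuous_on UNIV h" and w: "integrable lborel w"
  shows "complex_of_real (h x) = (1 / sqrt (2 * pi)) *\<^sub>R (CLINT \<xi>|lborel. w \<xi> * cis (x * \<xi>))"
proof -
  have [measurable]: "h \<in> borel_measurable borel" "w \<in> borel_measurable borel"
    using hw by (auto simp: is_fourier_L2_def in_Lp_def)
  have h2: "integrable lborel (\<lambda>x. (h x)\<^sup>2)"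
    using in_Lp_2_integrable[of h] hw by (simp add: is_fourier_L2_def)
  note measurable_fourier_truncated[measurable]
  define \<psi> where "\<psi> n \<xi> = std_normal_density (\<xi> / real (Suc n)) *\<^sub>R cis (x * \<xi>)" for n \<xi>
  have [measurable]: "\<psi> n \<in> borel_measurable borel" for n unfolding \<psi>_def by measurable
  let ?F = "\<lambda>R. fourier_truncated R h" and ?W = "\<lambda>n. CLINT \<xi>|lborel. w \<xi> * \<psi> n \<xi>"
  define c where "c n y = real (Suc n) * exp (- (real (Suc n) * (x - y))\<^sup>2 / 2)" for n y
  have psi_bound: "norm (\<psi> n \<xi>) \<le> 1 / sqrt (2 * pi)" for n \<xi>
    unfolding \<psi>_def by (simp add: std_normal_density_def divide_right_mono)
  have psi_w: "integrable lborel (\<lambda>\<xi>. w \<xi> * \<psi> n \<xi>)" for n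
  proof (rule Bochner_Integration.integrable_bound)
    show "integrable lborel (\<lambda>\<xi>. norm (w \<xi>) * (1 / sqrt (2 * pi)))" using w by simp
    show "AE \<xi> in lborel. norm (w \<xi> * \<psi> n \<xi>) \<le> norm (norm (w \<xi>) * (1 / sqrt (2 * pi)))"
      using mult_left_mono[OF psi_bound norm_ge_zero] by (auto simp: norm_mult)
  qed measurable
  have psi2: "Lp_norm 2 (\<psi> n) < \<infinity>" for n
    unfolding Lp_norm_2_finite_iff
  proof -
    have "(\<integral>\<^sup>+ \<xi>. ennreal ((norm (\<psi> n \<xi>))\<^sup>2) \<partial>lborel) \<le> (\<integral>\<^sup>+ \<xi>. ennreal (std_normal_density (\<xi> / real (Suc n))) \<partial>lborel)"
    proof (rule nn_integral_mono)
      fix \<xi>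
      have "(norm (\<psi> n \<xi>))\<^sup>2 \<le> std_normal_density (\<xi> / real (Suc n)) * 1"
        unfolding power2_eq_square
      proof (rule mult_mono)
        show "norm (\<psi> n \<xi>) \<le> 1"
          using psi_bound[of n \<xi>] pi_gt3 by (rule_tac order_trans) (auto simp: real_sqrt_ge_1_iff)
      qed (auto simp: \<psi>_def normal_density_nonneg)
      thus "ennreal ((norm (\<psi> n \<xi>))\<^sup>2) \<le> ennreal (std_normal_density (\<xi> / real (Suc n)))"
        by (intro ennreal_leI) simp
    qed
    also have "\<dots> < \<infinity>"
      using lborel_integrable_real_affine[OF integrable_normal_density[of 1 0], of "1/real (Suc n)" 0]
      by (auto simp: integrable_iff_bounded normal_density_nonneg)
    finally show "(\<integral>\<^sup>+ \<xi>. ennreal ((norm (\<psi> n \<xi>))\<^sup>2) \<partial>lborel) < \<infinity>" .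
  qed
  have psi_int: "integrable lborel (\<psi> n)" for n
  proof (rule Bochner_Integration.integrable_bound)
    show "integrable lborel (\<lambda>\<xi>. std_normal_density (\<xi> / real (Suc n)))"
      using lborel_integrable_real_affine[of std_normal_density "1/real (Suc n)" 0] by simp
  qed (auto simp: \<psi>_def)
  have trunc_int: "integrable lborel (\<lambda>\<xi>. ?F R \<xi> * \<psi> n \<xi>)" for R n
  proof (rule Bochner_Integration.integrable_bound)
    let ?C = "LINT y|lborel. norm (indicator {-R..R} y * h y)"
    show "integrable lborel (\<lambda>\<xi>. ?C * norm (\<psi> n \<xi>))" using psi_int by simp
    have "norm (?F R \<xi>) \<le> ?C" for \<xi>
    proof -
      have "norm (?F R \<xi>) \<le> 1 * norm (LINT x:{-R..R}|lborel. complex_of_real (h x) * cis (- (x * \<xi>)))"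
        unfolding fourier_truncated_def norm_scaleR
        by (rule mult_right_mono) (use pi_gt3 in \<open>auto simp: real_sqrt_ge_1_iff\<close>)
      also have "\<dots> \<le> (LINT x|lborel. norm (indicator {-R..R} x *\<^sub>R (complex_of_real (h x) * cis (- (x * \<xi>)))))"
        unfolding set_lebesgue_integral_def mult_1 by (rule integral_norm_bound)
      also have "\<dots> = ?C" by (simp add: norm_mult abs_mult)
      finally show ?thesis .
    qed
    thus "AE \<xi> in lborel. norm (?F R \<xi> * \<psi> n \<xi>) \<le> norm (?C * norm (\<psi> n \<xi>))"
      by (auto simp: norm_mult intro!: mult_right_mono order_trans[OF _ abs_ge_self])
  qed measurable
  \<comment> \<open>Both sides are limits of the truncated pairings: the left one by L^2 convergence
    of the truncated transforms tested against \<open>\<psi> n\<close> in L^2, the right one by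
    Fubini on each truncation and dominated convergence as the truncation is removed.\<close>
  have gauss_id: "?W n = (1 / sqrt (2 * pi)) *\<^sub>R complex_of_real (LINT y|lborel. h y * c n y)" for n
  proof (rule LIMSEQ_unique)
    let ?G = "\<lambda>m::nat. CLINT \<xi>|lborel. ?F (real m) \<xi> * \<psi> n \<xi>"
    let ?N = "\<lambda>m. Lp_norm 2 (\<psi> n) * Lp_norm 2 (\<lambda>\<xi>. w \<xi> - ?F (real m) \<xi>)"
    have diff: "w \<xi> * \<psi> n \<xi> - ?F R \<xi> * \<psi> n \<xi> = (w \<xi> - ?F R \<xi>) * \<psi> n \<xi>" for \<xi> R
      by (simp add: algebra_simps)
    have "(\<lambda>m. ennreal (norm (?W n - ?G m))) \<longlonglongrightarrow> 0"
    proof (rule tendsto_sandwich[OF _ _ tendsto_const])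
      have "ennreal (norm (?W n - ?G m)) \<le> ?N m" for m
        unfolding Bochner_Integration.integral_diff[OF psi_w trunc_int, symmetric] diff
        by (subst mult.commute) (rule integral_L2_norm_bound; measurable)
      thus "\<forall>\<^sub>F m in sequentially. ennreal (norm (?W n - ?G m)) \<le> ?N m"
        by simp
      have "(\<lambda>m. Lp_norm 2 (\<lambda>\<xi>. w \<xi> - ?F (real m) \<xi>)) \<longlonglongrightarrow> 0"
        using hw filterlim_compose[OF _ filterlim_real_sequentially] unfolding is_fourier_L2_def by blast
      hence "?N \<longlonglongrightarrow> Lp_norm 2 (\<psi> n) * 0"
        by (intro ennreal_tendsto_cmult) (use psi2 in auto)
      thus "?N \<longlonglongrightarrow> 0" by simp
    qed auto
    hence "(\<lambda>m. norm (?W n - ?G m)) \<longlonglongrightarrow> 0"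
      by (subst (asm) ennreal_0[symmetric], subst (asm) tendsto_ennreal_iff) auto
    hence "(\<lambda>m. dist (?G m) (?W n)) \<longlonglongrightarrow> 0"
      by (simp only: dist_norm norm_minus_commute)
    thus "?G \<longlonglongrightarrow> ?W n" by (rule tendsto_dist_iff[THEN iffD2])
    have eq: "?G m = (1 / sqrt (2 * pi)) *\<^sub>R (CLINT y|lborel. indicator {-real m..real m} y *\<^sub>R complex_of_real (h y * c n y))" for m
      unfolding \<psi>_def by (subst fourier_truncated_gauss[OF h]) (simp_all add: c_def)
    have k: "integrable lborel (\<lambda>y. h y * c n y)"
      unfolding c_def by (rule integrable_gauss_mult[OF h h2])
    show "?G \<longlonglongrightarrow> (1 / sqrt (2 * pi)) *\<^sub>R complex_of_real (LINT y|lborel. h y * c n y)"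
      unfolding eq integral_complex_of_real[symmetric]
    proof (intro tendsto_scaleR tendsto_const, rule integral_dominated_convergence[where w="\<lambda>y. norm (h y * c n y)"])
      show "AE y in lborel. (\<lambda>m. indicator {-real m..real m} y *\<^sub>R complex_of_real (h y * c n y)) \<longlonglongrightarrow> complex_of_real (h y * c n y)"
      proof (rule AE_I2)
        fix y
        obtain m0 :: nat where "\<bar>y\<bar> \<le> real m0" using real_arch_simple by blast
        hence "\<forall>\<^sub>F m in sequentially. indicator {-real m..real m} y *\<^sub>R complex_of_real (h y * c n y) = complex_of_real (h y * c n y)"
          by (intro eventually_sequentiallyI[of m0]) (auto simp: indicator_def)
        thus "(\<lambda>m. indicator {-real m..real m} y *\<^sub>R complex_of_real (h y * c n y)) \<longlonglongrightarrow> complex_of_real (h y * c n y)"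
          by (rule tendsto_eventually)
      qed
      show "AE y in lborel. norm (indicator {-real m..real m} y *\<^sub>R complex_of_real (h y * c n y)) \<le> norm (h y * c n y)" for m
        by (auto simp: indicator_def simp del: of_real_mult)
      show "(\<lambda>y. complex_of_real (h y * c n y)) \<in> borel_measurable lborel"
        "(\<lambda>y. indicator {-real m..real m} y *\<^sub>R complex_of_real (h y * c n y)) \<in> borel_measurable lborel" for m
        unfolding c_def by measurable
      show "integrable lborel (\<lambda>y. norm (h y * c n y))" by (rule integrable_norm[OF k])
    qed
  qed
  \<comment> \<open>Integrability of \<open>w\<close> provides the majorant. The density at 0,
    \<open>1 / sqrt (2 * pi)\<close>, survives the limit and becomes the normalising constant of the
    inversion formula.\<close>
  have L1: "?W \<longlonglongrightarrow> (CLINT \<xi>|lborel. w \<xi> * ((1 / sqrt (2 * pi)) *\<^sub>R cis (x * \<xi>)))"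
  proof (rule integral_dominated_convergence[where w="\<lambda>\<xi>. norm (w \<xi>) * (1 / sqrt (2 * pi))"])
    show "AE \<xi> in lborel. (\<lambda>n. w \<xi> * \<psi> n \<xi>) \<longlonglongrightarrow> w \<xi> * ((1 / sqrt (2 * pi)) *\<^sub>R cis (x * \<xi>))"
    proof (rule AE_I2)
      fix \<xi>
      have "(\<lambda>n. \<xi> / real (Suc n)) \<longlonglongrightarrow> 0" by real_asymp
      hence "(\<lambda>n. std_normal_density (\<xi> / real (Suc n))) \<longlonglongrightarrow> (1 / sqrt (2 * pi)) * exp (- 0\<^sup>2 / 2)"
        unfolding std_normal_density_def by (intro tendsto_intros) auto
      thus "(\<lambda>n. w \<xi> * \<psi> n \<xi>) \<longlonglongrightarrow> w \<xi> * ((1 / sqrt (2 * pi)) *\<^sub>R cis (x * \<xi>))"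
        unfolding \<psi>_def by (intro tendsto_intros) auto
    qed
    show "AE \<xi> in lborel. norm (w \<xi> * \<psi> n \<xi>) \<le> norm (w \<xi>) * (1 / sqrt (2 * pi))" for n
      using mult_left_mono[OF psi_bound norm_ge_zero] by (auto simp: norm_mult)
  qed (use w in auto)
  have L2: "?W \<longlonglongrightarrow> (1 / sqrt (2 * pi)) *\<^sub>R complex_of_real (sqrt (2 * pi) * h x)"
    unfolding gauss_id
    by (intro tendsto_scaleR tendsto_const tendsto_of_real) (unfold c_def, rule gauss_approx[OF h h2])
  show ?thesis using LIMSEQ_unique[OF L1 L2] by (simp add: scaleR_conv_of_real)
qed

section \<open>The Sobolev embedding\<close>

abbreviation bessel_norm :: "real \<Rightarrow> (real \<Rightarrow> complex) \<Rightarrow> ennreal" where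
  "bessel_norm s w \<equiv> Lp_norm 2 (\<lambda>\<xi>. (1 + \<xi>\<^sup>2) powr (s / 2) *\<^sub>R w \<xi>)"

text \<open>The integrand decays like \<open>\<bar>\<xi>\<bar> powr (2 - 2 * s)\<close>, and
  \<open>2 - 2 * s < -1\<close> says exactly \<open>s > 3 / 2\<close>.\<close>

lemma nn_integral_sobolev_weight:
  fixes s :: real
  assumes s: "s > 3 / 2"
  shows "(\<integral>\<^sup>+\<xi>. ennreal ((1 + \<xi>\<^sup>2) powr (1 - s)) \<partial>lborel) < \<infinity>"
proof -
  define e where "e = 2 - 2 * s"
  have e: "e < -1" using s by (simp add: e_def)
  let ?f = "\<lambda>x. ennreal (indicator {1..} x * x powr e)"
  let ?I = "\<integral>\<^sup>+x. ?f x \<partial>lborel"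
  have half: "?I < \<infinity>"
    using nn_integral_has_integral_lebesgue[OF _ has_integral_powr_to_inf[OF e, of 1]]
    by simp
  have "(\<integral>\<^sup>+\<xi>. ennreal ((1 + \<xi>\<^sup>2) powr (1 - s)) \<partial>lborel)
      \<le> (\<integral>\<^sup>+\<xi>. indicator {-1..1} \<xi> + (?f \<xi> + ?f (- \<xi>)) \<partial>lborel)"
  proof (rule nn_integral_mono)
    fix \<xi> :: real
    show "ennreal ((1 + \<xi>\<^sup>2) powr (1 - s)) \<le>
      indicator {-1..1} \<xi> + (?f \<xi> + ?f (- \<xi>))"
    proof (cases "\<xi> \<in> {-1..1}")
      case True
      have "(1 + \<xi>\<^sup>2) powr (1 - s) \<le> 1" using s powr_mono[of "1 - s" 0 "1 + \<xi>\<^sup>2"] add_pos_nonneg[of 1 "\<xi>\<^sup>2"] by simp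
      hence "ennreal ((1 + \<xi>\<^sup>2) powr (1 - s)) \<le> 1" by (simp flip: ennreal_1)
      thus ?thesis using True by (simp add: add_increasing2)
    next
      case False
      have "(1 + \<xi>\<^sup>2) powr (1 - s) \<le> (\<bar>\<xi>\<bar>\<^sup>2) powr (1 - s)"
        by (rule powr_mono2') (use False s in auto)
      also have "\<dots> = \<bar>\<xi>\<bar> powr e"
        using False by (simp add: e_def powr_powr powr_numeral[symmetric] right_diff_distrib del: power2_abs powr_numeral)
      finally show ?thesis using False
        by (cases "\<xi> > 0") (auto simp: indicator_def intro!: ennreal_leI)
    qed
  qed
  also have "\<dots> = (\<integral>\<^sup>+\<xi>. indicator {-1..1::real} \<xi> \<partial>lborel) + (?I +
     (\<integral>\<^sup>+\<xi>. ?f (- \<xi>) \<partial>lborel))"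
    by (simp add: nn_integral_add)
  also have "(\<integral>\<^sup>+\<xi>. ?f (- \<xi>) \<partial>lborel) = ?I"
    using nn_integral_real_affine[of ?f "-1" 0] by simp
  also have "(\<integral>\<^sup>+\<xi>. indicator {-1..1::real} \<xi> \<partial>lborel) + (?I +
     ?I) < \<infinity>"
    using half by simp
  finally show ?thesis .
qed

text \<open>Cauchy-Schwarz against
  \<open>(1 + \<bar>\<xi>\<bar>) * (1 + \<xi>^2) powr (- s / 2)\<close>, whose square is at most
  \<open>2 * (1 + \<xi>^2) powr (1 - s)\<close>; hence \<open>sqrt (2 * D)\<close>. The factor
  \<open>1 + \<bar>\<xi>\<bar>\<close> controls a function and its first derivative at once.\<close>

lemma fourier_weight_L1:
  fixes s :: real
  assumes s: "s > 3 / 2"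
  shows "\<exists>C\<ge>0. \<forall>w :: real \<Rightarrow> complex. w \<in> borel_measurable borel \<longrightarrow>
    (\<integral>\<^sup>+\<xi>. ennreal ((1 + \<bar>\<xi>\<bar>) * norm (w \<xi>)) \<partial>lborel)
      \<le> ennreal C * bessel_norm s w"
proof -
  obtain D where D: "D \<ge> 0" "(\<integral>\<^sup>+\<xi>. ennreal ((1 + \<xi>\<^sup>2) powr (1 - s)) \<partial>lborel) = ennreal D"
    using nn_integral_sobolev_weight[OF s] by (cases "\<integral>\<^sup>+\<xi>. ennreal ((1 + \<xi>\<^sup>2) powr (1 - s)) \<partial>lborel") auto
  have "(\<integral>\<^sup>+\<xi>. ennreal ((1 + \<bar>\<xi>\<bar>) * norm (w \<xi>)) \<partial>lborel)
      \<le> ennreal (sqrt (2 * D)) * bessel_norm s w"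
    if [measurable]: "w \<in> borel_measurable borel" for w :: "real \<Rightarrow> complex"
  proof -
    let ?a = "\<lambda>\<xi>::real. (1 + \<bar>\<xi>\<bar>) * (1 + \<xi>\<^sup>2) powr (- s / 2)"
    let ?b = "\<lambda>\<xi>::real. norm ((1 + \<xi>\<^sup>2) powr (s / 2) *\<^sub>R w \<xi>)"
    have pos: "1 + \<xi>\<^sup>2 > 0" for \<xi> :: real by (rule add_pos_nonneg) auto
    have "ennreal ((1 + \<bar>\<xi>\<bar>) * norm (w \<xi>)) = ennreal (?a \<xi>) * ennreal (?b \<xi>)" for \<xi>
    proof -
      have "(1 + \<bar>\<xi>\<bar>) * norm (w \<xi>) = ?a \<xi> * ?b \<xi>"
        using pos[of \<xi>] by (simp add: powr_minus field_simps)
      thus ?thesis by (simp only:) (rule ennreal_mult; simp)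
    qed
    hence "(\<integral>\<^sup>+\<xi>. ennreal ((1 + \<bar>\<xi>\<bar>) * norm (w \<xi>)) \<partial>lborel)\<^sup>2 = (\<integral>\<^sup>+\<xi>. ennreal (?a \<xi>) * ennreal (?b \<xi>) \<partial>lborel)\<^sup>2"
      by (simp only:)
    also have "\<dots> \<le> (\<integral>\<^sup>+\<xi>. (ennreal (?a \<xi>))\<^sup>2 \<partial>lborel) * (\<integral>\<^sup>+\<xi>. (ennreal (?b \<xi>))\<^sup>2 \<partial>lborel)"
      by (rule Cauchy_Schwarz_nn_integral) measurable
    also have "(\<integral>\<^sup>+\<xi>. (ennreal (?b \<xi>))\<^sup>2 \<partial>lborel) = (bessel_norm s w)\<^sup>2"
      by (simp add: Lp_norm_2_power2 ennreal_power)
    also have "(\<integral>\<^sup>+\<xi>. (ennreal (?a \<xi>))\<^sup>2 \<partial>lborel) \<le> (\<integral>\<^sup>+\<xi>. ennreal 2 * ennreal ((1 + \<xi>\<^sup>2) powr (1 - s)) \<partial>lborel)"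
    proof (rule nn_integral_mono)
      fix \<xi> :: real
      have "(?a \<xi>)\<^sup>2 = (1 + \<bar>\<xi>\<bar>)\<^sup>2 * (1 + \<xi>\<^sup>2) powr (- s)"
        using pos[of \<xi>] by (simp add: power_mult_distrib powr_powr flip: powr_numeral[of "_ powr _"])
      also have "\<dots> \<le> (2 * (1 + \<xi>\<^sup>2)) * (1 + \<xi>\<^sup>2) powr (- s)"
        using zero_le_power2[of "1 - \<bar>\<xi>\<bar>"]
        by (intro mult_right_mono) (auto simp: power2_eq_square algebra_simps)
      also have "\<dots> = 2 * (1 + \<xi>\<^sup>2) powr (1 - s)"
        using pos[of \<xi>] powr_add[of "1 + \<xi>\<^sup>2" 1 "- s"] by simp
      finally show "(ennreal (?a \<xi>))\<^sup>2 \<le> ennreal 2 * ennreal ((1 + \<xi>\<^sup>2) powr (1 - s))"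
        by (subst ennreal_power) (auto simp flip: ennreal_mult simp del: ennreal_numeral intro!: ennreal_leI)
    qed
    also have "\<dots> = (ennreal (sqrt (2 * D)))\<^sup>2"
      using D(1) by (simp add: nn_integral_cmult D(2) ennreal_power ennreal_mult)
    finally have "(\<integral>\<^sup>+\<xi>. ennreal ((1 + \<bar>\<xi>\<bar>) * norm (w \<xi>)) \<partial>lborel)\<^sup>2
      \<le> (ennreal (sqrt (2 * D)) * bessel_norm s w)\<^sup>2"
      by (simp add: power_mult_distrib mult_right_mono)
    thus ?thesis by (simp add: ennreal_power2_le_iff)
  qed
  thus ?thesis using D(1) by (intro exI[of _ "sqrt (2 * D)"]) auto
qed

lemma norm_cis_diff_le: "norm (cis a - cis b) \<le> \<bar>a - b\<bar>"
proof -
  have "norm (cis a - cis b) = norm (cis b * (cis (a - b) - 1))"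
    by (simp add: algebra_simps cis_mult)
  also have "\<dots> = norm (cis (a - b) - 1)" by (simp add: norm_mult)
  also have "\<dots> \<le> \<bar>a - b\<bar>"
    using iexp_approx1[of "a - b" 0] by (simp add: cis_conv_exp)
  finally show ?thesis .
qed

text \<open>Differentiation under the integral:
  \<open>(1 + \<bar>\<xi>\<bar>) * norm (w \<xi>)\<close> dominates the integrand, its derivative
  and, by \<open>norm_cis_diff_le\<close>, all difference quotients. The prefactor
  \<open>1 / sqrt (2 * pi)\<close> is below 1 and is dropped, so \<open>N\<close> bounds both
  \<open>h\<close> and \<open>h'\<close>.\<close>

lemma fourier_integral_C1:
  fixes w :: "real \<Rightarrow> complex"
  assumes w: "w \<in> borel_measurable borel"
    and N: "(\<integral>\<^sup>+\<xi>. ennreal ((1 + \<bar>\<xi>\<bar>) * norm (w \<xi>)) \<partial>lborel) \<le> ennreal N" and "N \<ge> 0"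
    and h: "\<And>x. complex_of_real (h x) = (1 / sqrt (2 * pi)) *\<^sub>R (CLINT \<xi>|lborel. w \<xi> * cis (x * \<xi>))"
  obtains h' where "\<And>x. (h has_real_derivative h' x) (at x)" "continuous_on UNIV h'"
    "\<And>x. \<bar>h x\<bar> \<le> N" "\<And>x. \<bar>h' x\<bar> \<le> N"
proof -
  note [measurable] = w
  define W where "W = (\<lambda>\<xi>. (1 + \<bar>\<xi>\<bar>) * norm (w \<xi>))"
  have W: "integrable lborel W" "(LINT \<xi>|lborel. W \<xi>) \<le> N"
  proof -
    have fin: "(\<integral>\<^sup>+\<xi>. ennreal (W \<xi>) \<partial>lborel) < \<infinity>" using N le_less_trans by (fastforce simp: W_def)
    show "integrable lborel W"
      by (rule integrableI_nonneg) (use fin in \<open>auto simp: W_def\<close>)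
    show "(LINT \<xi>|lborel. W \<xi>) \<le> N"
      using N \<open>N \<ge> 0\<close> unfolding W_def by (subst integral_eq_nn_integral) (auto simp: enn2real_leI)
  qed
  have le: "(1 / sqrt (2 * pi)) * r \<le> r" if "r \<ge> 0" for r
    using mult_right_mono[OF _ that, of "1 / sqrt (2 * pi)" 1] pi_gt3 by (simp add: real_sqrt_ge_1_iff)
  define k where "k x \<xi> = w \<xi> * (\<i> * of_real \<xi> * cis (x * \<xi>))" for x \<xi>
  have [measurable]: "k x \<in> borel_measurable borel" for x unfolding k_def by measurable
  have k_le: "norm (k x \<xi>) \<le> W \<xi>" for x \<xi>
    by (simp add: k_def W_def norm_mult algebra_simps)
  have w_le: "norm (w \<xi> * cis (x * \<xi>)) \<le> W \<xi>" for x \<xi>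
    using mult_right_mono[of 1 "1 + \<bar>\<xi>\<bar>" "norm (w \<xi>)"] by (simp add: W_def norm_mult)
  have wint: "integrable lborel (\<lambda>\<xi>. w \<xi> * cis (x * \<xi>))" for x
    by (rule Bochner_Integration.integrable_bound[OF W(1)])
      (use w_le in \<open>auto intro!: order_trans[OF _ abs_ge_self]\<close>)
  have bd: "norm ((1 / sqrt (2 * pi)) *\<^sub>R integral\<^sup>L lborel f) \<le> N" if "\<And>\<xi>. norm (f \<xi>) \<le> W \<xi>" "f \<in> borel_measurable borel" for f :: "real \<Rightarrow> complex"
  proof -
    have fint: "integrable lborel f"
      by (rule Bochner_Integration.integrable_bound[OF W(1)])
        (use that in \<open>auto intro!: AE_I2 order_trans[OF _ abs_ge_self]\<close>)
    have "norm (integral\<^sup>L lborel f) \<le> (LINT \<xi>|lborel. W \<xi>)"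
      by (rule Bochner_Integration.integral_norm_bound_integral)
        (use that W(1) fint in auto)
    hence "norm (integral\<^sup>L lborel f) \<le> N" using W(2) by linarith
    thus ?thesis using le[of "norm (integral\<^sup>L lborel f)"] by simp
  qed
  define h' where "h' x = Re ((1 / sqrt (2 * pi)) *\<^sub>R (CLINT \<xi>|lborel. k x \<xi>))" for x
  have lim: "(\<lambda>n. CLINT \<xi>|lborel. w \<xi> * ((cis (X n * \<xi>) - cis (x * \<xi>)) / of_real (X n - x))) \<longlonglongrightarrow> (CLINT \<xi>|lborel. k x \<xi>)"
    if X: "X \<longlonglongrightarrow> x" "\<And>n. X n \<noteq> x" for X :: "nat \<Rightarrow> real" and x
  proof (rule integral_dominated_convergence[where w = W])
    let ?D = "\<lambda>n \<xi>. w \<xi> * ((cis (X n * \<xi>) - cis (x * \<xi>)) / of_real (X n - x))"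
    show "AE \<xi> in lborel. (\<lambda>n. ?D n \<xi>) \<longlonglongrightarrow> k x \<xi>"
    proof (rule AE_I2)
      fix \<xi> :: real
      have "((\<lambda>z. exp (\<i> * (z * of_real \<xi>))) has_field_derivative (\<i> * of_real \<xi> * exp (\<i> * (of_real x * of_real \<xi>)))) (at (of_real x))"
        by (auto intro!: derivative_eq_intros)
      hence "((\<lambda>z. (exp (\<i> * (z * of_real \<xi>)) - exp (\<i> * (of_real x * of_real \<xi>))) / (z - of_real x)) \<longlongrightarrow> \<i> * of_real \<xi> * exp (\<i> * (of_real x * of_real \<xi>))) (at (complex_of_real x))"
        by (simp add: has_field_derivative_iff)
      hence "((\<lambda>z. (exp (\<i> * (z * of_real \<xi>)) - exp (\<i> * (of_real x * of_real \<xi>))) / (z - of_real x)) \<circ> (\<lambda>n. complex_of_real (X n))) \<longlonglongrightarrow> \<i> * of_real \<xi> * exp (\<i> * (of_real x * of_real \<xi>))"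
        unfolding tendsto_at_iff_sequentially using X tendsto_of_real[OF X(1), where 'a = complex] by force
      hence "(\<lambda>n. (cis (X n * \<xi>) - cis (x * \<xi>)) / of_real (X n - x)) \<longlonglongrightarrow> \<i> * of_real \<xi> * cis (x * \<xi>)"
        by (simp add: o_def cis_conv_exp)
      thus "(\<lambda>n. ?D n \<xi>) \<longlonglongrightarrow> k x \<xi>"
        unfolding k_def by (intro tendsto_mult_left)
    qed
    fix n
    have "norm (?D n \<xi>) \<le> W \<xi>" for \<xi>
    proof -
      have "norm (cis (X n * \<xi>) - cis (x * \<xi>)) \<le> \<bar>X n - x\<bar> * \<bar>\<xi>\<bar>"
        using norm_cis_diff_le[of "X n * \<xi>" "x * \<xi>"] by (simp add: abs_mult flip: left_diff_distrib)
      hence "norm ((cis (X n * \<xi>) - cis (x * \<xi>)) / of_real (X n - x)) \<le> \<bar>\<xi>\<bar>"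
        using X(2)[of n] by (simp add: norm_divide divide_le_eq mult.commute flip: of_real_diff)
      also have "\<dots> \<le> 1 + \<bar>\<xi>\<bar>" by simp
      finally show ?thesis unfolding W_def norm_mult
        by (subst mult.commute) (rule mult_right_mono, auto)
    qed
    thus "AE \<xi> in lborel. norm (?D n \<xi>) \<le> W \<xi>"
      by simp
  qed (use W in auto)
  have der: "(h has_real_derivative h' x) (at x)" for x
    unfolding has_field_derivative_iff tendsto_at_iff_sequentially
  proof (intro allI impI)
    fix X :: "nat \<Rightarrow> real" assume X: "\<forall>i. X i \<in> UNIV - {x}" "X \<longlonglongrightarrow> x"
    have hRe: "h y = Re ((1 / sqrt (2 * pi)) *\<^sub>R (CLINT \<xi>|lborel. w \<xi> * cis (y * \<xi>)))" for y
      by (metis Re_complex_of_real h)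
    have "(h (X n) - h x) / (X n - x) = Re ((1 / sqrt (2 * pi)) *\<^sub>R (CLINT \<xi>|lborel. w \<xi> * ((cis (X n * \<xi>) - cis (x * \<xi>)) / of_real (X n - x))))" for n
    proof -
      have "(CLINT \<xi>|lborel. w \<xi> * ((cis (X n * \<xi>) - cis (x * \<xi>)) / of_real (X n - x))) =
        (CLINT \<xi>|lborel. (w \<xi> * cis (X n * \<xi>) - w \<xi> * cis (x * \<xi>)) / of_real (X n - x))"
        by (simp add: right_diff_distrib)
      also have "\<dots> = ((CLINT \<xi>|lborel. w \<xi> * cis (X n * \<xi>)) - (CLINT \<xi>|lborel. w \<xi> * cis (x * \<xi>))) / of_real (X n - x)"
        by (simp only: integral_divide_zero Bochner_Integration.integral_diff[OF wint wint])
      finally show ?thesis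
        unfolding hRe by (simp only: Re_divide_of_real scaleR_complex.sel minus_complex.sel) (simp add: field_simps)
    qed
    moreover have "(\<lambda>n. Re ((1 / sqrt (2 * pi)) *\<^sub>R (CLINT \<xi>|lborel. w \<xi> * ((cis (X n * \<xi>) - cis (x * \<xi>)) / of_real (X n - x))))) \<longlonglongrightarrow> h' x"
      unfolding h'_def using X by (intro tendsto_Re tendsto_scaleR tendsto_const lim) auto
    ultimately show "((\<lambda>y. (h y - h x) / (y - x)) \<circ> X) \<longlonglongrightarrow> h' x"
      by (simp add: o_def)
  qed
  have "continuous_on UNIV h'"
    unfolding continuous_on_sequentially
  proof (intro ballI allI impI, elim conjE)
    fix X :: "nat \<Rightarrow> real" and x assume X: "X \<longlonglongrightarrow> x"
    have "(\<lambda>n. CLINT \<xi>|lborel. k (X n) \<xi>) \<longlonglongrightarrow> (CLINT \<xi>|lborel. k x \<xi>)"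
    proof (rule integral_dominated_convergence[where w = W])
      have "isCont cis a" for a using continuous_on_cis[of UNIV "\<lambda>x. x"] by (simp add: continuous_on_eq_continuous_at)
      hence "(\<lambda>n. k (X n) \<xi>) \<longlonglongrightarrow> k x \<xi>" for \<xi>
        unfolding k_def by (intro tendsto_intros isCont_tendsto_compose[of _ cis] X)
      thus "AE \<xi> in lborel. (\<lambda>n. k (X n) \<xi>) \<longlonglongrightarrow> k x \<xi>" by simp
    qed (use W k_le in auto)
    thus "(h' \<circ> X) \<longlonglongrightarrow> h' x"
      unfolding h'_def o_def by (intro tendsto_Re tendsto_scaleR tendsto_const)
  qed
  moreover have "\<bar>h x\<bar> \<le> N" for x
  proof -
    have "norm (complex_of_real (h x)) \<le> N"
      unfolding h by (rule bd) (use w_le in auto)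
    thus ?thesis by simp
  qed
  moreover have "\<bar>h' x\<bar> \<le> N" for x
    unfolding h'_def by (rule order_trans[OF abs_Re_le_cmod bd]) (use k_le in auto)
  ultimately show ?thesis using that der by blast
qed

text \<open>The constant is chosen before \<open>h\<close> and \<open>w\<close>. Applied to
  \<open>u \<tau> - u t\<close>, the lemma therefore turns convergence in the Sobolev norm into
  uniform convergence of the functions and of their derivatives.\<close>

lemma sobolev_C1:
  fixes s :: real
  assumes s: "s > 3 / 2"
  obtains C where "C \<ge> 0" "\<And>h w. is_fourier_L2 h w \<Longrightarrow> continuous_on UNIV h \<Longrightarrow>
      bessel_norm s w < \<infinity> \<Longrightarrow>
      \<exists>h'. (\<forall>x. (h has_real_derivative h' x) (at x)) \<and> continuous_on UNIV h' \<and>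
        (\<forall>x. \<bar>h x\<bar> \<le> C * enn2real (bessel_norm s w) \<and>
          \<bar>h' x\<bar> \<le> C * enn2real (bessel_norm s w))"
proof -
  obtain C where C: "C \<ge> 0" "\<And>w :: real \<Rightarrow> complex. w \<in> borel_measurable borel \<Longrightarrow>
    (\<integral>\<^sup>+\<xi>. ennreal ((1 + \<bar>\<xi>\<bar>) * norm (w \<xi>)) \<partial>lborel)
      \<le> ennreal C * bessel_norm s w"
    using fourier_weight_L1[OF s] by blast
  show ?thesis
  proof (rule that[OF C(1)])
    fix h w assume hw: "is_fourier_L2 h w" and h: "continuous_on UNIV h"
      and fin: "bessel_norm s w < \<infinity>" (is "?L < \<infinity>")
    have w[measurable]: "w \<in> borel_measurable borel" using hw by (auto simp: is_fourier_L2_def in_Lp_def)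
    have N: "(\<integral>\<^sup>+\<xi>. ennreal ((1 + \<bar>\<xi>\<bar>) * norm (w \<xi>)) \<partial>lborel) \<le> ennreal (C * enn2real ?L)"
      using C(2)[OF w] fin C(1) by (simp add: ennreal_mult)
    have "integrable lborel w"
    proof (rule integrableI_bounded)
      have "(\<integral>\<^sup>+\<xi>. ennreal (norm (w \<xi>)) \<partial>lborel) \<le> (\<integral>\<^sup>+\<xi>. ennreal ((1 + \<bar>\<xi>\<bar>) * norm (w \<xi>)) \<partial>lborel)"
        by (intro nn_integral_mono ennreal_leI) (simp add: distrib_right)
      also note N
      finally show "(\<integral>\<^sup>+\<xi>. ennreal (norm (w \<xi>)) \<partial>lborel) < \<infinity>" by (rule le_less_trans) simp
    qed simp
    obtain h' where "\<And>x. (h has_real_derivative h' x) (at x)" "continuous_on UNIV h'"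
      "\<And>x. \<bar>h x\<bar> \<le> C * enn2real ?L" "\<And>x. \<bar>h' x\<bar> \<le> C * enn2real ?L"
      by (rule fourier_integral_C1[OF w N _ fourier_inversion[OF hw h \<open>integrable lborel w\<close>]]) (use C(1) in auto)
    thus "\<exists>h'. (\<forall>x. (h has_real_derivative h' x) (at x)) \<and> continuous_on UNIV h' \<and>
        (\<forall>x. \<bar>h x\<bar> \<le> C * enn2real ?L \<and> \<bar>h' x\<bar> \<le> C * enn2real ?L)"
      by blast
  qed
qed

section \<open>From uniform continuity in time to joint continuity and global bounds\<close>

lemma continuous_on_Times_uniform:
  fixes F :: "real \<Rightarrow> real \<Rightarrow> real"
  assumes cont: "\<And>t. t \<in> S \<Longrightarrow> continuous_on UNIV (F t)"
    and unif: "\<And>t e. t \<in> S \<Longrightarrow> e > 0 \<Longrightarrow> \<exists>d>0. \<forall>\<tau>\<in>S. \<bar>\<tau> - t\<bar> < d \<longrightarrow> (\<forall>x. \<bar>F \<tau> x - F t x\<bar> \<le> e)"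
  shows "continuous_on (S \<times> UNIV) (\<lambda>(t, x). F t x)"
  unfolding continuous_on_iff
proof (intro ballI allI impI)
  fix p and e :: real assume p: "p \<in> S \<times> (UNIV :: real set)" and "e > 0"
  obtain t x where tx: "p = (t, x)" by (cases p)
  with p have t: "t \<in> S" by simp
  from unif[OF t, of "e/3"] \<open>e > 0\<close> obtain d1 where d1: "d1 > 0" "\<And>\<tau> x. \<tau> \<in> S \<Longrightarrow> \<bar>\<tau> - t\<bar> < d1 \<Longrightarrow> \<bar>F \<tau> x - F t x\<bar> \<le> e/3" by auto
  from cont[OF t] \<open>e > 0\<close> obtain d2 where d2: "d2 > 0" "\<And>y. \<bar>y - x\<bar> < d2 \<Longrightarrow> \<bar>F t y - F t x\<bar> < e/3"
    unfolding continuous_on_iff dist_real_def by (metis UNIV_I divide_pos_pos zero_less_numeral)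
  show "\<exists>d>0. \<forall>z\<in>S \<times> UNIV. dist z p < d \<longrightarrow> dist (case z of (t, x) \<Rightarrow> F t x) (case p of (t, x) \<Rightarrow> F t x) < e"
    unfolding tx
  proof (intro exI[of _ "min d1 d2"] conjI ballI impI)
    fix z assume z: "z \<in> S \<times> (UNIV :: real set)" "dist z (t, x) < min d1 d2"
    obtain \<tau> y where zz: "z = (\<tau>, y)" by (cases z)
    have "\<bar>\<tau> - t\<bar> < d1" "\<bar>y - x\<bar> < d2"
      using z dist_fst_le[of z "(t, x)"] dist_snd_le[of z "(t, x)"] by (auto simp: zz dist_real_def)
    from d1(2)[OF _ this(1), of y] d2(2)[OF this(2)] z(1)
    have "\<bar>F \<tau> y - F t y\<bar> \<le> e/3" "\<bar>F t y - F t x\<bar> < e/3" by (auto simp: zz)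
    hence "\<bar>F \<tau> y - F t x\<bar> < e" using \<open>e > 0\<close> by linarith
    thus "dist (case z of (t, x) \<Rightarrow> F t x) (case (t, x) of (t, x) \<Rightarrow> F t x) < e"
      by (auto simp: zz dist_real_def)
  qed (use d1 d2 in auto)
qed

lemma bounded_uniform_compact:
  fixes F :: "real \<Rightarrow> real \<Rightarrow> real"
  assumes S: "compact S"
    and bd: "\<And>t. t \<in> S \<Longrightarrow> \<exists>B. \<forall>x. \<bar>F t x\<bar> \<le> B"
    and unif: "\<And>t e. t \<in> S \<Longrightarrow> e > 0 \<Longrightarrow> \<exists>d>0. \<forall>\<tau>\<in>S. \<bar>\<tau> - t\<bar> < d \<longrightarrow> (\<forall>x. \<bar>F \<tau> x - F t x\<bar> \<le> e)"
  shows "\<exists>B. \<forall>t\<in>S. \<forall>x. \<bar>F t x\<bar> \<le> B"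
proof -
  obtain B where B: "\<And>t x. t \<in> S \<Longrightarrow> \<bar>F t x\<bar> \<le> B t" using bd by metis
  obtain d where d: "\<And>t. t \<in> S \<Longrightarrow> d t > 0" "\<And>t \<tau> x. t \<in> S \<Longrightarrow> \<tau> \<in> S \<Longrightarrow> \<bar>\<tau> - t\<bar> < d t \<Longrightarrow> \<bar>F \<tau> x - F t x\<bar> \<le> 1"
    using unif[of _ 1] zero_less_one by metis
  have "S \<subseteq> (\<Union>t\<in>S. ball t (d t))" using d(1) by force
  then obtain K where K: "K \<subseteq> S" "finite K" "S \<subseteq> (\<Union>t\<in>K. ball t (d t))"
    by (rule compactE_image[OF S, rotated]) auto
  have "\<bar>F \<tau> x\<bar> \<le> (\<Sum>t\<in>K. \<bar>B t\<bar> + 1)" if \<tau>: "\<tau> \<in> S" for \<tau> x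
  proof -
    obtain t where t: "t \<in> K" "\<bar>\<tau> - t\<bar> < d t"
      using K(3) \<tau> by (auto simp: dist_real_def abs_minus_commute subset_iff)
    hence "\<bar>F \<tau> x\<bar> \<le> \<bar>B t\<bar> + 1"
      using d(2)[of t \<tau> x] B[of t x] K(1) \<tau> by force
    also have "\<dots> \<le> (\<Sum>t\<in>K. \<bar>B t\<bar> + 1)"
      using K(2) t(1) by (intro member_le_sum) auto
    finally show ?thesis .
  qed
  thus ?thesis by blast
qed

text \<open>These four facts are all that the later argument extracts from membership in the Sobolev
  space. A compactness argument in time makes the last bound uniform on the whole strip.\<close>

lemma solution_regularity:
  fixes s T :: real
  assumes s: "s > 3 / 2" and u: "C0_sobolev T s u"
    and cont: "\<And>t. t \<in> {0..T} \<Longrightarrow> continuous_on UNIV (u t)"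
  shows "t \<in> {0..T} \<Longrightarrow> (u t has_real_derivative deriv (u t) x) (at x)"
    and "continuous_on ({0..T} \<times> UNIV) (\<lambda>(t, x). u t x)"
    and "continuous_on ({0..T} \<times> UNIV) (\<lambda>(t, x). deriv (u t) x)"
    and "\<exists>M. \<forall>t\<in>{0..T}. \<forall>x. \<bar>u t x\<bar> \<le> M \<and> \<bar>deriv (u t) x\<bar> \<le> M"
proof -
  obtain C where C: "C \<ge> 0" "\<And>h w. is_fourier_L2 h w \<Longrightarrow> continuous_on UNIV h \<Longrightarrow>
      bessel_norm s w < \<infinity> \<Longrightarrow>
      \<exists>h'. (\<forall>x. (h has_real_derivative h' x) (at x)) \<and> continuous_on UNIV h' \<and>
        (\<forall>x. \<bar>h x\<bar> \<le> C * enn2real (bessel_norm s w) \<and>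
          \<bar>h' x\<bar> \<le> C * enn2real (bessel_norm s w))"
    using sobolev_C1[OF s] by blast
  have C1: "(\<forall>x. (u t has_real_derivative deriv (u t) x) (at x)) \<and> continuous_on UNIV (deriv (u t)) \<and>
      (\<exists>B. \<forall>x. \<bar>u t x\<bar> \<le> B \<and> \<bar>deriv (u t) x\<bar> \<le> B) \<and> (\<exists>w. is_fourier_L2 (u t) w)"
    if t: "t \<in> {0..T}" for t
  proof -
    from u t obtain w where w: "is_fourier_L2 (u t) w" "in_Lp 2 (\<lambda>\<xi>. (1 + \<xi>\<^sup>2) powr (s / 2) *\<^sub>R w \<xi>)"
      unfolding C0_sobolev_def sobolev_def by blast
    from C(2)[OF w(1) cont[OF t]] w(2) obtain h' where
      h': "\<And>x. (u t has_real_derivative h' x) (at x)" "continuous_on UNIV h'" "\<exists>B. \<forall>x. \<bar>u t x\<bar> \<le> B \<and> \<bar>h' x\<bar> \<le> B"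
      unfolding in_Lp_def by blast
    have "deriv (u t) = h'" using h'(1) DERIV_imp_deriv by blast
    thus ?thesis using h' w(1) by blast
  qed
  have unif: "\<exists>d>0. \<forall>\<tau>\<in>{0..T}. \<bar>\<tau> - t\<bar> < d \<longrightarrow> (\<forall>x. \<bar>u \<tau> x - u t x\<bar> \<le> e \<and> \<bar>deriv (u \<tau>) x - deriv (u t) x\<bar> \<le> e)"
    if t: "t \<in> {0..T}" and e: "e > 0" for t e
  proof -
    have "((\<lambda>\<tau>. sobolev_norm s (\<lambda>x. u \<tau> x - u t x)) \<longlongrightarrow> 0) (at t within {0..T})"
      using u t unfolding C0_sobolev_def by blast
    moreover have "0 < ennreal (e / (C + 1))" using e C(1) by simp
    ultimately have "\<forall>\<^sub>F \<tau> in at t within {0..T}. sobolev_norm s (\<lambda>x. u \<tau> x - u t x) < ennreal (e / (C + 1))"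
      by (rule order_tendstoD(2))
    then obtain d where d: "d > 0" "\<And>\<tau>. \<tau> \<in> {0..T} \<Longrightarrow> \<tau> \<noteq> t \<Longrightarrow> \<bar>\<tau> - t\<bar> < d \<Longrightarrow> sobolev_norm s (\<lambda>x. u \<tau> x - u t x) < ennreal (e / (C + 1))"
      unfolding eventually_at dist_real_def by blast
    have "\<bar>u \<tau> x - u t x\<bar> \<le> e \<and> \<bar>deriv (u \<tau>) x - deriv (u t) x\<bar> \<le> e"
      if \<tau>: "\<tau> \<in> {0..T}" "\<bar>\<tau> - t\<bar> < d" for \<tau> x
    proof (cases "\<tau> = t")
      case False
      let ?h = "\<lambda>x. u \<tau> x - u t x"
      let ?N = "sobolev_norm s ?h"
      from d(2)[OF \<tau>(1) False \<tau>(2)] have N: "?N < ennreal (e / (C + 1))" .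
      from C1[OF \<tau>(1)] C1[OF t] obtain w1 w2 where "is_fourier_L2 (u \<tau>) w1" "is_fourier_L2 (u t) w2" by blast
      from is_fourier_L2_diff[OF cont[OF \<tau>(1)] cont[OF t] this] have w: "is_fourier_L2 ?h (fourier_L2 ?h)"
        unfolding fourier_L2_def by (rule someI[where P = "is_fourier_L2 ?h"])
      have "?N < \<infinity>" using N less_trans by fastforce
      from C(2)[OF w continuous_on_diff[OF cont[OF \<tau>(1)] cont[OF t]] this[unfolded sobolev_norm_def]]
      obtain h' where h': "\<And>x. (?h has_real_derivative h' x) (at x)"
        "\<And>x. \<bar>?h x\<bar> \<le> C * enn2real ?N" "\<And>x. \<bar>h' x\<bar> \<le> C * enn2real ?N"
        unfolding sobolev_norm_def by blast
      have "(?h has_real_derivative (deriv (u \<tau>) x - deriv (u t) x)) (at x)"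
        using C1[OF \<tau>(1)] C1[OF t] by (intro derivative_intros) auto
      with h'(1)[of x] have eq: "h' x = deriv (u \<tau>) x - deriv (u t) x" by (rule DERIV_unique)
      have "enn2real ?N \<le> e / (C + 1)" using N C(1) e by (intro enn2real_leI) auto
      hence "C * enn2real ?N \<le> C * (e / (C + 1))" using C(1) by (rule mult_left_mono)
      also have "\<dots> \<le> e" using C(1) e by (simp add: field_simps)
      finally show ?thesis using h'(2,3)[of x] by (simp add: eq)
    qed (use e in simp)
    thus ?thesis using d(1) by blast
  qed
  show "t \<in> {0..T} \<Longrightarrow> (u t has_real_derivative deriv (u t) x) (at x)" using C1 by blast
  have unif1: "\<exists>d>0. \<forall>\<tau>\<in>{0..T}. \<bar>\<tau> - t\<bar> < d \<longrightarrow> (\<forall>x. \<bar>u \<tau> x - u t x\<bar> \<le> e)"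
    and unif2: "\<exists>d>0. \<forall>\<tau>\<in>{0..T}. \<bar>\<tau> - t\<bar> < d \<longrightarrow> (\<forall>x. \<bar>deriv (u \<tau>) x - deriv (u t) x\<bar> \<le> e)"
    if te: "t \<in> {0..T}" "e > 0" for t e
  proof -
    from unif[OF te] obtain d where "d > 0"
      "\<forall>\<tau>\<in>{0..T}. \<bar>\<tau> - t\<bar> < d \<longrightarrow> (\<forall>x. \<bar>u \<tau> x - u t x\<bar> \<le> e \<and> \<bar>deriv (u \<tau>) x - deriv (u t) x\<bar> \<le> e)" by blast
    thus "\<exists>d>0. \<forall>\<tau>\<in>{0..T}. \<bar>\<tau> - t\<bar> < d \<longrightarrow> (\<forall>x. \<bar>u \<tau> x - u t x\<bar> \<le> e)"
      "\<exists>d>0. \<forall>\<tau>\<in>{0..T}. \<bar>\<tau> - t\<bar> < d \<longrightarrow> (\<forall>x. \<bar>deriv (u \<tau>) x - deriv (u t) x\<bar> \<le> e)"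
      by (intro exI[of _ d]; simp)+
  qed
  show "continuous_on ({0..T} \<times> UNIV) (\<lambda>(t, x). u t x)"
    by (rule continuous_on_Times_uniform[OF cont unif1])
  show "continuous_on ({0..T} \<times> UNIV) (\<lambda>(t, x). deriv (u t) x)"
    using C1 by (intro continuous_on_Times_uniform[OF _ unif2]) auto
  have bd1: "\<exists>B. \<forall>x. \<bar>u t x\<bar> \<le> B" and bd2: "\<exists>B. \<forall>x. \<bar>deriv (u t) x\<bar> \<le> B" if "t \<in> {0..T}" for t
    using C1[OF that] by meson+
  have "\<exists>B. \<forall>t\<in>{0..T}. \<forall>x. \<bar>u t x\<bar> \<le> B"
    by (rule bounded_uniform_compact[OF _ bd1 unif1]) auto
  moreover have "\<exists>B. \<forall>t\<in>{0..T}. \<forall>x. \<bar>deriv (u t) x\<bar> \<le> B"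
    by (rule bounded_uniform_compact[OF _ bd2 unif2]) auto
  ultimately obtain B1 B2 where "\<forall>t\<in>{0..T}. \<forall>x. \<bar>u t x\<bar> \<le> B1" "\<forall>t\<in>{0..T}. \<forall>x. \<bar>deriv (u t) x\<bar> \<le> B2" by blast
  thus "\<exists>M. \<forall>t\<in>{0..T}. \<forall>x. \<bar>u t x\<bar> \<le> M \<and> \<bar>deriv (u t) x\<bar> \<le> M"
    by (intro exI[of _ "max B1 B2"]) (auto intro: max.coboundedI1 max.coboundedI2)
qed

section \<open>The flow of a Lipschitz velocity field\<close>

lemma nondecreasing_within:
  fixes f :: "real \<Rightarrow> real"
  assumes der: "\<And>t. t \<in> {a..b} \<Longrightarrow> (f has_real_derivative f' t) (at t within {a..b})"
    and nonneg: "\<And>t. t \<in> {a..b} \<Longrightarrow> f' t \<ge> 0"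
    and st: "a \<le> s" "s \<le> t" "t \<le> b"
  shows "f s \<le> f t"
proof (rule DERIV_nonneg_imp_increasing_open[OF st(2)])
  show "continuous_on {s..t} f"
    using der st by (intro continuous_on_subset[OF DERIV_continuous_on[of "{a..b}" f f']]) auto
  fix x assume x: "s < x" "x < t"
  hence ax: "a < x" "x < b" using st by auto
  hence "(f has_real_derivative f' x) (at x)"
    using der[of x] by (simp add: at_within_Icc_at[OF ax])
  thus "\<exists>y. (f has_real_derivative y) (at x) \<and> 0 \<le> y" using nonneg[of x] x st by auto
qed

text \<open>Integrating \<open>exp (r * t)\<close> gains a factor \<open>1 / r\<close>. Taking
  \<open>r\<close> large turns a Lipschitz estimate into a contraction on all of
  \<open>[0, T]\<close> at once, in place of restarting on short intervals. The proof compares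
  \<open>f\<close> and \<open>- f\<close> with \<open>c / r * exp (r * t)\<close>.\<close>

lemma deriv_exp_bound:
  fixes f :: "real \<Rightarrow> real"
  assumes der: "\<And>t. t \<in> {0..T} \<Longrightarrow> (f has_real_derivative f' t) (at t within {0..T})"
    and f0: "f 0 = 0" and bd: "\<And>t. t \<in> {0..T} \<Longrightarrow> \<bar>f' t\<bar> \<le> c * exp (r * t)"
    and r: "r > 0" and c: "c \<ge> 0" and t: "t \<in> {0..T}"
  shows "\<bar>f t\<bar> \<le> c / r * exp (r * t)"
proof -
  have "c / r * exp (r * 0) - f 0 \<le> c / r * exp (r * t) - f t"
  proof (rule nondecreasing_within[where a = 0 and b = T and s = 0 and t = t and f = "\<lambda>t. c / r * exp (r * t) - f t"])
    show "((\<lambda>t. c / r * exp (r * t) - f t) has_real_derivative (c * exp (r * t) - f' t)) (at t within {0..T})"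
      if "t \<in> {0..T}" for t
      using r by (auto intro!: derivative_eq_intros der[OF that])
  qed (use t bd in \<open>auto simp: abs_le_iff\<close>)
  moreover have "c / r * exp (r * 0) + f 0 \<le> c / r * exp (r * t) + f t"
  proof (rule nondecreasing_within[where a = 0 and b = T and s = 0 and t = t and f = "\<lambda>t. c / r * exp (r * t) + f t"])
    show "((\<lambda>t. c / r * exp (r * t) + f t) has_real_derivative (c * exp (r * t) + f' t)) (at t within {0..T})"
      if "t \<in> {0..T}" for t
      using r by (auto intro!: derivative_eq_intros der[OF that])
    show "0 \<le> c * exp (r * t) + f' t" if "t \<in> {0..T}" for t
      using bd[OF that] by (simp add: abs_le_iff)
  qed (use t in auto)
  moreover have "c / r \<ge> 0" using c r by simp
  ultimately show ?thesis using f0 by (simp add: abs_le_iff)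
qed

lemma continuous_on_slice:
  assumes "continuous_on (A \<times> B) (\<lambda>(t, x). k t x)" "continuous_on C p" "continuous_on C r"
    "\<And>z. z \<in> C \<Longrightarrow> p z \<in> A" "\<And>z. z \<in> C \<Longrightarrow> r z \<in> B"
  shows "continuous_on C (\<lambda>z. k (p z) (r z))"
proof -
  have "continuous_on C (\<lambda>z. (p z, r z))" using assms by (intro continuous_intros)
  from continuous_on_compose2[OF assms(1) this] assms(4,5) show ?thesis by auto
qed

lemma continuous_on_Times_lipschitz:
  fixes F :: "real \<Rightarrow> real \<Rightarrow> real"
  assumes "\<And>t. t \<in> S \<Longrightarrow> continuous_on UNIV (F t)"
    and lip: "\<And>s t x. s \<in> S \<Longrightarrow> t \<in> S \<Longrightarrow> \<bar>F s x - F t x\<bar> \<le> C * \<bar>s - t\<bar>"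
  shows "continuous_on (S \<times> UNIV) (\<lambda>(t, x). F t x)"
proof (rule continuous_on_Times_uniform)
  fix t e :: real assume t: "t \<in> S" and e: "e > 0"
  show "\<exists>d>0. \<forall>\<tau>\<in>S. \<bar>\<tau> - t\<bar> < d \<longrightarrow> (\<forall>x. \<bar>F \<tau> x - F t x\<bar> \<le> e)"
  proof (intro exI[of _ "e / (\<bar>C\<bar> + 1)"] conjI ballI impI allI)
    fix \<tau> x assume \<tau>: "\<tau> \<in> S" "\<bar>\<tau> - t\<bar> < e / (\<bar>C\<bar> + 1)"
    have "\<bar>F \<tau> x - F t x\<bar> \<le> C * \<bar>\<tau> - t\<bar>" by (rule lip[OF \<tau>(1) t])
    also have "\<dots> \<le> (\<bar>C\<bar> + 1) * \<bar>\<tau> - t\<bar>" by (rule mult_right_mono) auto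
    also have "\<dots> \<le> e" using \<tau>(2) by (simp add: field_simps)
    finally show "\<bar>F \<tau> x - F t x\<bar> \<le> e" .
  qed (use e in simp)
qed (use assms in auto)

lemma abs_integral_le:
  fixes h :: "real \<Rightarrow> real"
  assumes "continuous_on {a..b} h" "a \<le> b" "\<And>x. x \<in> {a..b} \<Longrightarrow> \<bar>h x\<bar> \<le> C"
  shows "\<bar>integral {a..b} h\<bar> \<le> C * (b - a)"
  using integral_bound[OF assms(2,1)] assms(3) by simp

lemma integral_lipschitz:
  fixes h :: "real \<Rightarrow> real"
  assumes cont: "continuous_on {0..T} h" and C: "\<And>\<tau>. \<tau> \<in> {0..T} \<Longrightarrow> \<bar>h \<tau>\<bar> \<le> C"
    and st: "s \<in> {0..T}" "t \<in> {0..T}"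
  shows "\<bar>integral {0..s} h - integral {0..t} h\<bar> \<le> C * \<bar>s - t\<bar>"
proof -
  have main: "\<bar>integral {0..s} h - integral {0..t} h\<bar> \<le> C * \<bar>s - t\<bar>"
    if st: "s \<in> {0..T}" "t \<in> {0..T}" "s \<le> t" for s t
  proof -
    have "integral {0..s} h + integral {s..t} h = integral {0..t} h"
      using st by (intro Henstock_Kurzweil_Integration.integral_combine integrable_continuous_interval continuous_on_subset[OF cont]) auto
    moreover have "\<bar>integral {s..t} h\<bar> \<le> C * (t - s)"
      using st C by (intro abs_integral_le continuous_on_subset[OF cont]) auto
    ultimately show ?thesis using st by (simp add: abs_le_iff)
  qed
  show ?thesis
    using main[of s t] main[of t s] st by (cases "s \<le> t") (auto simp: abs_minus_commute)
qed

lemma continuous_on_integral_param: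
  fixes k :: "real \<Rightarrow> real \<Rightarrow> real"
  assumes k: "continuous_on ({0..T} \<times> UNIV) (\<lambda>(t, x). k t x)"
    and C: "\<And>t x. t \<in> {0..T} \<Longrightarrow> \<bar>k t x\<bar> \<le> C"
  shows "continuous_on ({0..T} \<times> UNIV) (\<lambda>(t, x). integral {0..t} (\<lambda>\<tau>. k \<tau> x))"
proof (rule continuous_on_Times_lipschitz)
  have kx: "continuous_on {0..T} (\<lambda>\<tau>. k \<tau> x)" for x
    by (rule continuous_on_slice[OF k]) (auto intro!: continuous_intros)
  show "\<bar>integral {0..s} (\<lambda>\<tau>. k \<tau> x) - integral {0..t} (\<lambda>\<tau>. k \<tau> x)\<bar> \<le> C * \<bar>s - t\<bar>"
    if "s \<in> {0..T}" "t \<in> {0..T}" for s t x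
    using that by (intro integral_lipschitz[OF kx]) (auto intro: C)
  fix t assume t: "t \<in> {0..T}"
  have "continuous_on (UNIV \<times> cbox 0 t) (\<lambda>(x, \<tau>). k \<tau> x)"
    unfolding case_prod_unfold
    by (rule continuous_on_slice[OF k]) (use t in \<open>auto intro!: continuous_intros\<close>)
  from integral_continuous_on_param[OF this]
  show "continuous_on UNIV (\<lambda>x. integral {0..t} (\<lambda>\<tau>. k \<tau> x))" by simp
qed

locale flow1d =
  fixes b bx :: "real \<Rightarrow> real \<Rightarrow> real" and T B L :: real
  assumes T: "T > 0" and L: "L > 0"
    and cont_b: "continuous_on ({0..T} \<times> UNIV) (\<lambda>(t, x). b t x)"
    and cont_bx: "continuous_on ({0..T} \<times> UNIV) (\<lambda>(t, x). bx t x)"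
    and deriv_b: "t \<in> {0..T} \<Longrightarrow> (b t has_real_derivative bx t x) (at x)"
    and b_bound: "t \<in> {0..T} \<Longrightarrow> \<bar>b t x\<bar> \<le> B"
    and bx_bound: "t \<in> {0..T} \<Longrightarrow> \<bar>bx t x\<bar> \<le> L"
begin

lemma B_nonneg: "B \<ge> 0"
  using b_bound[of 0 0] T by auto

lemma b_lipschitz: "t \<in> {0..T} \<Longrightarrow> \<bar>b t x - b t y\<bar> \<le> L * \<bar>x - y\<bar>"
  using field_differentiable_bound[of UNIV "b t" "bx t" L x y] deriv_b bx_bound by auto

lemma continuous_along:
  assumes "continuous_on ({0..T} \<times> UNIV) (\<lambda>(t, x). k t x)" "continuous_on {0..T} y"
  shows "continuous_on {0..T} (\<lambda>t. k t (y t))"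
  by (rule continuous_on_slice[OF assms(1)]) (auto intro!: continuous_intros assms(2))

primrec picard :: "real \<Rightarrow> nat \<Rightarrow> real \<Rightarrow> real" where
  "picard a 0 t = a"
| "picard a (Suc n) t = a + integral {0..t} (\<lambda>\<tau>. b \<tau> (picard a n \<tau>))"

lemma continuous_picard: "continuous_on {0..T} (picard a n)"
proof (induction n)
  case (Suc n)
  have "continuous_on {0..T} (\<lambda>t. a + integral {0..t} (\<lambda>\<tau>. b \<tau> (picard a n \<tau>)))"
    by (intro continuous_intros indefinite_integral_continuous_1 integrable_continuous_interval
        continuous_along[OF cont_b] Suc)
  thus ?case by simp
qed simp

lemma deriv_picard:
  "t \<in> {0..T} \<Longrightarrow> (picard a (Suc n) has_real_derivative b t (picard a n t)) (at t within {0..T})"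
  unfolding picard.simps
  by (auto intro!: derivative_eq_intros integral_has_real_derivative continuous_along[OF cont_b] continuous_picard)

text \<open>The weight \<open>exp (2 * L * t)\<close> makes every Picard step contract by the factor \<open>1/2\<close> on all of \<open>[0, T]\<close>.\<close>

lemma picard_diff:
  assumes t: "t \<in> {0..T}"
  shows "\<bar>picard a (Suc n) t - picard a n t\<bar> \<le> (B / (2 * L)) / 2 ^ n * exp (2 * L * t)"
  using t
proof (induction n arbitrary: t)
  case 0
  show ?case
  proof (rule order_trans[OF deriv_exp_bound[where T = T and t = t and f = "\<lambda>t. picard a (Suc 0) t - picard a 0 t" and f' = "\<lambda>t. b t a" and c = B and r = "2 * L"]])
    show "((\<lambda>t. picard a (Suc 0) t - picard a 0 t) has_real_derivative b t a) (at t within {0..T})" if "t \<in> {0..T}" for t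
      using deriv_picard[OF that, of a 0] by (simp add: has_field_derivative_iff)
    show "\<bar>b t a\<bar> \<le> B * exp (2 * L * t)" if "t \<in> {0..T}" for t
      using b_bound[OF that, of a] mult_left_mono[OF _ B_nonneg, of 1 "exp (2 * L * t)"] L that by simp
  qed (use 0 L B_nonneg in auto)
next
  case (Suc n)
  show ?case
  proof (rule order_trans[OF deriv_exp_bound[where T = T and t = t and f = "\<lambda>t. picard a (Suc (Suc n)) t - picard a (Suc n) t" and f' = "\<lambda>t. b t (picard a (Suc n) t) - b t (picard a n t)"
          and c = "L * ((B / (2 * L)) / 2 ^ n)" and r = "2 * L"]])
    show "((\<lambda>t. picard a (Suc (Suc n)) t - picard a (Suc n) t) has_real_derivative b t (picard a (Suc n) t) - b t (picard a n t)) (at t within {0..T})" if "t \<in> {0..T}" for t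
      by (intro derivative_intros deriv_picard that)
    show "\<bar>b t (picard a (Suc n) t) - b t (picard a n t)\<bar> \<le> L * ((B / (2 * L)) / 2 ^ n) * exp (2 * L * t)" if "t \<in> {0..T}" for t
      using b_lipschitz[OF that, of "picard a (Suc n) t" "picard a n t"] mult_left_mono[OF Suc.IH[OF that], of L] L
      by (simp del: picard.simps add: mult.assoc)
  qed (use Suc.prems L B_nonneg in \<open>auto simp: field_simps\<close>)
qed

lemma flow_exists:
  "\<exists>x. x 0 = a \<and> (\<forall>t\<in>{0..T}. (x has_real_derivative b t (x t)) (at t within {0..T}))"
proof -
  define M where "M = B / (2 * L) * exp (2 * L * T)"
  have M: "M \<ge> 0" using B_nonneg L by (simp add: M_def)
  have step: "\<bar>picard a (Suc n) t - picard a n t\<bar> \<le> M * (1 / 2) ^ n" if "t \<in> {0..T}" for n t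
  proof -
    have "\<bar>picard a (Suc n) t - picard a n t\<bar> \<le> (B / (2 * L)) / 2 ^ n * exp (2 * L * t)" by (rule picard_diff[OF that])
    also have "\<dots> \<le> (B / (2 * L)) / 2 ^ n * exp (2 * L * T)"
      using that L B_nonneg by (intro mult_left_mono) auto
    finally show ?thesis by (simp add: M_def power_one_over field_simps)
  qed
  have tel: "(\<Sum>i<n. picard a (Suc i) t - picard a i t) = picard a n t - a" for n t
    using sum_lessThan_telescope[of "\<lambda>i. picard a i t" n] by (simp del: picard.simps(2))
  define X where "X t = a + (\<Sum>i. picard a (Suc i) t - picard a i t)" for t
  have "uniform_limit {0..T} (\<lambda>n t. \<Sum>i<n. picard a (Suc i) t - picard a i t) (\<lambda>t. \<Sum>i. picard a (Suc i) t - picard a i t) sequentially"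
  proof (rule Weierstrass_m_test)
    show "norm (picard a (Suc n) t - picard a n t) \<le> M * (1 / 2) ^ n" if "t \<in> {0..T}" for n t
      using step[OF that] by (simp del: picard.simps)
    show "summable (\<lambda>n. M * (1 / 2 :: real) ^ n)" by (intro summable_mult summable_geometric) simp
  qed
  hence "uniform_limit {0..T} (\<lambda>n t. picard a n t - a) (\<lambda>t. X t - a) sequentially"
    by (simp add: tel X_def del: picard.simps(2))
  hence unif: "uniform_limit {0..T} (picard a) X sequentially"
    by (simp add: uniform_limit_iff dist_real_def)
  have contX: "continuous_on {0..T} X"
    by (rule uniform_limit_theorem[OF _ unif]) (simp_all add: continuous_picard always_eventually)
  have fix_X: "X t = a + integral {0..t} (\<lambda>\<tau>. b \<tau> (X \<tau>))" if t: "t \<in> {0..T}" for t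
  proof (rule LIMSEQ_unique)
    show "(\<lambda>n. picard a (Suc n) t) \<longlonglongrightarrow> X t"
      using tendsto_uniform_limitI[OF unif t] by (rule LIMSEQ_Suc)
    show "(\<lambda>n. picard a (Suc n) t) \<longlonglongrightarrow> a + integral {0..t} (\<lambda>\<tau>. b \<tau> (X \<tau>))"
      unfolding picard.simps
    proof (intro tendsto_add tendsto_const Equivalence_Lebesgue_Henstock_Integration.dominated_convergence(2)[where h = "\<lambda>_. B"])
      show "(\<lambda>\<tau>. b \<tau> (picard a n \<tau>)) integrable_on {0..t}" for n
        using t by (intro integrable_continuous_interval continuous_on_subset[OF continuous_along[OF cont_b continuous_picard]]) auto
      show "(\<lambda>n. b \<tau> (picard a n \<tau>)) \<longlonglongrightarrow> b \<tau> (X \<tau>)" if "\<tau> \<in> {0..t}" for \<tau>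
        using that t by (intro isCont_tendsto_compose[OF DERIV_isCont[OF deriv_b]] tendsto_uniform_limitI[OF unif]) auto
    qed (use t b_bound in \<open>auto intro: integrable_continuous_interval\<close>)
  qed
  have "(X has_real_derivative b t (X t)) (at t within {0..T})" if t: "t \<in> {0..T}" for t
  proof -
    have "((\<lambda>t. a + integral {0..t} (\<lambda>\<tau>. b \<tau> (X \<tau>))) has_real_derivative b t (X t)) (at t within {0..T})"
      by (auto intro!: derivative_eq_intros integral_has_real_derivative continuous_along[OF cont_b] contX t)
    thus ?thesis by (rule has_field_derivative_transform_within[where d = 1]) (use t in \<open>auto simp flip: fix_X\<close>)
  qed
  moreover have "X 0 = a" using fix_X[of 0] T by simp
  ultimately show ?thesis by blast
qed

text \<open>The trajectory is chosen for each label \<open>a\<close> separately, so nothing about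
  the dependence on \<open>a\<close> comes for free; it is recovered from the Lipschitz estimate for
  two trajectories.\<close>

definition X :: "real \<Rightarrow> real \<Rightarrow> real" where
  "X t a = (SOME x. x 0 = a \<and> (\<forall>t\<in>{0..T}. (x has_real_derivative b t (x t)) (at t within {0..T}))) t"

lemma X_0: "X 0 a = a"
  and deriv_X: "t \<in> {0..T} \<Longrightarrow> ((\<lambda>t. X t a) has_real_derivative b t (X t a)) (at t within {0..T})"
  using someI_ex[OF flow_exists[of a]] unfolding X_def by blast+

lemma continuous_X: "continuous_on {0..T} (\<lambda>t. X t a)"
  by (rule DERIV_continuous_on) (rule deriv_X)

lemma X_lipschitz_time:
  assumes "s \<in> {0..T}" "t \<in> {0..T}"
  shows "\<bar>X s a - X t a\<bar> \<le> B * \<bar>s - t\<bar>"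
  using field_differentiable_bound[of "{0..T}" "\<lambda>t. X t a" "\<lambda>t. b t (X t a)" B s t] deriv_X b_bound assms
  by auto

lemma X_displacement: "t \<in> {0..T} \<Longrightarrow> \<bar>X t a - a\<bar> \<le> B * T"
  using X_lipschitz_time[of t 0 a] T mult_left_mono[OF _ B_nonneg, of t T] by (auto simp: X_0)

text \<open>The distance \<open>D\<close> of two trajectories satisfies
  \<open>\<bar>D'\<bar> \<le> L * \<bar>D\<bar>\<close>, so \<open>D^2 * exp (2 * L * t)\<close>
  increases and \<open>D^2 * exp (- 2 * L * t)\<close> decreases. Squares avoid differentiating the
  absolute value. The first bound gives continuity in the label, the second injectivity.\<close>

lemma X_diff_bounds:
  assumes t: "t \<in> {0..T}"
  shows "\<bar>X t c - X t a\<bar> \<le> \<bar>c - a\<bar> * exp (L * t)" "\<bar>c - a\<bar> * exp (- L * t) \<le> \<bar>X t c - X t a\<bar>"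
proof -
  define D where "D t = X t c - X t a" for t
  define D' where "D' t = b t (X t c) - b t (X t a)" for t
  have D': "(D has_real_derivative D' t) (at t within {0..T})" if "t \<in> {0..T}" for t
    unfolding D_def D'_def by (intro derivative_intros deriv_X that)
  have le: "\<bar>D t * D' t\<bar> \<le> L * (D t)\<^sup>2" if "t \<in> {0..T}" for t
  proof -
    have "\<bar>D t * D' t\<bar> = \<bar>D t\<bar> * \<bar>D' t\<bar>" by (rule abs_mult)
    also have "\<dots> \<le> \<bar>D t\<bar> * (L * \<bar>D t\<bar>)"
      unfolding D_def D'_def by (intro mult_left_mono b_lipschitz that) auto
    also have "\<dots> = L * (D t)\<^sup>2" by (simp add: power2_eq_square)
    finally show ?thesis .
  qed
  have e2: "(exp (- (L * t)))\<^sup>2 = inverse (exp (2 * L * t))" and e3: "(exp (L * t))\<^sup>2 = exp (2 * L * t)"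
    by (simp_all add: mult.assoc flip: exp_double exp_minus)
  have "(D 0)\<^sup>2 * exp (2 * L * 0) \<le> (D t)\<^sup>2 * exp (2 * L * t)"
  proof (rule nondecreasing_within[where a = 0 and b = T and s = 0 and t = t and f = "\<lambda>t. (D t)\<^sup>2 * exp (2 * L * t)"])
    show "((\<lambda>t. (D t)\<^sup>2 * exp (2 * L * t)) has_real_derivative 2 * exp (2 * L * t) * (D t * D' t + L * (D t)\<^sup>2)) (at t within {0..T})"
      if "t \<in> {0..T}" for t
      by (rule derivative_eq_intros D'[OF that] refl | simp add: algebra_simps power2_eq_square)+
    show "0 \<le> 2 * exp (2 * L * t) * (D t * D' t + L * (D t)\<^sup>2)" if "t \<in> {0..T}" for t
      using le[OF that] by (intro mult_nonneg_nonneg) (auto simp: abs_le_iff)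
  qed (use t in auto)
  hence "(\<bar>D 0\<bar> * exp (- L * t))\<^sup>2 \<le> (\<bar>D t\<bar>)\<^sup>2"
    by (simp add: power_mult_distrib e2 field_simps)
  hence "\<bar>D 0\<bar> * exp (- L * t) \<le> \<bar>D t\<bar>" by (rule power2_le_imp_le) simp
  thus "\<bar>c - a\<bar> * exp (- L * t) \<le> \<bar>X t c - X t a\<bar>" by (simp add: D_def X_0)
  have "- ((D 0)\<^sup>2 * exp (- 2 * L * 0)) \<le> - ((D t)\<^sup>2 * exp (- 2 * L * t))"
  proof (rule nondecreasing_within[where a = 0 and b = T and s = 0 and t = t and f = "\<lambda>t. - ((D t)\<^sup>2 * exp (- 2 * L * t))"])
    show "((\<lambda>t. - ((D t)\<^sup>2 * exp (- 2 * L * t))) has_real_derivative 2 * exp (- 2 * L * t) * (L * (D t)\<^sup>2 - D t * D' t)) (at t within {0..T})"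
      if "t \<in> {0..T}" for t
      by (rule derivative_eq_intros D'[OF that] refl | simp add: algebra_simps power2_eq_square)+
    show "0 \<le> 2 * exp (- 2 * L * t) * (L * (D t)\<^sup>2 - D t * D' t)" if "t \<in> {0..T}" for t
      using le[OF that] by (intro mult_nonneg_nonneg) (auto simp: abs_le_iff)
  qed (use t in auto)
  hence "(\<bar>D t\<bar>)\<^sup>2 \<le> (\<bar>D 0\<bar> * exp (L * t))\<^sup>2"
    by (simp add: power_mult_distrib e3 exp_minus field_simps)
  hence "\<bar>D t\<bar> \<le> \<bar>D 0\<bar> * exp (L * t)" by (rule power2_le_imp_le) simp
  thus "\<bar>X t c - X t a\<bar> \<le> \<bar>c - a\<bar> * exp (L * t)" by (simp add: D_def X_0)
qed

lemma X_neq: "t \<in> {0..T} \<Longrightarrow> c \<noteq> a \<Longrightarrow> X t c \<noteq> X t a"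
proof
  assume "t \<in> {0..T}" "c \<noteq> a" "X t c = X t a"
  with X_diff_bounds(2)[of t c a] show False by (simp add: mult_le_0_iff not_le)
qed

lemma X_strict_mono:
  assumes t: "t \<in> {0..T}" and ac: "a < c"
  shows "X t a < X t c"
proof (rule ccontr)
  assume "\<not> X t a < X t c"
  hence "\<exists>s. 0 \<le> s \<and> s \<le> t \<and> X s c - X s a = 0"
    using t ac by (intro IVT2' continuous_on_subset[OF continuous_on_diff[OF continuous_X continuous_X]]) (auto simp: X_0)
  thus False using X_neq[of _ c a] t ac by auto
qed

text \<open>The sign depends on the labels alone. This neutralises the jump of \<open>dq\<close>
  when the flows of two different solutions are compared.\<close>

lemma sgn_X_diff: "t \<in> {0..T} \<Longrightarrow> sgn (X t a - X t c) = sgn (a - c)"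
  using X_strict_mono[of t a c] X_strict_mono[of t c a] by (cases a c rule: linorder_cases) (auto simp: sgn_if)

lemma continuous_X_space: "t \<in> {0..T} \<Longrightarrow> continuous_on UNIV (X t)"
proof (rule lipschitz_on_continuous_on[where L = "exp (L * t)"])
  assume "t \<in> {0..T}"
  thus "(exp (L * t))-lipschitz_on UNIV (X t)"
    using X_diff_bounds(1)[of t] by (intro lipschitz_onI) (auto simp: dist_real_def mult.commute)
qed

lemma continuous_X_joint: "continuous_on ({0..T} \<times> UNIV) (\<lambda>(t, a). X t a)"
  by (rule continuous_on_Times_lipschitz[OF continuous_X_space X_lipschitz_time])

lemma continuous_along_X:
  assumes "continuous_on ({0..T} \<times> UNIV) (\<lambda>(t, x). k t x)"
  shows "continuous_on ({0..T} \<times> UNIV) (\<lambda>(t, a). k t (X t a))"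
proof -
  have "continuous_on ({0..T} \<times> UNIV) (\<lambda>p. X (fst p) (snd p))"
    using continuous_X_joint by (simp add: case_prod_unfold)
  from continuous_on_slice[OF assms continuous_on_fst[OF continuous_on_id] this]
  show ?thesis by (auto simp: case_prod_unfold)
qed

text \<open>Liouville's formula for the Jacobian. In this form positivity and the evolution in time
  are immediate; that it is the derivative of \<open>X t\<close> in the label is shown in
  \<open>deriv_X_space\<close>.\<close>

definition J :: "real \<Rightarrow> real \<Rightarrow> real" where
  "J t a = exp (integral {0..t} (\<lambda>\<tau>. bx \<tau> (X \<tau> a)))"

lemma J_0: "J 0 a = 1" and J_pos: "J t a > 0"
  by (simp_all add: J_def)

lemma continuous_bx_X: "continuous_on {0..T} (\<lambda>\<tau>. bx \<tau> (X \<tau> a))"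
  by (rule continuous_along[OF cont_bx continuous_X])

lemma deriv_J:
  "t \<in> {0..T} \<Longrightarrow> ((\<lambda>t. J t a) has_real_derivative bx t (X t a) * J t a) (at t within {0..T})"
  unfolding J_def
  by (auto intro!: derivative_eq_intros integral_has_real_derivative continuous_bx_X)

lemma continuous_J: "continuous_on ({0..T} \<times> UNIV) (\<lambda>(t, a). J t a)"
  using continuous_on_exp[OF continuous_on_integral_param[OF continuous_along_X[OF cont_bx] bx_bound]]
  by (simp add: J_def case_prod_unfold)

lemma J_le:
  assumes t: "t \<in> {0..T}"
  shows "J t a \<le> exp (L * T)"
proof -
  have "\<bar>integral {0..t} (\<lambda>\<tau>. bx \<tau> (X \<tau> a))\<bar> \<le> L * (t - 0)"
    using t by (intro abs_integral_le continuous_on_subset[OF continuous_bx_X] bx_bound) auto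
  also have "\<dots> \<le> L * T" using t L by simp
  finally show ?thesis by (simp add: J_def abs_le_iff)
qed

text \<open>With the divided difference of \<open>b\<close> as coefficient, the distance of two
  trajectories solves a scalar linear equation, which integrates explicitly.\<close>

lemma X_diff_eq:
  assumes t: "t \<in> {0..T}" and ac: "c \<noteq> a"
  defines "s \<equiv> \<lambda>\<tau>. (b \<tau> (X \<tau> c) - b \<tau> (X \<tau> a)) / (X \<tau> c - X \<tau> a)"
  shows "continuous_on {0..T} s" "X t c - X t a = (c - a) * exp (integral {0..t} s)"
proof -
  show s: "continuous_on {0..T} s"
    unfolding s_def using X_neq ac
    by (intro continuous_intros continuous_along[OF cont_b] continuous_X) auto
  let ?f = "\<lambda>t. (X t c - X t a) * exp (- integral {0..t} s)"
  have d: "(?f has_real_derivative 0) (at \<tau> within {0..T})" if \<tau>: "\<tau> \<in> {0..T}" for \<tau>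
  proof -
    have "(?f has_real_derivative ((b \<tau> (X \<tau> c) - b \<tau> (X \<tau> a)) * exp (- integral {0..\<tau>} s) +
        (X \<tau> c - X \<tau> a) * (exp (- integral {0..\<tau>} s) * (- s \<tau>)))) (at \<tau> within {0..T})"
      by (auto intro!: derivative_eq_intros deriv_X integral_has_real_derivative s \<tau>)
    also have "(b \<tau> (X \<tau> c) - b \<tau> (X \<tau> a)) * exp (- integral {0..\<tau>} s) +
        (X \<tau> c - X \<tau> a) * (exp (- integral {0..\<tau>} s) * (- s \<tau>)) = 0"
      using X_neq[OF \<tau> ac] by (simp add: s_def)
    finally show ?thesis .
  qed
  have "?f 0 \<le> ?f t"
    by (rule nondecreasing_within[of 0 T ?f "\<lambda>_. 0"]) (use d t in auto)
  moreover have "- ?f 0 \<le> - ?f t"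
    by (rule nondecreasing_within[of 0 T "\<lambda>t. - ?f t" "\<lambda>_. 0"]) (use DERIV_minus[OF d] t in auto)
  ultimately have "?f t = c - a" by (simp add: X_0)
  thus "X t c - X t a = (c - a) * exp (integral {0..t} s)" by (simp add: exp_minus field_simps)
qed

text \<open>By \<open>X_diff_eq\<close> the difference quotient of \<open>X t\<close> is the
  exponential of a time integral of slopes of \<open>b\<close>. These are bounded by
  \<open>L\<close> and converge to \<open>bx\<close>, so dominated convergence passes to the limit
  in the exponent.\<close>

lemma deriv_X_space:
  assumes t: "t \<in> {0..T}"
  shows "(X t has_real_derivative J t a) (at a)"
  unfolding has_field_derivative_iff tendsto_at_iff_sequentially
proof (intro allI impI)
  fix Y :: "nat \<Rightarrow> real" assume Y: "\<forall>i. Y i \<in> UNIV - {a}" "Y \<longlonglongrightarrow> a"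
  define s where "s n \<tau> = (b \<tau> (X \<tau> (Y n)) - b \<tau> (X \<tau> a)) / (X \<tau> (Y n) - X \<tau> a)" for n \<tau>
  have "(\<lambda>n. integral {0..t} (s n)) \<longlonglongrightarrow> integral {0..t} (\<lambda>\<tau>. bx \<tau> (X \<tau> a))"
  proof (rule Equivalence_Lebesgue_Henstock_Integration.dominated_convergence(2)[where h = "\<lambda>_. L"])
    fix n
    show "s n integrable_on {0..t}"
      using X_diff_eq(1)[of t "Y n" a] t Y(1) unfolding s_def
      by (intro integrable_continuous_interval) (auto elim!: continuous_on_subset)
    fix \<tau> assume \<tau>: "\<tau> \<in> {0..t}"
    show "norm (s n \<tau>) \<le> L"
      using b_lipschitz[of \<tau> "X \<tau> (Y n)" "X \<tau> a"] X_neq[of \<tau> "Y n" a] \<tau> t Y(1)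
      by (auto simp: s_def divide_le_eq)
  next
    fix \<tau> assume \<tau>: "\<tau> \<in> {0..t}"
    have "(\<lambda>n. X \<tau> (Y n)) \<longlonglongrightarrow> X \<tau> a"
      using \<tau> t by (intro continuous_on_tendsto_compose[OF continuous_X_space Y(2)]) auto
    moreover have "((\<lambda>y. (b \<tau> y - b \<tau> (X \<tau> a)) / (y - X \<tau> a)) \<longlongrightarrow> bx \<tau> (X \<tau> a)) (at (X \<tau> a))"
      using deriv_b[of \<tau>] \<tau> t by (simp add: has_field_derivative_iff)
    moreover have "X \<tau> (Y i) \<noteq> X \<tau> a" for i using X_neq[of \<tau> "Y i" a] \<tau> t Y(1) by auto
    ultimately show "(\<lambda>n. s n \<tau>) \<longlonglongrightarrow> bx \<tau> (X \<tau> a)"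
      unfolding tendsto_at_iff_sequentially s_def o_def by force
  qed auto
  hence "(\<lambda>n. exp (integral {0..t} (s n))) \<longlonglongrightarrow> J t a"
    unfolding J_def by (rule tendsto_exp)
  moreover have "(X t (Y n) - X t a) / (Y n - a) = exp (integral {0..t} (s n))" for n
    using X_diff_eq(2)[OF t, of "Y n" a] Y(1) by (simp add: s_def[abs_def])
  ultimately show "((\<lambda>y. (X t y - X t a) / (y - a)) \<circ> Y) \<longlonglongrightarrow> J t a"
    by (simp add: o_def)
qed

lemma X_surj:
  assumes t: "t \<in> {0..T}"
  obtains a where "X t a = y"
proof -
  let ?l = "y - B * T" and ?r = "y + B * T"
  have "\<exists>a. ?l \<le> a \<and> a \<le> ?r \<and> X t a = y"
    using X_displacement[OF t, of ?l] X_displacement[OF t, of ?r] B_nonneg T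
    by (intro IVT' continuous_on_subset[OF continuous_X_space[OF t]]) (auto simp: abs_le_iff)
  thus thesis using that by blast
qed

section \<open>Change of variables between positions and labels\<close>

lemma measurable_X [measurable]: "t \<in> {0..T} \<Longrightarrow> X t \<in> borel_measurable borel"
  by (intro borel_measurable_continuous_onI continuous_X_space)

lemma continuous_J_space: "t \<in> {0..T} \<Longrightarrow> continuous_on UNIV (J t)"
  by (rule continuous_on_slice[OF continuous_J]) (auto intro!: continuous_intros)

lemma measurable_J [measurable]: "t \<in> {0..T} \<Longrightarrow> J t \<in> borel_measurable borel"
  by (intro borel_measurable_continuous_onI continuous_J_space)

text \<open>Open intervals suffice: the preimage of one under the increasing bijection
  \<open>X t\<close> is an interval of labels, over which \<open>J t\<close> integrates to the
  increment of \<open>X t\<close>. Stated for measures, the result serves nonnegative and Bochner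
  integrals alike.\<close>

lemma distr_X:
  assumes t: "t \<in> {0..T}"
  shows "distr (density lborel (J t)) borel (X t) = lborel"
proof (rule lborel_eqI[symmetric])
  note [measurable] = measurable_X[OF t] measurable_J[OF t]
  fix l u :: real assume "\<And>b. b \<in> Basis \<Longrightarrow> l \<bullet> b \<le> u \<bullet> b"
  hence lu: "l \<le> u" by simp
  obtain \<alpha> \<beta> where ab: "X t \<alpha> = l" "X t \<beta> = u" using X_surj[OF t] by metis
  have le: "\<alpha> \<le> \<beta>" using X_strict_mono[OF t, of \<beta> \<alpha>] lu ab by force
  have "X t -` box l u = {\<alpha><..<\<beta>}"
    using X_strict_mono[OF t] unfolding ab[symmetric] by (auto simp: box_real) (metis linorder_cases order_less_asym')+
  hence "emeasure (distr (density lborel (J t)) borel (X t)) (box l u) = (\<integral>\<^sup>+a. ennreal (J t a) * indicator {\<alpha><..<\<beta>} a \<partial>lborel)"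
    by (simp add: emeasure_distr emeasure_density)
  also have "\<dots> = (\<integral>\<^sup>+a. ennreal (J t a) * indicator {\<alpha>..\<beta>} a \<partial>lborel)"
    by (rule nn_integral_cong_AE)
      (use AE_lborel_singleton[of \<alpha>] AE_lborel_singleton[of \<beta>] in eventually_elim, auto simp: indicator_def)
  also have "\<dots> = ennreal (X t \<beta> - X t \<alpha>)"
    using deriv_X_space[OF t] J_pos le by (intro nn_integral_FTC_Icc) (auto intro: less_imp_le)
  finally show "emeasure (distr (density lborel (J t)) borel (X t)) (box l u) = (\<Prod>b\<in>Basis. (u - l) \<bullet> b)"
    by (simp add: ab)
qed simp

lemma nn_integral_X:
  assumes t: "t \<in> {0..T}" and [measurable]: "h \<in> borel_measurable borel"
  shows "(\<integral>\<^sup>+x. h x \<partial>lborel) = (\<integral>\<^sup>+a. ennreal (J t a) * h (X t a) \<partial>lborel)"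
proof -
  note [measurable] = measurable_X[OF t] measurable_J[OF t]
  have "(\<integral>\<^sup>+x. h x \<partial>lborel) = (\<integral>\<^sup>+x. h x \<partial>distr (density lborel (J t)) borel (X t))"
    by (simp add: distr_X[OF t])
  thus ?thesis by (simp add: nn_integral_distr nn_integral_density)
qed

lemma integral_X:
  fixes h :: "real \<Rightarrow> real"
  assumes t: "t \<in> {0..T}" and [measurable]: "h \<in> borel_measurable borel"
  shows "(LINT x|lborel. h x) = (LINT a|lborel. J t a * h (X t a))"
proof -
  note [measurable] = measurable_X[OF t] measurable_J[OF t]
  have "(LINT x|lborel. h x) = (LINT x|distr (density lborel (J t)) borel (X t). h x)"
    by (simp add: distr_X[OF t])
  thus ?thesis using J_pos by (simp add: integral_distr integral_density less_imp_le)
qed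

end

section \<open>The nonlocal kernel\<close>

lemma smooth_has_derivative:
  assumes "smooth f"
  shows "((deriv ^^ n) f has_real_derivative (deriv ^^ Suc n) f x) (at x)"
  using assms unfolding smooth_def by (simp add: DERIV_deriv_iff_real_differentiable)

lemma smooth_continuous: "smooth f \<Longrightarrow> continuous_on S ((deriv ^^ n) f)"
  using smooth_has_derivative by (intro continuous_at_imp_continuous_on ballI DERIV_isCont) blast

lemma smooth_bounded:
  assumes "smooth f"
  shows "\<exists>A. \<forall>z\<in>{-M..M}. \<bar>(deriv ^^ n) f z\<bar> \<le> A"
proof -
  have "bounded ((deriv ^^ n) f ` {-M..M})"
    by (intro compact_imp_bounded compact_continuous_image smooth_continuous assms) auto
  thus ?thesis by (auto simp: bounded_iff)
qed

lemma has_bochner_integral_exp_abs: "has_bochner_integral lborel (\<lambda>x::real. exp (- \<bar>x\<bar>)) 2"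
proof (rule has_bochner_integral_nn_integral)
  have half: "(\<integral>\<^sup>+x. ennreal (exp (- x)) * indicator {0..} x \<partial>lborel) = ennreal 1"
  proof -
    have d: "((\<lambda>x::real. - exp (- x)) has_real_derivative exp (- x)) (at x)" for x
      by (auto intro!: derivative_eq_intros)
    have "((\<lambda>x::real. - exp (- x)) \<longlongrightarrow> 0) at_top" by real_asymp
    from nn_integral_FTC_atLeast[where F = "\<lambda>x::real. - exp (- x)" and f = "\<lambda>x. exp (- x)" and a = 0, OF _ d _ this]
    show ?thesis by simp
  qed
  have "(\<integral>\<^sup>+x. ennreal (exp (- \<bar>x\<bar>)) \<partial>lborel) =
    (\<integral>\<^sup>+x. ennreal (exp (- x)) * indicator {0..} x + ennreal (exp (- (- x))) * indicator {0..} (- x) \<partial>lborel)"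
    by (rule nn_integral_cong_AE) (use AE_lborel_singleton[of "0::real"] in eventually_elim, auto simp: indicator_def)
  also have "\<dots> = (\<integral>\<^sup>+x. ennreal (exp (- x)) * indicator {0..} x \<partial>lborel) +
    (\<integral>\<^sup>+x. ennreal (exp (- (- x))) * indicator {0..} (- x) \<partial>lborel)"
    by (rule nn_integral_add) auto
  also have "(\<integral>\<^sup>+x. ennreal (exp (- (- x))) * indicator {0..} (- x) \<partial>lborel) = (\<integral>\<^sup>+x. ennreal (exp (- x)) * indicator {0..} x \<partial>lborel)"
    using nn_integral_real_affine[of "\<lambda>x. ennreal (exp (- x)) * indicator {0..} x" "-1" 0] by simp
  finally show "(\<integral>\<^sup>+x. ennreal (exp (- \<bar>x\<bar>)) \<partial>lborel) = ennreal 2"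
    unfolding half by (simp flip: ennreal_plus)
qed auto

lemma integrable_exp_abs: "integrable lborel (\<lambda>x::real. exp (- \<bar>x\<bar>))"
  and integral_exp_abs: "(LINT x|lborel. exp (- \<bar>x::real\<bar>)) = 2"
  using has_bochner_integral_exp_abs by (auto simp: has_bochner_integral_iff)

lemma integrable_exp_shift: "integrable lborel (\<lambda>c. exp (- \<bar>a - c\<bar>))" for a :: real
  using lborel_integrable_real_affine[OF integrable_exp_abs, of "-1" a] by simp

lemma nn_integral_exp_half: "(\<integral>\<^sup>+x. ennreal (exp (- \<bar>x\<bar> / 2)) \<partial>lborel) < \<infinity>"
proof -
  have "integrable lborel (\<lambda>x::real. exp (- \<bar>x\<bar> / 2))"
    using lborel_integrable_real_affine[OF integrable_exp_abs, of "1/2" 0] by (simp add: abs_mult)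
  thus ?thesis by (auto simp: integrable_iff_bounded)
qed

lemma q_measurable [measurable]: "q \<in> borel_measurable borel"
  and dq_measurable [measurable]: "dq \<in> borel_measurable borel"
  unfolding q_def[abs_def] dq_def[abs_def] by measurable

lemma abs_q: "\<bar>q x\<bar> = exp (- \<bar>x\<bar>) / 2" and abs_dq_le: "\<bar>dq x\<bar> \<le> exp (- \<bar>x\<bar>) / 2"
  by (auto simp: q_def dq_def sgn_if)

lemma integrable_q: "integrable lborel q" and integrable_dq: "integrable lborel dq"
proof -
  have *: "integrable lborel (\<lambda>x::real. exp (- \<bar>x\<bar>) / 2)" using integrable_exp_abs by simp
  show "integrable lborel q" "integrable lborel dq"
    by (rule Bochner_Integration.integrable_bound[OF *]; use abs_q abs_dq_le in simp)+
qed

lemma conv_commute: "conv k h x = (LINT z|lborel. k z * h (x - z))"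
  unfolding conv_def using lborel_integral_real_affine[of "-1" "\<lambda>y. k (x - y) * h y" x] by simp

lemma integrable_mult_bounded:
  fixes k h :: "real \<Rightarrow> real"
  assumes k: "integrable lborel k" and [measurable]: "h \<in> borel_measurable borel" and C: "\<And>x. \<bar>h x\<bar> \<le> C"
  shows "integrable lborel (\<lambda>x. k x * h x)"
proof (rule Bochner_Integration.integrable_bound)
  show "integrable lborel (\<lambda>x. \<bar>k x\<bar> * C)" using k by simp
  show "AE x in lborel. norm (k x * h x) \<le> norm (\<bar>k x\<bar> * C)"
    by (auto simp: abs_mult intro!: AE_I2 mult_left_mono order_trans[OF C abs_ge_self])
qed (use k in auto)

text \<open>The translation is moved onto the continuous function \<open>h\<close>, so dominated
  convergence covers kernels with a jump such as \<open>dq\<close>.\<close>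

lemma continuous_on_conv:
  fixes h :: "real \<Rightarrow> real \<Rightarrow> real"
  assumes k: "integrable lborel k"
    and h: "continuous_on (S \<times> UNIV) (\<lambda>(t, x). h t x)"
    and C: "\<And>t x. t \<in> S \<Longrightarrow> \<bar>h t x\<bar> \<le> C"
  shows "continuous_on (S \<times> UNIV) (\<lambda>(t, x). conv k (h t) x)"
  unfolding continuous_on_sequentially
proof (intro allI ballI impI, elim conjE)
  fix Y :: "nat \<Rightarrow> real \<times> real" and p assume p: "p \<in> S \<times> (UNIV :: real set)" and Y: "\<forall>n. Y n \<in> S \<times> UNIV" "Y \<longlonglongrightarrow> p"
  have ht: "h t \<in> borel_measurable borel" if "t \<in> S" for t
    by (intro borel_measurable_continuous_onI continuous_on_slice[OF h]) (use that in auto)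
  have [measurable]: "k \<in> borel_measurable borel" using k by auto
  have YS: "fst (Y n) \<in> S" for n using Y(1) by (metis mem_Times_iff)
  have "(\<lambda>n. LINT z|lborel. k z * h (fst (Y n)) (snd (Y n) - z)) \<longlonglongrightarrow> (LINT z|lborel. k z * h (fst p) (snd p - z))"
  proof (rule integral_dominated_convergence[where w = "\<lambda>z. \<bar>k z\<bar> * C"])
    show "(\<lambda>z. k z * h (fst p) (snd p - z)) \<in> borel_measurable lborel"
      using measurable_compose[OF _ ht[of "fst p"], of "\<lambda>z. snd p - z" borel] p by auto
    show "(\<lambda>z. k z * h (fst (Y n)) (snd (Y n) - z)) \<in> borel_measurable lborel" for n
      using measurable_compose[OF _ ht[OF YS[of n]], of "\<lambda>z. snd (Y n) - z" borel] by auto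
    have "(\<lambda>n. h (fst (Y n)) (snd (Y n) - z)) \<longlonglongrightarrow> h (fst p) (snd p - z)" for z
    proof -
      have "(\<lambda>n. (fst (Y n), snd (Y n) - z)) \<longlonglongrightarrow> (fst p, snd p - z)"
        by (intro tendsto_Pair tendsto_diff tendsto_fst tendsto_snd Y tendsto_const)
      from continuous_on_tendsto_compose[OF h this] show ?thesis
        using YS p by (auto simp: mem_Times_iff)
    qed
    thus "AE z in lborel. (\<lambda>n. k z * h (fst (Y n)) (snd (Y n) - z)) \<longlonglongrightarrow> k z * h (fst p) (snd p - z)"
      by (intro AE_I2 tendsto_mult_left)
    show "AE z in lborel. norm (k z * h (fst (Y n)) (snd (Y n) - z)) \<le> \<bar>k z\<bar> * C" for n
      using C[OF YS[of n]] by (auto simp: abs_mult intro!: AE_I2 mult_left_mono)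
  qed (use k in auto)
  thus "((\<lambda>(t, x). conv k (h t) x) \<circ> Y) \<longlonglongrightarrow> (\<lambda>(t, x). conv k (h t) x) p"
    by (simp add: conv_commute case_prod_unfold o_def)
qed

lemma deriv_integral_atMost:
  fixes h :: "real \<Rightarrow> real"
  assumes h: "continuous_on UNIV h" and int: "\<And>x. integrable lborel (\<lambda>y. indicator {..x} y * h y)"
  shows "((\<lambda>x. LINT y|lborel. indicator {..x} y * h y) has_real_derivative h x) (at x)"
proof -
  define H where "H x = (LINT y|lborel. indicator {..x} y * h y)" for x
  let ?a = "x - 1" and ?b = "x + 1"
  have eq: "H z = H ?a + integral {?a..z} h" if z: "z \<in> {?a..?b}" for z
  proof -
    have [measurable]: "h \<in> borel_measurable borel" by (rule borel_measurable_continuous_onI[OF h])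
    have i: "set_integrable lborel {?a..z} h"
      by (intro borel_integrable_atLeastAtMost' continuous_on_subset[OF h]) auto
    have "H z = (LINT y|lborel. indicator {..?a} y * h y + indicator {?a..z} y * h y)"
      unfolding H_def
    proof (rule integral_cong_AE)
      show "AE y in lborel. indicator {..z} y * h y = indicator {..?a} y * h y + indicator {?a..z} y * h y"
        using AE_lborel_singleton[of ?a] by eventually_elim (use z in \<open>auto simp: indicator_def\<close>)
    qed measurable
    also have "\<dots> = H ?a + (LINT y|lborel. indicator {?a..z} y * h y)"
      unfolding H_def using i by (intro Bochner_Integration.integral_add int) (simp add: set_integrable_def)
    also have "(LINT y|lborel. indicator {?a..z} y * h y) = integral {?a..z} h"
      using set_borel_integral_eq_integral(2)[OF i] by (simp add: set_lebesgue_integral_def)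
    finally show ?thesis .
  qed
  have "((\<lambda>z. H ?a + integral {?a..z} h) has_real_derivative h x) (at x within {?a..?b})"
    by (auto intro!: derivative_eq_intros integral_has_real_derivative continuous_on_subset[OF h])
  hence "(H has_real_derivative h x) (at x within {?a..?b})"
    by (rule has_field_derivative_transform_within[where d = 1]) (auto simp flip: eq)
  thus ?thesis by (simp add: at_within_Icc_at H_def[abs_def])
qed

text \<open>This is the gain of two derivatives: as a distribution, the derivative of
  \<open>dq\<close> is \<open>q\<close> minus a point mass at 0, the latter caused by the jump. The
  proof cuts the kernel at \<open>y = x\<close> into two exponentials, where \<open>x\<close>
  factors out and the fundamental theorem of calculus applies.\<close>

lemma deriv_conv_dq:
  assumes h: "continuous_on UNIV h" and C: "\<And>x. \<bar>h x\<bar> \<le> C"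
  shows "(conv dq h has_real_derivative conv q h x - h x) (at x)"
proof -
  define A where "A h x = (LINT y|lborel. indicator {..x} y * (exp y * h y))" for h and x :: real
  have int: "integrable lborel (\<lambda>y. indicator {..x} y * (exp y * h y))"
    if h: "continuous_on UNIV h" and C: "\<And>x. \<bar>h x\<bar> \<le> C" for h x
  proof (rule Bochner_Integration.integrable_bound)
    have [measurable]: "h \<in> borel_measurable borel" by (rule borel_measurable_continuous_onI[OF h])
    show "integrable lborel (\<lambda>y. exp (2 * \<bar>x\<bar>) * exp (- \<bar>y\<bar>) * C)" using integrable_exp_abs by simp
    show "(\<lambda>y. indicator {..x} y * (exp y * h y)) \<in> borel_measurable lborel" by measurable
    have "\<bar>exp y * h y\<bar> \<le> exp (2 * \<bar>x\<bar>) * exp (- \<bar>y\<bar>) * C" if "y \<le> x" for y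
    proof -
      have "y \<le> 2 * \<bar>x\<bar> + - \<bar>y\<bar>" using that by auto
      hence "exp y \<le> exp (2 * \<bar>x\<bar>) * exp (- \<bar>y\<bar>)" by (simp flip: exp_add)
      from mult_mono[OF this C[of y]] show ?thesis by (simp add: abs_mult)
    qed
    thus "AE y in lborel. norm (indicator {..x} y * (exp y * h y)) \<le> norm (exp (2 * \<bar>x\<bar>) * exp (- \<bar>y\<bar>) * C)"
      by (auto simp: indicator_def intro!: AE_I2 order_trans[OF _ abs_ge_self])
  qed
  have dA: "(A h has_real_derivative exp x * h x) (at x)"
    if h: "continuous_on UNIV h" and C: "\<And>x. \<bar>h x\<bar> \<le> C" for h x
  proof -
    have "continuous_on UNIV (\<lambda>y. exp y * h y)" using h by (intro continuous_intros)
    from deriv_integral_atMost[OF this int[OF h C]] show ?thesis unfolding A_def[abs_def] .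
  qed
  \<comment> \<open>Reflection turns the integral over the right half-line into
    \<open>A ?r (- x)\<close>, so one antiderivative serves both halves.\<close>
  let ?r = "\<lambda>y. h (- y)"
  have r: "continuous_on UNIV ?r" "\<And>x. \<bar>?r x\<bar> \<le> C"
    using C by (auto intro!: continuous_on_compose2[OF h] continuous_intros)
  \<comment> \<open>Up to the factor \<open>1 / 2\<close> and the null set \<open>y = x\<close>,
    \<open>c = - 1\<close> gives the convolution with \<open>dq\<close> and \<open>c = 1\<close> the
    one with \<open>q\<close>.\<close>
  have split: "(LINT y|lborel. (c * indicator {..x} y * exp (y - x) + indicator {x..} y * exp (x - y)) * h y) =
      c * exp (- x) * A h x + exp x * A ?r (- x)" for c x
  proof -
    have e1: "(\<lambda>y. c * indicator {..x} y * exp (y - x) * h y) = (\<lambda>y. c * exp (- x) * (indicator {..x} y * (exp y * h y)))"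
      by (auto simp: exp_diff exp_minus field_simps)
    have i1: "integrable lborel (\<lambda>y. c * indicator {..x} y * exp (y - x) * h y)"
      unfolding e1 using int[OF h C] by simp
    have e2: "(\<lambda>y. indicator {x..} y * exp (x - y) * h y) = (\<lambda>y. exp x * (indicator {..- x} (0 + (- 1) * y) * (exp (0 + (- 1) * y) * ?r (0 + (- 1) * y))))"
      by (auto simp: exp_diff exp_minus field_simps indicator_def)
    have i2: "integrable lborel (\<lambda>y. indicator {x..} y * exp (x - y) * h y)"
      unfolding e2 using lborel_integrable_real_affine[OF int[OF r, of "- x"], of "-1" 0] by simp
    have "(LINT y|lborel. indicator {x..} y * exp (x - y) * h y) = exp x * A ?r (- x)"
      unfolding e2 A_def integral_mult_right_zero
      using lborel_integral_real_affine[of "-1" "\<lambda>y. indicator {..- x} y * (exp y * ?r y)" 0] by simp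
    moreover have "(LINT y|lborel. c * indicator {..x} y * exp (y - x) * h y) = c * exp (- x) * A h x"
      unfolding e1 A_def by simp
    ultimately show ?thesis unfolding distrib_right by (simp add: Bochner_Integration.integral_add[OF i1 i2])
  qed
  have [measurable]: "h \<in> borel_measurable borel" by (rule borel_measurable_continuous_onI[OF h])
  have P: "conv dq h x = (- 1 * exp (- x) * A h x + exp x * A ?r (- x)) / 2" for x
  proof -
    have "conv dq h x = (LINT y|lborel. ((- 1) * indicator {..x} y * exp (y - x) + indicator {x..} y * exp (x - y)) * h y / 2)"
      unfolding conv_def
    proof (rule integral_cong_AE)
      show "AE y in lborel. dq (x - y) * h y = ((- 1) * indicator {..x} y * exp (y - x) + indicator {x..} y * exp (x - y)) * h y / 2"
        using AE_lborel_singleton[of x] by eventually_elim (auto simp: indicator_def dq_def q_def sgn_if)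
    qed measurable
    thus ?thesis by (simp only: integral_divide_zero split)
  qed
  have Q: "conv q h x = (1 * exp (- x) * A h x + exp x * A ?r (- x)) / 2" for x
  proof -
    have "conv q h x = (LINT y|lborel. (1 * indicator {..x} y * exp (y - x) + indicator {x..} y * exp (x - y)) * h y / 2)"
      unfolding conv_def
    proof (rule integral_cong_AE)
      show "AE y in lborel. q (x - y) * h y = (1 * indicator {..x} y * exp (y - x) + indicator {x..} y * exp (x - y)) * h y / 2"
        using AE_lborel_singleton[of x] by eventually_elim (auto simp: indicator_def q_def)
    qed measurable
    thus ?thesis by (simp only: integral_divide_zero split)
  qed
  have "((\<lambda>x. A ?r (- x)) has_real_derivative (exp (- x) * ?r (- x)) * (- 1)) (at x)"
    by (rule DERIV_chain2[OF dA[OF r]]) (auto intro!: derivative_eq_intros)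
  hence "((\<lambda>x. (- 1 * exp (- x) * A h x + exp x * A ?r (- x)) / 2) has_real_derivative
      (exp (- x) * A h x - exp (- x) * (exp x * h x) + (exp x * A ?r (- x) - exp x * (exp (- x) * ?r (- x)))) / 2) (at x)"
    by (auto intro!: derivative_eq_intros dA[OF h C])
  also have "(exp (- x) * A h x - exp (- x) * (exp x * h x) + (exp x * A ?r (- x) - exp x * (exp (- x) * ?r (- x)))) / 2
    = conv q h x - h x"
    by (simp add: Q exp_minus field_simps)
  finally show ?thesis unfolding P[abs_def] .
qed

section \<open>Lagrangian form of the equation\<close>

definition source :: "(real \<Rightarrow> real) \<Rightarrow> (real \<Rightarrow> real) \<Rightarrow> real \<Rightarrow> real \<Rightarrow> real" where
  "source f g U V = g U + deriv (deriv f) U / 2 * V\<^sup>2"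

lemma continuous_on_source:
  assumes "smooth f" "smooth g" "continuous_on S U" "continuous_on S V"
  shows "continuous_on S (\<lambda>z. source f g (U z) (V z))"
  unfolding source_def
  using continuous_on_compose2[OF smooth_continuous[OF assms(1), of UNIV 2] assms(3)]
    continuous_on_compose2[OF smooth_continuous[OF assms(2), of UNIV 0] assms(3)] assms(4)
  by (auto intro!: continuous_intros simp: numeral_2_eq_2)

text \<open>The time derivative of \<open>u\<close> is available only pointwise, without continuity
  in both variables. Total differentiability still follows, because continuity of the other partial
  derivative \<open>ux\<close> suffices.\<close>

lemma has_derivative_along_curve:
  fixes u ux :: "real \<Rightarrow> real \<Rightarrow> real"
  assumes ut: "((\<lambda>\<tau>. u \<tau> (y t)) has_real_derivative d) (at t within S)"
    and ux: "\<And>\<tau> x. \<tau> \<in> S \<Longrightarrow> (u \<tau> has_real_derivative ux \<tau> x) (at x)"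
    and cont: "continuous_on (S \<times> UNIV) (\<lambda>(t, x). ux t x)"
    and y: "(y has_real_derivative y') (at t within S)" and t: "t \<in> S"
  shows "((\<lambda>\<tau>. u \<tau> (y \<tau>)) has_real_derivative d + ux t (y t) * y') (at t within S)"
proof -
  have c: "continuous_on (S \<times> UNIV) (\<lambda>(t, x). blinfun_mult_right (ux t x))"
    using bounded_linear.continuous_on[OF bounded_linear_blinfun_mult_right cont]
    by (simp add: case_prod_unfold)
  have "((\<lambda>(\<tau>, x). u \<tau> x) has_derivative (\<lambda>(a, b). d * a + blinfun_mult_right (ux t (y t)) b)) (at (t, y t) within S \<times> UNIV)"
  proof (rule has_derivative_partialsI)
    show "((\<lambda>\<tau>. u \<tau> (y t)) has_derivative (\<lambda>a. d * a)) (at t within S)"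
      using ut by (simp add: has_field_derivative_def)
    show "(u \<tau> has_derivative blinfun_apply (blinfun_mult_right (ux \<tau> x))) (at x within UNIV)" if "\<tau> \<in> S" for \<tau> x
      using ux[OF that, of x] by (simp add: has_field_derivative_def)
    show "continuous (at (t, y t) within S \<times> UNIV) (\<lambda>(t, x). blinfun_mult_right (ux t x))"
      using c t by (simp add: continuous_on_eq_continuous_within)
  qed auto
  hence D: "((\<lambda>(\<tau>, x). u \<tau> x) has_derivative (\<lambda>(a, b). d * a + blinfun_mult_right (ux t (y t)) b))
      (at (t, y t) within (\<lambda>\<tau>. (\<tau>, y \<tau>)) ` S)"
    by (rule has_derivative_subset) auto
  have "((\<lambda>\<tau>. (\<tau>, y \<tau>)) has_derivative (\<lambda>a. (a, y' * a))) (at t within S)"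
    using y by (intro has_derivative_Pair has_derivative_ident) (simp add: has_field_derivative_def)
  from has_derivative_in_compose[OF this D]
  have "((\<lambda>\<tau>. u \<tau> (y \<tau>)) has_derivative (\<lambda>a. d * a + ux t (y t) * (y' * a))) (at t within S)"
    by simp
  moreover have "(\<lambda>a. d * a + ux t (y t) * (y' * a)) = (*) (d + ux t (y t) * y')"
    by (auto simp: algebra_simps)
  ultimately show ?thesis by (simp add: has_field_derivative_def)
qed

text \<open>Three derivatives of \<open>f\<close> appear because uniqueness needs a Lipschitz bound
  for the second one, which is a coefficient of the source.\<close>

definition coefficients_bounded :: "(real \<Rightarrow> real) \<Rightarrow> (real \<Rightarrow> real) \<Rightarrow> real \<Rightarrow> real \<Rightarrow> bool" where
  "coefficients_bounded f g M A \<longleftrightarrow> (\<forall>z. \<bar>z\<bar> \<le> M \<longrightarrow> \<bar>deriv f z\<bar> \<le> A \<and> \<bar>deriv (deriv f) z\<bar> \<le> A \<and>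
    \<bar>deriv (deriv (deriv f)) z\<bar> \<le> A \<and> \<bar>g z\<bar> \<le> A \<and> \<bar>deriv g z\<bar> \<le> A)"

text \<open>The Sobolev exponent has disappeared. The constants \<open>M\<close> and
  \<open>A\<close> are parameters so that two solutions can be compared under common bounds.\<close>

locale regular_solution =
  fixes f g :: "real \<Rightarrow> real" and T M A :: real and u ux :: "real \<Rightarrow> real \<Rightarrow> real"
  assumes f: "smooth f" and g: "smooth g" and T: "T > 0"
    and cont_u: "continuous_on ({0..T} \<times> UNIV) (\<lambda>(t, x). u t x)"
    and cont_ux: "continuous_on ({0..T} \<times> UNIV) (\<lambda>(t, x). ux t x)"
    and deriv_u: "t \<in> {0..T} \<Longrightarrow> (u t has_real_derivative ux t x) (at x)"
    and u_bound: "t \<in> {0..T} \<Longrightarrow> \<bar>u t x\<bar> \<le> M"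
    and ux_bound: "t \<in> {0..T} \<Longrightarrow> \<bar>ux t x\<bar> \<le> M"
    and coeff: "coefficients_bounded f g M A"
    and pde: "t \<in> {0..T} \<Longrightarrow> ((\<lambda>\<tau>. u \<tau> x) has_real_derivative
      - deriv f (u t x) * ux t x - conv dq (\<lambda>y. source f g (u t y) (ux t y)) x) (at t within {0..T})"
begin

lemma coeff_bound:
  assumes "\<bar>z\<bar> \<le> M"
  shows "\<bar>deriv f z\<bar> \<le> A" "\<bar>deriv (deriv f) z\<bar> \<le> A" "\<bar>deriv (deriv (deriv f)) z\<bar> \<le> A"
    "\<bar>g z\<bar> \<le> A" "\<bar>deriv g z\<bar> \<le> A"
  using coeff assms by (auto simp: coefficients_bounded_def)

lemma M_nonneg: "M \<ge> 0" and A_nonneg: "A \<ge> 0"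
proof -
  show "M \<ge> 0" using u_bound[of 0 0] T by auto
  thus "A \<ge> 0" using coeff_bound(1)[of 0] by auto
qed

lemma deriv_f: "(f has_real_derivative deriv f z) (at z)"
  "(deriv f has_real_derivative deriv (deriv f) z) (at z)"
  "(deriv (deriv f) has_real_derivative deriv (deriv (deriv f)) z) (at z)"
  and deriv_g: "(g has_real_derivative deriv g z) (at z)"
  using smooth_has_derivative[OF f, of 0] smooth_has_derivative[OF f, of 1] smooth_has_derivative[OF f, of 2]
    smooth_has_derivative[OF g, of 0]
  by (auto simp: numeral_2_eq_2)

lemma continuous_coeff: "continuous_on S (deriv f)" "continuous_on S (deriv (deriv f))"
  using deriv_f by (auto intro!: continuous_at_imp_continuous_on DERIV_isCont)

text \<open>The speed of the flow is at most \<open>A\<close>, so labels move by at most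
  \<open>A * T\<close>. The summand 1 in the Lipschitz constant only makes it strictly positive,
  since the Picard argument divides by it.\<close>

sublocale flow1d "\<lambda>t x. deriv f (u t x)" "\<lambda>t x. deriv (deriv f) (u t x) * ux t x" T A "A * M + 1"
proof
  show "A * M + 1 > 0" using A_nonneg M_nonneg by (simp add: add_nonneg_pos)
  show "T > 0" by (rule T)
  show "continuous_on ({0..T} \<times> UNIV) (\<lambda>(t, x). deriv f (u t x))"
    using continuous_on_compose2[OF continuous_coeff(1)[of UNIV] cont_u] by (simp add: case_prod_unfold)
  have "continuous_on ({0..T} \<times> UNIV) (\<lambda>p. deriv (deriv f) (u (fst p) (snd p)) * ux (fst p) (snd p))"
    using continuous_on_compose2[OF continuous_coeff(2)[of UNIV] cont_u] cont_ux
    by (intro continuous_intros) (simp_all add: case_prod_unfold)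
  thus "continuous_on ({0..T} \<times> UNIV) (\<lambda>(t, x). deriv (deriv f) (u t x) * ux t x)"
    by (simp add: case_prod_unfold)
  fix t x assume t: "t \<in> {0..T}"
  show "((\<lambda>x. deriv f (u t x)) has_real_derivative deriv (deriv f) (u t x) * ux t x) (at x)"
    by (rule DERIV_chain2[OF deriv_f(2) deriv_u[OF t]])
  show "\<bar>deriv f (u t x)\<bar> \<le> A" by (intro coeff_bound u_bound t)
  have "\<bar>deriv (deriv f) (u t x) * ux t x\<bar> \<le> A * M"
    unfolding abs_mult using A_nonneg by (intro mult_mono coeff_bound u_bound ux_bound t) auto
  thus "\<bar>deriv (deriv f) (u t x) * ux t x\<bar> \<le> A * M + 1" by simp
qed

definition F :: "real \<Rightarrow> real \<Rightarrow> real" where "F t y = source f g (u t y) (ux t y)"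
definition P :: "real \<Rightarrow> real \<Rightarrow> real" where "P t = conv dq (F t)"
definition Q :: "real \<Rightarrow> real \<Rightarrow> real" where "Q t = conv q (F t)"
definition U :: "real \<Rightarrow> real \<Rightarrow> real" where "U t a = u t (X t a)"
definition V :: "real \<Rightarrow> real \<Rightarrow> real" where "V t a = ux t (X t a)"

definition FB :: real where "FB = A + A / 2 * M\<^sup>2"

lemma source_bound:
  assumes "\<bar>z\<bar> \<le> M" "\<bar>w\<bar> \<le> M"
  shows "\<bar>source f g z w\<bar> \<le> FB"
proof -
  have "\<bar>source f g z w\<bar> \<le> \<bar>g z\<bar> + \<bar>deriv (deriv f) z\<bar> / 2 * w\<^sup>2"
    unfolding source_def by (rule order_trans[OF abs_triangle_ineq]) (simp add: abs_mult)
  also have "\<dots> \<le> A + A / 2 * M\<^sup>2"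
    using A_nonneg assms abs_le_square_iff[of w M] by (intro add_mono mult_mono divide_right_mono coeff_bound) auto
  finally show ?thesis by (simp add: FB_def)
qed

lemma F_bound: "t \<in> {0..T} \<Longrightarrow> \<bar>F t x\<bar> \<le> FB"
  unfolding F_def by (intro source_bound u_bound ux_bound)

lemma continuous_F: "continuous_on ({0..T} \<times> UNIV) (\<lambda>(t, x). F t x)"
  using continuous_on_source[OF f g cont_u[unfolded case_prod_unfold] cont_ux[unfolded case_prod_unfold]]
  by (simp add: F_def case_prod_unfold)

lemma continuous_F_space: "t \<in> {0..T} \<Longrightarrow> continuous_on UNIV (F t)"
  by (rule continuous_on_slice[OF continuous_F]) (auto intro!: continuous_intros)

lemma measurable_F: "t \<in> {0..T} \<Longrightarrow> F t \<in> borel_measurable borel"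
  by (intro borel_measurable_continuous_onI continuous_F_space)

lemma continuous_P: "continuous_on ({0..T} \<times> UNIV) (\<lambda>(t, x). P t x)"
  and continuous_Q: "continuous_on ({0..T} \<times> UNIV) (\<lambda>(t, x). Q t x)"
  unfolding P_def Q_def
  by (rule continuous_on_conv[OF _ continuous_F F_bound]; simp add: integrable_q integrable_dq)+

lemma deriv_P: "t \<in> {0..T} \<Longrightarrow> (P t has_real_derivative Q t x - F t x) (at x)"
  unfolding P_def Q_def by (rule deriv_conv_dq[OF continuous_F_space F_bound])

lemma deriv_U:
  assumes t: "t \<in> {0..T}"
  shows "((\<lambda>t. U t a) has_real_derivative - P t (X t a)) (at t within {0..T})"
proof -
  have "((\<lambda>\<tau>. u \<tau> (X \<tau> a)) has_real_derivative
      (- deriv f (u t (X t a)) * ux t (X t a) - conv dq (\<lambda>y. source f g (u t y) (ux t y)) (X t a)) +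
      ux t (X t a) * deriv f (u t (X t a))) (at t within {0..T})"
    by (rule has_derivative_along_curve[OF pde deriv_u cont_ux deriv_X]) (use t in auto)
  thus ?thesis by (simp add: U_def P_def F_def[abs_def])
qed

lemma continuous_U: "continuous_on ({0..T} \<times> UNIV) (\<lambda>(t, a). U t a)"
  and continuous_V: "continuous_on ({0..T} \<times> UNIV) (\<lambda>(t, a). V t a)"
  unfolding U_def V_def by (rule continuous_along_X[OF cont_u] continuous_along_X[OF cont_ux])+

lemma U_bound: "t \<in> {0..T} \<Longrightarrow> \<bar>U t a\<bar> \<le> M" and V_bound: "t \<in> {0..T} \<Longrightarrow> \<bar>V t a\<bar> \<le> M"
  unfolding U_def V_def by (rule u_bound ux_bound, assumption)+

text \<open>
  \<open>u\<close> has no second space derivative, so the equation for \<open>u\<^sub>x\<close> cannot be obtained by differentiating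
  the PDE. Instead the integrated equation for \<open>U\<close> is differentiated in the label \<open>a\<close>.
\<close>

lemma V_J_eq:
  assumes t: "t \<in> {0..T}"
  shows "V t a * J t a = V 0 a - integral {0..t} (\<lambda>\<tau>. (Q \<tau> (X \<tau> a) - F \<tau> (X \<tau> a)) * J \<tau> a)"
proof -
  have Ueq: "U t a = U 0 a + - integral {0..t} (\<lambda>\<tau>. P \<tau> (X \<tau> a))" for a
  proof -
    have "((\<lambda>\<tau>. - P \<tau> (X \<tau> a)) has_integral (U t a - U 0 a)) {0..t}"
      using t by (intro fundamental_theorem_of_calculus)
        (auto simp flip: has_real_derivative_iff_has_vector_derivative intro!: DERIV_subset[OF deriv_U])
    from integral_unique[OF this] show ?thesis by simp
  qed
  have E: "U t = (\<lambda>a. U 0 a + - integral {0..t} (\<lambda>\<tau>. P \<tau> (X \<tau> a)))"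
    by (rule ext) (rule Ueq)
  have cPX: "continuous_on ({0..T} \<times> UNIV) (\<lambda>(t, a). P t (X t a))"
    by (rule continuous_along_X[OF continuous_P])
  have cD: "continuous_on ({0..T} \<times> UNIV) (\<lambda>(t, a). (Q t (X t a) - F t (X t a)) * J t a)"
    using continuous_along_X[OF continuous_Q] continuous_along_X[OF continuous_F] continuous_J
    unfolding case_prod_unfold by (intro continuous_intros)
  \<comment> \<open>The derivative of \<open>P\<close> in space is \<open>Q - F\<close> by
    \<open>deriv_P\<close>, which is continuous and involves no second derivative of
    \<open>u\<close>. Hence the integrated equation can be differentiated under the integral
    sign.\<close>
  have "((\<lambda>a. integral (cbox 0 t) (\<lambda>\<tau>. P \<tau> (X \<tau> a))) has_real_derivative
      integral (cbox 0 t) (\<lambda>\<tau>. (Q \<tau> (X \<tau> a) - F \<tau> (X \<tau> a)) * J \<tau> a)) (at a within UNIV)"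
  proof (rule leibniz_rule_field_derivative)
    show "((\<lambda>a. P \<tau> (X \<tau> a)) has_real_derivative (Q \<tau> (X \<tau> a) - F \<tau> (X \<tau> a)) * J \<tau> a) (at a within UNIV)"
      if "\<tau> \<in> cbox 0 t" for a \<tau>
      using that t by (auto intro!: DERIV_chain2[OF deriv_P deriv_X_space])
    show "(\<lambda>\<tau>. P \<tau> (X \<tau> a)) integrable_on cbox 0 t" for a
      by (intro integrable_continuous continuous_on_slice[OF cPX]) (use t in \<open>auto intro!: continuous_intros\<close>)
    show "continuous_on (UNIV \<times> cbox 0 t) (\<lambda>(a, \<tau>). (Q \<tau> (X \<tau> a) - F \<tau> (X \<tau> a)) * J \<tau> a)"
      unfolding case_prod_unfold
      by (rule continuous_on_slice[OF cD]) (use t in \<open>auto intro!: continuous_intros\<close>)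
  qed auto
  hence R: "((\<lambda>a. integral {0..t} (\<lambda>\<tau>. P \<tau> (X \<tau> a))) has_real_derivative
      integral {0..t} (\<lambda>\<tau>. (Q \<tau> (X \<tau> a) - F \<tau> (X \<tau> a)) * J \<tau> a)) (at a)" by simp
  have "(U 0 has_real_derivative V 0 a * J 0 a) (at a)" "(U t has_real_derivative V t a * J t a) (at a)"
    unfolding U_def[abs_def] V_def using T t
    by (auto intro!: DERIV_chain2[OF deriv_u deriv_X_space])
  hence "((\<lambda>a. U 0 a + - integral {0..t} (\<lambda>\<tau>. P \<tau> (X \<tau> a))) has_real_derivative
      V 0 a + - integral {0..t} (\<lambda>\<tau>. (Q \<tau> (X \<tau> a) - F \<tau> (X \<tau> a)) * J \<tau> a)) (at a)"
    using R by (intro derivative_intros) (simp_all add: J_0)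
  hence "(U t has_real_derivative V 0 a + - integral {0..t} (\<lambda>\<tau>. (Q \<tau> (X \<tau> a) - F \<tau> (X \<tau> a)) * J \<tau> a)) (at a)"
    by (simp only: E)
  from DERIV_unique[OF \<open>(U t has_real_derivative V t a * J t a) (at a)\<close> this] show ?thesis by simp
qed

text \<open>Obtained by writing \<open>V\<close> as the quotient of \<open>V_J_eq\<close> by
  \<open>J\<close>: the integral term loses its factor \<open>J\<close>, and differentiating the
  denominator contributes the term quadratic in \<open>V\<close>.\<close>

definition dV :: "real \<Rightarrow> real \<Rightarrow> real" where
  "dV t a = source f g (U t a) (V t a) - deriv (deriv f) (U t a) * (V t a)\<^sup>2 - Q t (X t a)"

lemma deriv_V:
  assumes t: "t \<in> {0..T}"
  shows "((\<lambda>t. V t a) has_real_derivative dV t a) (at t within {0..T})"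
proof -
  let ?D = "\<lambda>\<tau>. (Q \<tau> (X \<tau> a) - F \<tau> (X \<tau> a)) * J \<tau> a"
  have cD: "continuous_on {0..T} ?D"
    by (intro continuous_intros continuous_along[OF continuous_Q] continuous_along[OF continuous_F] continuous_X
        DERIV_continuous_on[OF deriv_J])
  have "((\<lambda>t. (V 0 a - integral {0..t} ?D) / J t a) has_real_derivative
      ((- ?D t) * J t a - (V 0 a - integral {0..t} ?D) * (deriv (deriv f) (u t (X t a)) * ux t (X t a) * J t a)) / (J t a * J t a)) (at t within {0..T})"
    using J_pos[of t a]
    by (auto intro!: derivative_eq_intros integral_has_real_derivative[OF cD t] deriv_J t)
  also have "((- ?D t) * J t a - (V 0 a - integral {0..t} ?D) * (deriv (deriv f) (u t (X t a)) * ux t (X t a) * J t a)) / (J t a * J t a) = dV t a"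
    unfolding V_J_eq[OF t, symmetric] using J_pos[of t a]
    by (simp add: dV_def F_def U_def V_def field_simps power2_eq_square)
  finally show ?thesis
  proof (rule has_field_derivative_transform_within[where d = 1])
    show "(V 0 a - integral {0..\<tau>} ?D) / J \<tau> a = V \<tau> a" if "\<tau> \<in> {0..T}" for \<tau>
      using J_pos[of \<tau> a] unfolding V_J_eq[OF that, symmetric] by simp
  qed (use t in auto)
qed

lemma F_X: "F t (X t a) = source f g (U t a) (V t a)"
  by (simp add: F_def U_def V_def)

text \<open>Together with \<open>Q_X\<close> this closes the system: the nonlocal terms are
  expressed by \<open>X\<close>, \<open>U\<close>, \<open>V\<close> and \<open>J\<close>
  alone.\<close>

lemma P_X:
  assumes t: "t \<in> {0..T}"
  shows "P t (X t a) = (LINT c|lborel. J t c * (dq (X t a - X t c) * source f g (U t c) (V t c)))"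
proof -
  note [measurable] = measurable_F[OF t]
  have "(\<lambda>y. dq (X t a - y) * F t y) \<in> borel_measurable borel" by measurable
  from integral_X[OF t this] show ?thesis by (simp add: P_def conv_def F_X)
qed

lemma Q_X:
  assumes t: "t \<in> {0..T}"
  shows "Q t (X t a) = (LINT c|lborel. J t c * (q (X t a - X t c) * source f g (U t c) (V t c)))"
proof -
  note [measurable] = measurable_F[OF t]
  have "(\<lambda>y. q (X t a - y) * F t y) \<in> borel_measurable borel" by measurable
  from integral_X[OF t this] show ?thesis by (simp add: Q_def conv_def F_X)
qed

lemma exp_X_diff_le:
  assumes t: "t \<in> {0..T}"
  shows "exp (- \<bar>X t a - X t c\<bar>) \<le> exp (2 * A * T) * exp (- \<bar>a - c\<bar>)"
proof -
  have "\<bar>a - c\<bar> \<le> \<bar>X t a - X t c\<bar> + 2 * A * T"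
    using X_displacement[OF t, of a] X_displacement[OF t, of c] by linarith
  thus ?thesis by (simp flip: exp_add)
qed

end

section \<open>Uniqueness\<close>

lemma abs_diff_mult_le:
  fixes a1 a2 b1 b2 :: real
  assumes "\<bar>a1 - a2\<bar> \<le> d" "\<bar>b1\<bar> \<le> B" "\<bar>a2\<bar> \<le> A" "\<bar>b1 - b2\<bar> \<le> e"
  shows "\<bar>a1 * b1 - a2 * b2\<bar> \<le> d * B + A * e"
proof -
  have "a1 * b1 - a2 * b2 = (a1 - a2) * b1 + a2 * (b1 - b2)" by (simp add: algebra_simps)
  hence "\<bar>a1 * b1 - a2 * b2\<bar> \<le> \<bar>a1 - a2\<bar> * \<bar>b1\<bar> + \<bar>a2\<bar> * \<bar>b1 - b2\<bar>"
    by (simp flip: abs_mult add: abs_triangle_ineq)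
  also have "\<dots> \<le> d * B + A * e"
    using assms by (intro add_mono mult_mono) auto
  finally show ?thesis .
qed

lemma abs_exp_diff_le: "\<bar>exp (- s) - exp (- t)\<bar> \<le> \<bar>s - t\<bar> * (exp (- s) + exp (- t))" for s t :: real
proof -
  have main: "\<bar>exp (- s) - exp (- t)\<bar> \<le> \<bar>s - t\<bar> * (exp (- s) + exp (- t))" if "s \<le> t" for s t :: real
  proof -
    have "exp (- s) - exp (- t) = exp (- s) * (1 - exp (s - t))"
      by (simp add: right_diff_distrib flip: exp_add)
    also have "\<dots> \<le> exp (- s) * (t - s)"
    proof (rule mult_left_mono)
      show "1 - exp (s - t) \<le> t - s" using exp_ge_add_one_self[of "s - t"] by linarith
    qed simp
    also have "\<dots> \<le> (exp (- s) + exp (- t)) * (t - s)" using that by (intro mult_right_mono) auto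
    finally show ?thesis using that by (simp add: mult.commute)
  qed
  show ?thesis
    using main[of s t] main[of t s] by (cases "s \<le> t") (auto simp: abs_minus_commute add.commute)
qed

text \<open>A Lipschitz bound that keeps the exponential decay. A bound by
  \<open>\<bar>x - y\<bar>\<close> alone could not be integrated over all labels.\<close>

lemma abs_q_diff_le: "\<bar>q x - q y\<bar> \<le> \<bar>x - y\<bar> * (exp (- \<bar>x\<bar>) + exp (- \<bar>y\<bar>)) / 2"
proof -
  have "\<bar>q x - q y\<bar> = \<bar>exp (- \<bar>x\<bar>) - exp (- \<bar>y\<bar>)\<bar> / 2" by (simp add: q_def flip: diff_divide_distrib)
  also have "\<dots> \<le> \<bar>\<bar>x\<bar> - \<bar>y\<bar>\<bar> * (exp (- \<bar>x\<bar>) + exp (- \<bar>y\<bar>)) / 2"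
    by (intro divide_right_mono abs_exp_diff_le) simp
  also have "\<dots> \<le> \<bar>x - y\<bar> * (exp (- \<bar>x\<bar>) + exp (- \<bar>y\<bar>)) / 2"
    by (intro divide_right_mono mult_right_mono abs_triangle_ineq3) auto
  finally show ?thesis .
qed

context regular_solution
begin

lemma coeff_lipschitz:
  assumes "\<bar>z\<bar> \<le> M" "\<bar>w\<bar> \<le> M"
  shows "\<bar>deriv f z - deriv f w\<bar> \<le> A * \<bar>z - w\<bar>"
    "\<bar>deriv (deriv f) z - deriv (deriv f) w\<bar> \<le> A * \<bar>z - w\<bar>" "\<bar>g z - g w\<bar> \<le> A * \<bar>z - w\<bar>"
  using field_differentiable_bound[of "{-M..M}" "deriv f" "deriv (deriv f)" A z w]
    field_differentiable_bound[of "{-M..M}" "deriv (deriv f)" "deriv (deriv (deriv f))" A z w]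
    field_differentiable_bound[of "{-M..M}" g "deriv g" A z w]
    deriv_f deriv_g coeff_bound assms
  by (auto simp: abs_le_iff has_field_derivative_at_within)

lemma quadratic_diff:
  assumes "\<bar>z\<bar> \<le> M" "\<bar>z'\<bar> \<le> M" "\<bar>w\<bar> \<le> M" "\<bar>w'\<bar> \<le> M" "\<bar>z - z'\<bar> \<le> d" "\<bar>w - w'\<bar> \<le> d"
  shows "\<bar>deriv (deriv f) z * w\<^sup>2 - deriv (deriv f) z' * w'\<^sup>2\<bar> \<le> (A * M\<^sup>2 + 2 * A * M) * d"
proof -
  have sq: "\<bar>w\<^sup>2 - w'\<^sup>2\<bar> \<le> d * M + M * d"
    unfolding power2_eq_square by (rule abs_diff_mult_le) (use assms in auto)
  have "\<bar>deriv (deriv f) z - deriv (deriv f) z'\<bar> \<le> A * d"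
    using coeff_lipschitz(2)[OF assms(1,2)] mult_left_mono[OF assms(5) A_nonneg] by linarith
  from abs_diff_mult_le[OF this _ coeff_bound(2)[OF assms(2)] sq, of "M\<^sup>2"] assms(3) abs_le_square_iff[of w M] M_nonneg
  have "\<bar>deriv (deriv f) z * w\<^sup>2 - deriv (deriv f) z' * w'\<^sup>2\<bar> \<le> A * d * M\<^sup>2 + A * (d * M + M * d)" by simp
  thus ?thesis by (simp add: algebra_simps)
qed

definition GL :: real where "GL = A + (A * M\<^sup>2 + 2 * A * M)"

lemma source_diff:
  assumes "\<bar>z\<bar> \<le> M" "\<bar>z'\<bar> \<le> M" "\<bar>w\<bar> \<le> M" "\<bar>w'\<bar> \<le> M" "\<bar>z - z'\<bar> \<le> d" "\<bar>w - w'\<bar> \<le> d"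
  shows "\<bar>source f g z w - source f g z' w'\<bar> \<le> GL * d"
proof -
  have "\<bar>g z - g z'\<bar> \<le> A * d"
    using coeff_lipschitz(3)[OF assms(1,2)] mult_left_mono[OF assms(5) A_nonneg] by linarith
  moreover note quadratic_diff[OF assms]
  moreover have "source f g z w - source f g z' w' = (g z - g z') +
      (deriv (deriv f) z * w\<^sup>2 - deriv (deriv f) z' * w'\<^sup>2) / 2"
    by (simp add: source_def diff_divide_distrib)
  moreover have "\<bar>a + b / 2\<bar> \<le> x + y" if "\<bar>a\<bar> \<le> x" "\<bar>b\<bar> \<le> y" for a b x y :: real
    using that by linarith
  ultimately show ?thesis unfolding GL_def distrib_right[of A] by metis
qed

lemma FB_nonneg: "FB \<ge> 0" and GL_nonneg: "GL \<ge> 0"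
  using A_nonneg M_nonneg by (auto simp: FB_def GL_def)

lemma continuous_space:
  assumes t: "t \<in> {0..T}"
  shows "continuous_on UNIV (U t)" "continuous_on UNIV (V t)"
  by (rule continuous_on_slice[OF continuous_U] continuous_on_slice[OF continuous_V]; use t in \<open>auto intro!: continuous_intros\<close>)+

lemma measurable_source: "t \<in> {0..T} \<Longrightarrow> (\<lambda>c. source f g (U t c) (V t c)) \<in> borel_measurable borel"
  by (intro borel_measurable_continuous_onI continuous_on_source f g continuous_space)

lemma integrable_kernel:
  assumes t: "t \<in> {0..T}" and k: "k \<in> borel_measurable borel" "\<And>x. \<bar>k x\<bar> \<le> exp (- \<bar>x\<bar>) / 2"
  shows "integrable lborel (\<lambda>c. J t c * (k (X t a - X t c) * source f g (U t c) (V t c)))"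
proof (rule Bochner_Integration.integrable_bound)
  let ?C = "exp ((A * M + 1) * T) * (exp (2 * A * T) * FB)"
  note [measurable] = measurable_J[OF t] measurable_X[OF t] measurable_source[OF t] k(1)
  show "integrable lborel (\<lambda>c. ?C * exp (- \<bar>a - c\<bar>))"
    using integrable_exp_shift by simp
  have "norm (J t c * (k (X t a - X t c) * source f g (U t c) (V t c))) \<le> ?C * exp (- \<bar>a - c\<bar>)" for c
  proof -
    have "\<bar>k (X t a - X t c)\<bar> \<le> exp (2 * A * T) * exp (- \<bar>a - c\<bar>)"
      using k(2)[of "X t a - X t c"] exp_X_diff_le[OF t, of a c] by simp
    hence "norm (J t c * (k (X t a - X t c) * source f g (U t c) (V t c))) \<le>
        exp ((A * M + 1) * T) * ((exp (2 * A * T) * exp (- \<bar>a - c\<bar>)) * FB)"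
      unfolding real_norm_def abs_mult
      using J_le[OF t, of c] J_pos[of t c] by (intro mult_mono source_bound U_bound V_bound t) auto
    thus ?thesis by (simp add: mult_ac)
  qed
  thus "AE c in lborel. norm (J t c * (k (X t a - X t c) * source f g (U t c) (V t c))) \<le> norm (?C * exp (- \<bar>a - c\<bar>))"
    using FB_nonneg by (auto intro!: AE_I2 simp: abs_mult)
  show "(\<lambda>c. J t c * (k (X t a - X t c) * source f g (U t c) (V t c))) \<in> borel_measurable lborel" by measurable
qed

end

text \<open>Let \<open>Z\<close> be the supremum of the total difference weighted by
  \<open>exp (- r * t)\<close> over all times and labels. Each right-hand side is Lipschitz in these
  sup norms, so integration in time bounds every component by
  \<open>C * Z / r * exp (r * t)\<close>; a large \<open>r\<close> gives
  \<open>Z \<le> Z / 2\<close>.\<close>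

lemma regular_solution_unique:
  assumes S1: "regular_solution f g T M A u ux" and S2: "regular_solution f g T M A w wx"
    and init: "\<And>x. u 0 x = w 0 x" and t: "t \<in> {0..T}"
  shows "u t x = w t x"
proof -
  interpret S1: regular_solution f g T M A u ux by (rule S1)
  interpret S2: regular_solution f g T M A w wx by (rule S2)
  let ?E = "exp (2 * A * T)" and ?EJ = "exp ((A * M + 1) * T)"
  note T = S1.T and M = S1.M_nonneg and A = S1.A_nonneg
  \<comment> \<open>The summands record the variation of the Jacobian, of the source and of the
    kernel. The last carries a 2 because both endpoints of the kernel argument move; the leading 2
    is the integral of \<open>exp (- \<bar>a - c\<bar>)\<close>, and \<open>?E\<close> compares the
    kernel in positions with the one in labels.\<close>
  define CK where "CK = 2 * ?E * (S1.FB + ?EJ * S1.GL + 2 * ?EJ * S1.FB)"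
  have CK: "CK \<ge> 0" using S1.FB_nonneg S1.GL_nonneg by (simp add: CK_def)
  \<comment> \<open>One estimate for both \<open>q\<close> and \<open>dq\<close>. The third
    condition on \<open>k\<close> reduces its variation between the two flows to that of the
    continuous kernel \<open>q\<close>.\<close>
  have kernel: "\<bar>(LINT c|lborel. S1.J t c * (k (S1.X t a - S1.X t c) * source f g (S1.U t c) (S1.V t c))) -
       (LINT c|lborel. S2.J t c * (k (S2.X t a - S2.X t c) * source f g (S2.U t c) (S2.V t c)))\<bar> \<le> CK * d"
    if t: "t \<in> {0..T}" and k: "k \<in> borel_measurable borel" "\<And>x. \<bar>k x\<bar> \<le> exp (- \<bar>x\<bar>) / 2"
      "\<And>c. \<bar>k (S1.X t a - S1.X t c) - k (S2.X t a - S2.X t c)\<bar> \<le> \<bar>q (S1.X t a - S1.X t c) - q (S2.X t a - S2.X t c)\<bar>"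
      and d: "\<And>c. \<bar>S1.X t c - S2.X t c\<bar> \<le> d" "\<And>c. \<bar>S1.U t c - S2.U t c\<bar> \<le> d"
        "\<And>c. \<bar>S1.V t c - S2.V t c\<bar> \<le> d" "\<And>c. \<bar>S1.J t c - S2.J t c\<bar> \<le> d"
    for t a d and k :: "real \<Rightarrow> real"
  proof -
    let ?e = "\<lambda>c. exp (- \<bar>a - c\<bar>)"
    let ?G1 = "\<lambda>c. source f g (S1.U t c) (S1.V t c)" and ?G2 = "\<lambda>c. source f g (S2.U t c) (S2.V t c)"
    let ?k1 = "\<lambda>c. k (S1.X t a - S1.X t c)" and ?k2 = "\<lambda>c. k (S2.X t a - S2.X t c)"
    have d0: "d \<ge> 0" using d(1)[of a] by linarith
    have pw: "\<bar>S1.J t c * (?k1 c * ?G1 c) - S2.J t c * (?k2 c * ?G2 c)\<bar> \<le> CK / 2 * d * ?e c" for c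
    proof -
      have JG: "\<bar>S1.J t c * ?G1 c - S2.J t c * ?G2 c\<bar> \<le> d * S1.FB + ?EJ * (S1.GL * d)"
        by (rule abs_diff_mult_le)
          (use S2.J_le[OF t, of c] S2.J_pos[of t c] d in \<open>auto intro!: S1.source_bound S1.source_diff S1.U_bound S1.V_bound S2.U_bound S2.V_bound t\<close>)
      have k1: "\<bar>?k1 c\<bar> \<le> ?E * ?e c"
        using k(2)[of "S1.X t a - S1.X t c"] S1.exp_X_diff_le[OF t, of a c] by simp
      have J2: "\<bar>S2.J t c * ?G2 c\<bar> \<le> ?EJ * S1.FB"
        unfolding abs_mult using S2.J_le[OF t, of c] S2.J_pos[of t c]
        by (intro mult_mono S1.source_bound S2.U_bound S2.V_bound t) auto
      have kd: "\<bar>?k1 c - ?k2 c\<bar> \<le> 2 * d * (?E * ?e c)"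
      proof -
        have "\<bar>(S1.X t a - S1.X t c) - (S2.X t a - S2.X t c)\<bar> \<le> 2 * d"
          using d(1)[of a] d(1)[of c] by linarith
        moreover have "exp (- \<bar>S1.X t a - S1.X t c\<bar>) + exp (- \<bar>S2.X t a - S2.X t c\<bar>) \<le> 2 * (?E * ?e c)"
          using S1.exp_X_diff_le[OF t, of a c] S2.exp_X_diff_le[OF t, of a c] by simp
        ultimately have "\<bar>(S1.X t a - S1.X t c) - (S2.X t a - S2.X t c)\<bar> *
            (exp (- \<bar>S1.X t a - S1.X t c\<bar>) + exp (- \<bar>S2.X t a - S2.X t c\<bar>)) \<le> (2 * d) * (2 * (?E * ?e c))"
          using d0 by (intro mult_mono) auto
        thus ?thesis
          using k(3)[of c] abs_q_diff_le[of "S1.X t a - S1.X t c" "S2.X t a - S2.X t c"] by linarith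
      qed
      have "\<bar>S1.J t c * (?k1 c * ?G1 c) - S2.J t c * (?k2 c * ?G2 c)\<bar> =
          \<bar>(S1.J t c * ?G1 c) * ?k1 c - (S2.J t c * ?G2 c) * ?k2 c\<bar>"
        by (simp add: mult_ac)
      also have "\<dots> \<le> (d * S1.FB + ?EJ * (S1.GL * d)) * (?E * ?e c) + (?EJ * S1.FB) * (2 * d * (?E * ?e c))"
        by (rule abs_diff_mult_le[OF JG k1 J2 kd])
      also have "\<dots> = CK / 2 * d * ?e c" by (simp add: CK_def algebra_simps)
      finally show ?thesis .
    qed
    have int: "integrable lborel (\<lambda>c. CK / 2 * d * ?e c)"
      using integrable_exp_shift by simp
    have e2: "(LINT c|lborel. ?e c) = 2"
      using lborel_integral_real_affine[of "-1" "\<lambda>x. exp (- \<bar>x\<bar>)" a] integral_exp_abs by simp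
    note i = S1.integrable_kernel[OF t k(1,2), of a] S2.integrable_kernel[OF t k(1,2), of a]
    have "norm (LINT c|lborel. S1.J t c * (?k1 c * ?G1 c) - S2.J t c * (?k2 c * ?G2 c)) \<le> (LINT c|lborel. CK / 2 * d * ?e c)"
      using pw by (intro Bochner_Integration.integral_norm_bound_integral Bochner_Integration.integrable_diff i int) auto
    also have "\<dots> = CK * d" unfolding integral_mult_right_zero e2 by simp
    finally show ?thesis by (simp add: Bochner_Integration.integral_diff[OF i])
  qed
  \<comment> \<open>The four groups are the Lipschitz constants of the equations for
    \<open>X\<close>, \<open>U\<close>, \<open>V\<close> and \<open>J\<close>, in this
    order.\<close>
  define C where "C = A + CK + (S1.GL + (A * M\<^sup>2 + 2 * A * M) + CK) + (A * M * ?EJ + A * ?EJ + A * M)"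
  \<comment> \<open>Four components each pick up \<open>C / r\<close>, so \<open>8 * C\<close> makes
    the total factor at most \<open>1 / 2\<close>; the 1 keeps \<open>r\<close> positive when
    \<open>C = 0\<close>.\<close>
  define r where "r = 8 * C + 1"
  have C: "C \<ge> 0" "A \<le> C" "CK \<le> C" "S1.GL + (A * M\<^sup>2 + 2 * A * M) + CK \<le> C" "A * M * ?EJ + A * ?EJ + A * M \<le> C"
    using A M CK S1.GL_nonneg by (auto simp: C_def)
  have r: "r > 0" using C(1) by (simp add: r_def)
  define dd where "dd t a = \<bar>S1.X t a - S2.X t a\<bar> + \<bar>S1.U t a - S2.U t a\<bar> + \<bar>S1.V t a - S2.V t a\<bar> + \<bar>S1.J t a - S2.J t a\<bar>" for t a
  define Z where "Z = (SUP p\<in>{0..T}\<times>UNIV. exp (- r * fst p) * dd (fst p) (snd p))"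
  \<comment> \<open>Finiteness of \<open>Z\<close> is what permits absorbing \<open>Z / 2\<close>.
    It holds because displacements, values, slopes and Jacobians are bounded a priori.\<close>
  have bdd: "bdd_above ((\<lambda>p. exp (- r * fst p) * dd (fst p) (snd p)) ` ({0..T}\<times>UNIV))"
  proof (rule bdd_aboveI2)
    fix p :: "real \<times> real" assume "p \<in> {0..T}\<times>UNIV"
    then obtain t a where p: "p = (t, a)" and t: "t \<in> {0..T}" by auto
    have "\<bar>S1.X t a - S2.X t a\<bar> \<le> 2 * A * T"
      using S1.X_displacement[OF t, of a] S2.X_displacement[OF t, of a] by linarith
    moreover have "\<bar>S1.U t a - S2.U t a\<bar> \<le> 2 * M" "\<bar>S1.V t a - S2.V t a\<bar> \<le> 2 * M"
      using S1.U_bound[OF t, of a] S2.U_bound[OF t, of a] S1.V_bound[OF t, of a] S2.V_bound[OF t, of a] by linarith+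
    moreover have "\<bar>S1.J t a - S2.J t a\<bar> \<le> ?EJ"
      using S1.J_le[OF t, of a] S2.J_le[OF t, of a] S1.J_pos[of t a] S2.J_pos[of t a] by linarith
    ultimately have "dd t a \<le> 2 * A * T + 2 * M + 2 * M + ?EJ"
      unfolding dd_def by (intro add_mono)
    moreover have "exp (- r * t) \<le> 1" "dd t a \<ge> 0" using r t by (auto simp: dd_def)
    ultimately show "exp (- r * fst p) * dd (fst p) (snd p) \<le> 2 * A * T + 2 * M + 2 * M + ?EJ"
      using mult_mono[of "exp (- r * t)" 1 "dd t a" "2 * A * T + 2 * M + 2 * M + ?EJ"] by (simp add: p)
  qed
  have Zle: "dd t a \<le> Z * exp (r * t)" if "t \<in> {0..T}" for t a
  proof -
    have "exp (- r * t) * dd t a \<le> Z"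
      unfolding Z_def using cSUP_upper[OF _ bdd, of "(t, a)"] that by simp
    thus ?thesis by (simp add: exp_minus field_simps)
  qed
  have Z0: "Z \<ge> 0" using Zle[of 0 0] T by (simp add: dd_def)
  have init0: "S1.X 0 a = S2.X 0 a" "S1.U 0 a = S2.U 0 a" "S1.V 0 a = S2.V 0 a" "S1.J 0 a = S2.J 0 a" for a
  proof -
    show "S1.X 0 a = S2.X 0 a" "S1.J 0 a = S2.J 0 a" by (simp_all add: S1.X_0 S2.X_0 S1.J_0 S2.J_0)
    have "u 0 = w 0" using init by auto
    moreover have "(u 0 has_real_derivative ux 0 a) (at a)" "(w 0 has_real_derivative wx 0 a) (at a)"
      using S1.deriv_u[of 0 a] S2.deriv_u[of 0 a] T by auto
    ultimately have "ux 0 a = wx 0 a" using DERIV_unique by metis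
    thus "S1.U 0 a = S2.U 0 a" "S1.V 0 a = S2.V 0 a"
      using init by (simp_all add: S1.U_def S2.U_def S1.V_def S2.V_def S1.X_0 S2.X_0)
  qed
  have comp: "\<bar>S1.X t a - S2.X t a\<bar> \<le> Z * exp (r * t)" "\<bar>S1.U t a - S2.U t a\<bar> \<le> Z * exp (r * t)"
    "\<bar>S1.V t a - S2.V t a\<bar> \<le> Z * exp (r * t)" "\<bar>S1.J t a - S2.J t a\<bar> \<le> Z * exp (r * t)" if "t \<in> {0..T}" for t a
    using Zle[OF that, of a] unfolding dd_def by linarith+
  have half: "dd t a \<le> 4 * (C * Z / r * exp (r * t))" if t: "t \<in> {0..T}" for t a
  proof -
    let ?j1 = "\<lambda>t. deriv (deriv f) (u t (S1.X t a)) * ux t (S1.X t a) * S1.J t a" and ?j2 = "\<lambda>t. deriv (deriv f) (w t (S2.X t a)) * wx t (S2.X t a) * S2.J t a"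
    have weaken: "\<bar>y\<bar> \<le> C * Z * exp (r * t)" if "\<bar>y\<bar> \<le> K * (Z * exp (r * t))" "K \<le> C" for y K t
      using that mult_right_mono[OF that(2), of "Z * exp (r * t)"] Z0 by (simp add: mult.assoc)
    have P: "\<bar>S1.P t (S1.X t a) - S2.P t (S2.X t a)\<bar> \<le> CK * (Z * exp (r * t))" if t: "t \<in> {0..T}" for t
      unfolding S1.P_X[OF t] S2.P_X[OF t]
    proof (rule kernel[OF t])
      \<comment> \<open>Both signs equal \<open>sgn (a - c)\<close> and factor out, leaving the
        difference of the values of \<open>q\<close>.\<close>
      show "\<bar>dq (S1.X t a - S1.X t c) - dq (S2.X t a - S2.X t c)\<bar> \<le> \<bar>q (S1.X t a - S1.X t c) - q (S2.X t a - S2.X t c)\<bar>" for c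
        unfolding dq_def S1.sgn_X_diff[OF t] S2.sgn_X_diff[OF t] right_diff_distrib[symmetric] abs_mult
        by (rule mult_left_le_one_le) (auto simp: sgn_if)
    qed (use comp[OF t] abs_dq_le in auto)
    have Q: "\<bar>S1.Q t (S1.X t a) - S2.Q t (S2.X t a)\<bar> \<le> CK * (Z * exp (r * t))" if t: "t \<in> {0..T}" for t
      unfolding S1.Q_X[OF t] S2.Q_X[OF t]
      by (rule kernel[OF t]) (use comp[OF t] abs_q in auto)
    have "\<bar>S1.X t a - S2.X t a\<bar> \<le> C * Z / r * exp (r * t)"
    proof (rule deriv_exp_bound[where T = T and f = "\<lambda>t. S1.X t a - S2.X t a" and f' = "\<lambda>t. deriv f (u t (S1.X t a)) - deriv f (w t (S2.X t a))"])
      show "\<bar>deriv f (u t (S1.X t a)) - deriv f (w t (S2.X t a))\<bar> \<le> C * Z * exp (r * t)" if t: "t \<in> {0..T}" for t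
      proof (rule weaken[OF _ C(2)])
        have "\<bar>deriv f (S1.U t a) - deriv f (S2.U t a)\<bar> \<le> A * \<bar>S1.U t a - S2.U t a\<bar>"
          by (intro S1.coeff_lipschitz S1.U_bound S2.U_bound t)
        also have "\<dots> \<le> A * (Z * exp (r * t))" using comp(2)[OF t] A by (intro mult_left_mono)
        finally show "\<bar>deriv f (u t (S1.X t a)) - deriv f (w t (S2.X t a))\<bar> \<le> A * (Z * exp (r * t))"
          by (simp add: S1.U_def S2.U_def)
      qed
    qed (use t r C(1) Z0 init0 in \<open>auto intro!: derivative_intros S1.deriv_X S2.deriv_X\<close>)
    moreover have "\<bar>S1.U t a - S2.U t a\<bar> \<le> C * Z / r * exp (r * t)"
    proof (rule deriv_exp_bound[where T = T and f = "\<lambda>t. S1.U t a - S2.U t a" and f' = "\<lambda>t. - S1.P t (S1.X t a) - - S2.P t (S2.X t a)"])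
      show "\<bar>- S1.P t (S1.X t a) - - S2.P t (S2.X t a)\<bar> \<le> C * Z * exp (r * t)" if t: "t \<in> {0..T}" for t
        using weaken[OF P[OF t] C(3)] by (simp add: abs_minus_commute)
      show "((\<lambda>t. S1.U t a - S2.U t a) has_real_derivative - S1.P t (S1.X t a) - - S2.P t (S2.X t a)) (at t within {0..T})"
        if t: "t \<in> {0..T}" for t by (intro derivative_intros S1.deriv_U S2.deriv_U t)
    qed (use t r C(1) Z0 init0 in auto)
    moreover have "\<bar>S1.V t a - S2.V t a\<bar> \<le> C * Z / r * exp (r * t)"
    proof (rule deriv_exp_bound[where T = T and f = "\<lambda>t. S1.V t a - S2.V t a" and f' = "\<lambda>t. S1.dV t a - S2.dV t a"])
      fix t assume t: "t \<in> {0..T}"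
      show "((\<lambda>t. S1.V t a - S2.V t a) has_real_derivative
        S1.dV t a - S2.dV t a) (at t within {0..T})"
        by (intro derivative_intros S1.deriv_V S2.deriv_V t)
      show "\<bar>S1.dV t a - S2.dV t a\<bar> \<le> C * Z * exp (r * t)"
      proof (rule weaken[OF _ C(4)])
        let ?d = "Z * exp (r * t)"
        have "\<bar>source f g (S1.U t a) (S1.V t a) - source f g (S2.U t a) (S2.V t a)\<bar> \<le> S1.GL * ?d"
          by (intro S1.source_diff S1.U_bound S2.U_bound S1.V_bound S2.V_bound t comp)
        moreover have "\<bar>deriv (deriv f) (S1.U t a) * (S1.V t a)\<^sup>2 - deriv (deriv f) (S2.U t a) * (S2.V t a)\<^sup>2\<bar> \<le> (A * M\<^sup>2 + 2 * A * M) * ?d"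
          by (intro S1.quadratic_diff S1.U_bound S2.U_bound S1.V_bound S2.V_bound t comp)
        moreover note Q[OF t]
        ultimately show "\<bar>S1.dV t a - S2.dV t a\<bar> \<le> (S1.GL + (A * M\<^sup>2 + 2 * A * M) + CK) * ?d"
          unfolding distrib_right[of _ _ ?d] S1.dV_def S2.dV_def by linarith
      qed
    qed (use t r C(1) Z0 init0 in auto)
    moreover have "\<bar>S1.J t a - S2.J t a\<bar> \<le> C * Z / r * exp (r * t)"
    proof (rule deriv_exp_bound[where T = T and f = "\<lambda>t. S1.J t a - S2.J t a" and f' = "\<lambda>t.
        ?j1 t - ?j2 t"])
      fix t assume t: "t \<in> {0..T}"
      show "((\<lambda>t. S1.J t a - S2.J t a) has_real_derivative
        ?j1 t - ?j2 t) (at t within {0..T})"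
        by (intro derivative_intros S1.deriv_J S2.deriv_J t)
      show "\<bar>?j1 t - ?j2 t\<bar> \<le> C * Z * exp (r * t)"
      proof (rule weaken[OF _ C(5)])
        let ?d = "Z * exp (r * t)"
        have d0: "?d \<ge> 0" using Z0 by simp
        have "\<bar>deriv (deriv f) (S1.U t a) - deriv (deriv f) (S2.U t a)\<bar> \<le> A * ?d"
          using S1.coeff_lipschitz(2)[OF S1.U_bound[OF t, of a] S2.U_bound[OF t, of a]] mult_left_mono[OF comp(2)[OF t, of a] A] by linarith
        hence "\<bar>deriv (deriv f) (S1.U t a) * S1.V t a - deriv (deriv f) (S2.U t a) * S2.V t a\<bar> \<le> A * ?d * M + A * ?d"
          by (rule abs_diff_mult_le) (intro S1.V_bound S1.coeff_bound S2.U_bound comp t)+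
        hence "\<bar>deriv (deriv f) (S1.U t a) * S1.V t a * S1.J t a - deriv (deriv f) (S2.U t a) * S2.V t a * S2.J t a\<bar>
          \<le> (A * ?d * M + A * ?d) * ?EJ + (A * M) * ?d"
        proof (rule abs_diff_mult_le)
          show "\<bar>S1.J t a\<bar> \<le> ?EJ" using S1.J_le[OF t, of a] S1.J_pos[of t a] by simp
          show "\<bar>deriv (deriv f) (S2.U t a) * S2.V t a\<bar> \<le> A * M"
            unfolding abs_mult by (intro mult_mono S1.coeff_bound S2.U_bound S2.V_bound t A) auto
          show "\<bar>S1.J t a - S2.J t a\<bar> \<le> ?d" by (rule comp[OF t])
        qed
        thus "\<bar>?j1 t - ?j2 t\<bar>
          \<le> (A * M * ?EJ + A * ?EJ + A * M) * ?d"
          by (simp add: S1.U_def S1.V_def S2.U_def S2.V_def algebra_simps)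
      qed
    qed (use t r C(1) Z0 init0 in auto)
    ultimately show ?thesis unfolding dd_def by linarith
  qed
  have "Z \<le> Z / 2"
    unfolding Z_def
  proof (rule cSUP_least)
    fix p :: "real \<times> real" assume "p \<in> {0..T}\<times>UNIV"
    then obtain t a where p: "p = (t, a)" and t: "t \<in> {0..T}" by auto
    have "exp (- r * t) * dd t a \<le> exp (- r * t) * (4 * (C * Z / r * exp (r * t)))"
      by (intro mult_left_mono half t) simp
    also have "\<dots> = 4 * C / r * Z" by (simp add: exp_minus field_simps)
    also have "\<dots> \<le> 1 / 2 * Z"
      using C(1) by (intro mult_right_mono Z0) (simp add: r_def field_simps)
    finally show "exp (- r * fst p) * dd (fst p) (snd p) \<le> (SUP p\<in>{0..T}\<times>UNIV. exp (- r * fst p) * dd (fst p) (snd p)) / 2"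
      by (simp add: p Z_def)
  qed (use T in auto)
  with Z0 have "Z = 0" by simp
  \<comment> \<open>Equality holds label by label. Since \<open>X\<close> is onto and the flows
    coincide, every position \<open>x\<close> carries a common label.\<close>
  obtain a where a: "S1.X t a = x" by (rule S1.X_surj[OF t])
  from Zle[OF t, of a] \<open>Z = 0\<close> have "S1.X t a = S2.X t a" "S1.U t a = S2.U t a"
    unfolding dd_def by auto
  thus ?thesis using a by (simp add: S1.U_def S2.U_def)
qed

section \<open>Convolution and Gronwall estimates\<close>

lemma nn_integral_reflect:
  fixes \<kappa> :: "real \<Rightarrow> ennreal"
  assumes "\<kappa> \<in> borel_measurable borel"
  shows "(\<integral>\<^sup>+c. \<kappa> (a - c) \<partial>lborel) = (\<integral>\<^sup>+c. \<kappa> c \<partial>lborel)"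
  using nn_integral_real_affine[OF assms, of "-1" a] by simp

lemma nn_integral_convolution:
  fixes \<kappa> h :: "real \<Rightarrow> ennreal"
  assumes [measurable]: "\<kappa> \<in> borel_measurable borel" "h \<in> borel_measurable borel"
  shows "(\<integral>\<^sup>+a. (\<integral>\<^sup>+c. \<kappa> (a - c) * h c \<partial>lborel) \<partial>lborel) = (\<integral>\<^sup>+x. \<kappa> x \<partial>lborel) * (\<integral>\<^sup>+c. h c \<partial>lborel)"
proof -
  have "(\<integral>\<^sup>+a. (\<integral>\<^sup>+c. \<kappa> (a - c) * h c \<partial>lborel) \<partial>lborel) = (\<integral>\<^sup>+c. (\<integral>\<^sup>+a. \<kappa> (a - c) * h c \<partial>lborel) \<partial>lborel)"
    by (rule lborel_pair.Fubini'[symmetric]) measurable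
  also have "\<dots> = (\<integral>\<^sup>+c. (\<integral>\<^sup>+x. \<kappa> x \<partial>lborel) * h c \<partial>lborel)"
  proof (rule nn_integral_cong)
    fix c
    have "(\<integral>\<^sup>+a. \<kappa> (a - c) \<partial>lborel) = (\<integral>\<^sup>+x. \<kappa> x \<partial>lborel)"
      using nn_integral_real_affine[of \<kappa> 1 "- c"] by simp
    thus "(\<integral>\<^sup>+a. \<kappa> (a - c) * h c \<partial>lborel) = (\<integral>\<^sup>+x. \<kappa> x \<partial>lborel) * h c"
      by (simp add: nn_integral_multc)
  qed
  finally show ?thesis by (simp add: nn_integral_cmult)
qed

text \<open>Young's inequality for an L^1 kernel acting on L^2: Cauchy-Schwarz with the splitting
  \<open>sqrt \<kappa>\<close> times \<open>sqrt \<kappa> * h\<close>, followed by Fubini.\<close>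

lemma young_L2:
  fixes \<kappa> h :: "real \<Rightarrow> real"
  assumes [measurable]: "\<kappa> \<in> borel_measurable borel" "h \<in> borel_measurable borel"
    and \<kappa>: "\<And>x. \<kappa> x \<ge> 0" and h: "\<And>x. h x \<ge> 0"
  shows "(\<integral>\<^sup>+a. (\<integral>\<^sup>+c. ennreal (\<kappa> (a - c) * h c) \<partial>lborel)\<^sup>2 \<partial>lborel)
    \<le> (\<integral>\<^sup>+x. ennreal (\<kappa> x) \<partial>lborel)\<^sup>2 * (\<integral>\<^sup>+c. ennreal ((h c)\<^sup>2) \<partial>lborel)"
proof -
  let ?\<Lambda> = "\<integral>\<^sup>+x. ennreal (\<kappa> x) \<partial>lborel"
  have "(\<integral>\<^sup>+c. ennreal (\<kappa> (a - c) * h c) \<partial>lborel)\<^sup>2 \<le> ?\<Lambda> * (\<integral>\<^sup>+c. ennreal (\<kappa> (a - c)) * ennreal ((h c)\<^sup>2) \<partial>lborel)" for a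
  proof -
    have "ennreal (\<kappa> (a - c) * h c) = ennreal (sqrt (\<kappa> (a - c))) * ennreal (sqrt (\<kappa> (a - c)) * h c)" for c
      using \<kappa>[of "a - c"] h[of c] by (simp add: mult.assoc[symmetric] flip: ennreal_mult)
    hence "(\<integral>\<^sup>+c. ennreal (\<kappa> (a - c) * h c) \<partial>lborel)\<^sup>2 =
        (\<integral>\<^sup>+c. ennreal (sqrt (\<kappa> (a - c))) * ennreal (sqrt (\<kappa> (a - c)) * h c) \<partial>lborel)\<^sup>2" by simp
    also have "\<dots> \<le> (\<integral>\<^sup>+c. (ennreal (sqrt (\<kappa> (a - c))))\<^sup>2 \<partial>lborel) * (\<integral>\<^sup>+c. (ennreal (sqrt (\<kappa> (a - c)) * h c))\<^sup>2 \<partial>lborel)"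
      by (rule Cauchy_Schwarz_nn_integral) measurable
    also have "(\<integral>\<^sup>+c. (ennreal (sqrt (\<kappa> (a - c))))\<^sup>2 \<partial>lborel) = ?\<Lambda>"
      using nn_integral_reflect[of "\<lambda>x. ennreal (\<kappa> x)" a] \<kappa> by (simp add: ennreal_power)
    also have "(\<integral>\<^sup>+c. (ennreal (sqrt (\<kappa> (a - c)) * h c))\<^sup>2 \<partial>lborel) = (\<integral>\<^sup>+c. ennreal (\<kappa> (a - c)) * ennreal ((h c)\<^sup>2) \<partial>lborel)"
      using \<kappa> h by (intro nn_integral_cong) (simp add: ennreal_power power_mult_distrib flip: ennreal_mult)
    finally show ?thesis .
  qed
  hence "(\<integral>\<^sup>+a. (\<integral>\<^sup>+c. ennreal (\<kappa> (a - c) * h c) \<partial>lborel)\<^sup>2 \<partial>lborel) \<le>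
      (\<integral>\<^sup>+a. ?\<Lambda> * (\<integral>\<^sup>+c. ennreal (\<kappa> (a - c)) * ennreal ((h c)\<^sup>2) \<partial>lborel) \<partial>lborel)"
    by (intro nn_integral_mono)
  also have "\<dots> = ?\<Lambda> * (\<integral>\<^sup>+a. (\<integral>\<^sup>+c. ennreal (\<kappa> (a - c)) * ennreal ((h c)\<^sup>2) \<partial>lborel) \<partial>lborel)"
    by (rule nn_integral_cmult) measurable
  also have "(\<integral>\<^sup>+a. (\<integral>\<^sup>+c. ennreal (\<kappa> (a - c)) * ennreal ((h c)\<^sup>2) \<partial>lborel) \<partial>lborel) = ?\<Lambda> * (\<integral>\<^sup>+c. ennreal ((h c)\<^sup>2) \<partial>lborel)"
    by (rule nn_integral_convolution[of "\<lambda>x. ennreal (\<kappa> x)" "\<lambda>c. ennreal ((h c)\<^sup>2)"]) measurable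
  finally show ?thesis by (simp add: power2_eq_square mult.assoc)
qed

lemma ennreal_le_half_imp:
  fixes Z E :: ennreal
  assumes "Z \<le> E + Z / 2" "Z < \<infinity>"
  shows "Z \<le> 2 * E"
proof (cases E)
  case (real e)
  from assms(2) obtain z where z: "Z = ennreal z" "z \<ge> 0" by (cases Z) auto
  have "Z / 2 = ennreal (z / 2)" using z by (simp add: divide_ennreal flip: ennreal_numeral)
  with assms(1) real z have "ennreal z \<le> ennreal (e + z / 2)" by simp
  hence "z \<le> 2 * e" using real z by (subst (asm) ennreal_le_iff) auto
  thus ?thesis using real z by (simp add: ennreal_leI flip: ennreal_mult' ennreal_numeral)
qed (simp add: ennreal_mult_top)

lemma nn_integral_exp_Icc_le:
  fixes r t :: real
  assumes "r > 0"
  shows "(\<integral>\<^sup>+\<tau>. indicator {0..t} \<tau> * ennreal (exp (r * \<tau>)) \<partial>lborel) \<le> ennreal (exp (r * t) / r)"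
proof (cases "t \<ge> 0")
  case True
  have "(\<integral>\<^sup>+\<tau>. ennreal (exp (r * \<tau>)) * indicator {0..t} \<tau> \<partial>lborel) = ennreal (exp (r * t) / r - exp (r * 0) / r)"
    using assms True by (intro nn_integral_FTC_Icc) (auto intro!: derivative_eq_intros)
  also have "\<dots> \<le> ennreal (exp (r * t) / r)" using assms by (intro ennreal_leI) simp
  finally show ?thesis by (simp add: mult.commute)
qed simp

text \<open>The weight \<open>exp (- 2 * K * t)\<close> reduces the integral term to half the
  supremum \<open>Z\<close>, which is then absorbed. The bound \<open>B\<close> guarantees that
  \<open>Z\<close> is finite but is absent from the conclusion; this matters because it grows with
  the cut-off index in the application.\<close>

lemma gronwall_nn_integral:
  fixes E :: "real \<Rightarrow> ennreal" and K B :: real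
  assumes bd: "\<And>t. t \<in> {0..T} \<Longrightarrow> E t \<le> ennreal B"
    and K: "K > 0" and E: "\<And>t. t \<in> {0..T} \<Longrightarrow> E t \<le> E0 + ennreal K * (\<integral>\<^sup>+\<tau>. indicator {0..t} \<tau> * E \<tau> \<partial>lborel)"
    and t: "t \<in> {0..T}"
  shows "E t \<le> ennreal (exp (2 * K * T)) * (2 * E0)"
proof -
  let ?r = "2 * K"
  define Z where "Z = (SUP t\<in>{0..T}. ennreal (exp (- ?r * t)) * E t)"
  have ee: "ennreal (exp x) * (ennreal (exp (- x)) * y) = y" for x y
    by (simp add: mult.assoc[symmetric] exp_minus flip: ennreal_mult)
  have le: "E t \<le> ennreal (exp (?r * t)) * Z" if "t \<in> {0..T}" for t
  proof -
    have "ennreal (exp (- ?r * t)) * E t \<le> Z" unfolding Z_def using that by (intro SUP_upper)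
    from mult_left_mono[OF this, of "ennreal (exp (?r * t))"] ee[of "?r * t" "E t"] show ?thesis by simp
  qed
  have "Z \<le> E0 + Z / 2" unfolding Z_def
  proof (rule SUP_least, fold Z_def)
    fix t assume t: "t \<in> {0..T}"
    have "(\<integral>\<^sup>+\<tau>. indicator {0..t} \<tau> * E \<tau> \<partial>lborel) \<le> (\<integral>\<^sup>+\<tau>. (indicator {0..t} \<tau> * ennreal (exp (?r * \<tau>))) * Z \<partial>lborel)"
      using le t by (intro nn_integral_mono) (auto simp: indicator_def)
    also have "\<dots> = (\<integral>\<^sup>+\<tau>. indicator {0..t} \<tau> * ennreal (exp (?r * \<tau>)) \<partial>lborel) * Z"
      by (rule nn_integral_multc) measurable
    also have "\<dots> \<le> ennreal (exp (?r * t) / ?r) * Z"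
      using K by (intro mult_right_mono nn_integral_exp_Icc_le) auto
    finally have "E t \<le> E0 + ennreal K * (ennreal (exp (?r * t) / ?r) * Z)"
      using E[OF t] by (meson add_left_mono mult_left_mono order_trans zero_le)
    also have "ennreal K * (ennreal (exp (?r * t) / ?r) * Z) = ennreal (exp (?r * t)) * (ennreal (1 / 2) * Z)"
    proof -
      have "ennreal K * ennreal (exp (?r * t) / ?r) = ennreal (K * (exp (?r * t) / ?r))"
        using K by (intro ennreal_mult[symmetric]) auto
      also have "K * (exp (?r * t) / ?r) = exp (?r * t) * (1 / 2)" using K by simp
      also have "ennreal (exp (?r * t) * (1 / 2)) = ennreal (exp (?r * t)) * ennreal (1 / 2)"
        by (intro ennreal_mult) auto
      finally show ?thesis by (simp only: mult.assoc[symmetric])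
    qed
    also have "E0 \<le> ennreal (exp (?r * t)) * E0"
      using K t mult_right_mono[of 1 "ennreal (exp (?r * t))" E0] by (simp add: ennreal_ge_1)
    finally have "E t \<le> ennreal (exp (?r * t)) * (E0 + ennreal (1 / 2) * Z)"
      by (simp add: distrib_left add_right_mono)
    from mult_left_mono[OF this, of "ennreal (exp (- ?r * t))"] ee[of "- ?r * t" "E0 + ennreal (1 / 2) * Z"]
    have "ennreal (exp (- ?r * t)) * E t \<le> E0 + ennreal (1 / 2) * Z" by simp
    also have "ennreal (1 / 2) * Z = Z / 2"
      by (simp add: divide_ennreal_def mult.commute flip: divide_ennreal)
    finally show "ennreal (exp (- ?r * t)) * E t \<le> E0 + Z / 2" .
  qed
  moreover have "Z \<le> ennreal B" unfolding Z_def
  proof (rule SUP_least)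
    fix t assume t: "t \<in> {0..T}"
    have "ennreal (exp (- ?r * t)) * E t \<le> 1 * ennreal B"
      using K t bd[OF t] by (intro mult_mono) (auto simp: ennreal_le_1)
    thus "ennreal (exp (- ?r * t)) * E t \<le> ennreal B" by simp
  qed
  hence "Z < \<infinity>" by (rule le_less_trans) simp
  ultimately have Z: "Z \<le> 2 * E0" by (rule ennreal_le_half_imp)
  have "E t \<le> ennreal (exp (?r * t)) * Z" by (rule le[OF t])
  also have "\<dots> \<le> ennreal (exp (?r * T)) * (2 * E0)"
    using K t Z by (intro mult_mono ennreal_leI) auto
  finally show ?thesis .
qed

lemma gronwall_real:
  fixes y :: "real \<Rightarrow> real"
  assumes y: "continuous_on {0..T} y" and k: "k \<ge> 0"
    and le: "\<And>t. t \<in> {0..T} \<Longrightarrow> y t \<le> c + k * integral {0..t} y" and t: "t \<in> {0..T}"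
  shows "y t \<le> c * exp (k * t)"
proof -
  let ?z = "\<lambda>t. (c + k * integral {0..t} y) * exp (- k * t)"
  have "- ?z 0 \<le> - ?z t"
  proof (rule nondecreasing_within[where f = "\<lambda>t. - ?z t" and a = 0 and b = T and s = 0 and t = t])
    show "((\<lambda>t. - ?z t) has_real_derivative k * exp (- k * t) * (c + k * integral {0..t} y - y t)) (at t within {0..T})"
      if "t \<in> {0..T}" for t
      by (rule derivative_eq_intros integral_has_real_derivative[OF y that] refl | simp add: algebra_simps)+
    show "0 \<le> k * exp (- k * t) * (c + k * integral {0..t} y - y t)" if "t \<in> {0..T}" for t
      using le[OF that] k by simp
  qed (use t in auto)
  hence "(c + k * integral {0..t} y) * exp (- k * t) \<le> c" by simp
  hence "c + k * integral {0..t} y \<le> c * exp (k * t)" by (simp add: exp_minus field_simps)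
  thus ?thesis using le[OF t] by simp
qed

lemma nn_integral_Icc_eq_integral:
  fixes h :: "real \<Rightarrow> real"
  assumes "continuous_on {0..t} h" "\<And>x. x \<in> {0..t} \<Longrightarrow> h x \<ge> 0"
  shows "ennreal (integral {0..t} h) = (\<integral>\<^sup>+\<tau>. indicator {0..t} \<tau> * ennreal (h \<tau>) \<partial>lborel)"
proof -
  have "(\<integral>\<^sup>+\<tau>. ennreal (indicator {0..t} \<tau> * h \<tau>) \<partial>lborel) = ennreal (integral {0..t} h)"
    by (rule nn_integral_has_integral_lebesgue)
      (use assms integrable_continuous_interval[OF assms(1)] in \<open>auto simp: integrable_integral\<close>)
  thus ?thesis by (simp add: indicator_mult_ennreal)
qed

section \<open>Lebesgue norms of continuous functions and Young's inequality in L^p\<close>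

lemma AE_le_imp_le_continuous:
  fixes h :: "real \<Rightarrow> real"
  assumes h: "continuous_on UNIV h" and ae: "AE x in lborel. h x \<le> D"
  shows "h x \<le> D"
proof (rule ccontr)
  assume "\<not> h x \<le> D"
  hence x: "x \<in> {x. D < h x}" by simp
  have "open {x. D < h x}" using h by (intro open_Collect_less) auto
  then obtain e where e: "e > 0" "ball x e \<subseteq> {x. D < h x}" using x by (meson openE)
  have "AE y in lborel. y \<notin> {x - e<..<x + e}"
    using ae by eventually_elim (use e(2) in \<open>auto simp: ball_eq_greaterThanLessThan\<close>)
  hence "emeasure lborel {x - e<..<x + e} = 0"
    by (subst (asm) AE_iff_measurable[where N = "{x - e<..<x + e}"]) auto
  thus False using e(1) by simp
qed

lemma in_Lp_finite:
  assumes "in_Lp p h" "p \<noteq> \<infinity>"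
  shows "(\<integral>\<^sup>+x. ennreal (norm (h x) powr enn2real p) \<partial>lborel) < \<infinity>"
  using assms by (auto simp: in_Lp_def Lp_norm_def Let_def less_top split: if_splits)

lemma in_Lp_infinity:
  fixes h :: "real \<Rightarrow> real"
  assumes "in_Lp \<infinity> h" "continuous_on UNIV h"
  shows "\<exists>D\<ge>0. \<forall>x. \<bar>h x\<bar> \<le> D"
proof -
  have "esssup lborel (\<lambda>x. ennreal \<bar>h x\<bar>) < \<infinity>" using assms(1) by (simp add: in_Lp_def Lp_norm_def)
  then obtain D where D: "esssup lborel (\<lambda>x. ennreal \<bar>h x\<bar>) = ennreal D" "D \<ge> 0"
    by (cases "esssup lborel (\<lambda>x. ennreal \<bar>h x\<bar>)") auto
  have "AE x in lborel. ennreal \<bar>h x\<bar> \<le> ennreal D"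
    using esssup_AE[of "\<lambda>x. ennreal \<bar>h x\<bar>" lborel] D by simp
  hence "AE x in lborel. \<bar>h x\<bar> \<le> D" using D(2) by (simp add: ennreal_le_iff)
  hence "\<bar>h x\<bar> \<le> D" for x
    using assms(2) by (intro AE_le_imp_le_continuous[of "\<lambda>x. \<bar>h x\<bar>"]) (auto intro: continuous_intros)
  thus ?thesis using D(2) by blast
qed

lemma Lp_norm_infinity_le:
  assumes "h \<in> borel_measurable borel" "\<And>x. norm (h x) \<le> D"
  shows "Lp_norm \<infinity> h \<le> ennreal D"
  unfolding Lp_norm_def using assms by (auto intro!: esssup_I AE_I2 ennreal_leI)

text \<open>Either \<open>y \<le> l\<close>, or \<open>(y / l) powr (p - 1) \<ge> 1\<close>. With
  \<open>l\<close> free to be optimised afterwards, this takes the place of Hoelder's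
  inequality.\<close>

lemma powr_le_split:
  fixes y l p :: real
  assumes "y \<ge> 0" "l > 0" "p \<ge> 1"
  shows "y \<le> l + l powr (1 - p) * y powr p"
proof (cases "y \<le> l")
  case False
  have "1 \<le> (y / l) powr (p - 1)" using False assms by (intro ge_one_powr_ge_zero) auto
  hence "y * 1 \<le> y * (y / l) powr (p - 1)" using assms by (intro mult_left_mono) auto
  also have "\<dots> = l powr (1 - p) * y powr p"
    using False assms by (simp add: powr_divide powr_diff field_simps)
  finally show ?thesis using assms by simp
qed (use assms in \<open>simp add: add_increasing2\<close>)

text \<open>Write the integrand as \<open>sqrt y * exp (- \<bar>x\<bar> / 2)\<close> with
  \<open>y = exp (- \<bar>x\<bar>) * v x\<close>. For \<open>p = \<infinity>\<close> the first
  factor is bounded; otherwise it is at most 1 where \<open>y \<le> 1\<close>, and elsewhere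
  \<open>sqrt y \<le> y powr p\<close>.\<close>

lemma nn_integral_sqrt_weight:
  fixes v :: "real \<Rightarrow> real"
  assumes v: "weight_function v" and p: "2 \<le> p" and Lp: "in_Lp p (\<lambda>x. exp (- \<bar>x\<bar>) * v x)"
  shows "(\<integral>\<^sup>+x. ennreal (sqrt (v x) * exp (- \<bar>x\<bar>)) \<partial>lborel) < \<infinity>"
proof -
  have vpos: "v x > 0" for x using v by (simp add: weight_function_def)
  have vc: "continuous_on UNIV v" using v by (simp add: weight_function_def)
  hence [measurable]: "v \<in> borel_measurable borel" by (rule borel_measurable_continuous_onI)
  have eq: "sqrt (v x) * exp (- \<bar>x\<bar>) = sqrt (exp (- \<bar>x\<bar>) * v x) * exp (- \<bar>x\<bar> / 2)" for x
  proof -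
    have "sqrt (exp (- \<bar>x\<bar>)) = exp (- \<bar>x\<bar> / 2)"
      by (rule real_sqrt_unique) (simp_all flip: exp_double)
    thus ?thesis by (simp add: real_sqrt_mult mult_exp_exp)
  qed
  show ?thesis
  proof (cases "p = \<infinity>")
    case True
    have "continuous_on UNIV (\<lambda>x. exp (- \<bar>x\<bar>) * v x)" using vc by (intro continuous_intros)
    from in_Lp_infinity[OF Lp[unfolded True] this] obtain D where D: "D \<ge> 0" "\<And>x. \<bar>exp (- \<bar>x\<bar>) * v x\<bar> \<le> D" by blast
    have "(\<integral>\<^sup>+x. ennreal (sqrt (v x) * exp (- \<bar>x\<bar>)) \<partial>lborel) \<le> (\<integral>\<^sup>+x. ennreal (sqrt D) * ennreal (exp (- \<bar>x\<bar> / 2)) \<partial>lborel)"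
      unfolding eq using D vpos
      by (intro nn_integral_mono) (auto simp flip: ennreal_mult intro!: ennreal_leI mult_right_mono simp: abs_mult less_imp_le)
    also have "\<dots> < \<infinity>" using nn_integral_exp_half by (simp add: nn_integral_cmult ennreal_mult_less_top)
    finally show ?thesis .
  next
    case False
    let ?P = "enn2real p"
    have P: "?P \<ge> 2" using p False by (cases p) (auto simp flip: ennreal_numeral)
    have "(\<integral>\<^sup>+x. ennreal (sqrt (v x) * exp (- \<bar>x\<bar>)) \<partial>lborel) \<le>
      (\<integral>\<^sup>+x. ennreal (exp (- \<bar>x\<bar> / 2)) + ennreal (norm (exp (- \<bar>x\<bar>) * v x) powr ?P) \<partial>lborel)"
    proof (rule nn_integral_mono)
      fix x :: real
      let ?y = "exp (- \<bar>x\<bar>) * v x"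
      have y: "?y > 0" using vpos by simp
      have "sqrt ?y * exp (- \<bar>x\<bar> / 2) \<le> exp (- \<bar>x\<bar> / 2) + ?y powr ?P"
      proof (cases "?y \<le> 1")
        case True
        hence "sqrt ?y * exp (- \<bar>x\<bar> / 2) \<le> 1 * exp (- \<bar>x\<bar> / 2)" by (intro mult_right_mono) auto
        thus ?thesis by (simp add: add_increasing2)
      next
        case False
        have "sqrt ?y * exp (- \<bar>x\<bar> / 2) \<le> ?y powr (1 / 2) * 1"
          using y by (intro mult_mono) (auto simp: powr_half_sqrt)
        also have "\<dots> \<le> ?y powr ?P" using False P by (simp add: powr_mono)
        finally show ?thesis by (simp add: add_increasing)
      qed
      thus "ennreal (sqrt (v x) * exp (- \<bar>x\<bar>)) \<le> ennreal (exp (- \<bar>x\<bar> / 2)) + ennreal (norm (exp (- \<bar>x\<bar>) * v x) powr ?P)"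
        unfolding eq using y by (simp flip: ennreal_plus add: ennreal_leI)
    qed
    also have "\<dots> = (\<integral>\<^sup>+x. ennreal (exp (- \<bar>x\<bar> / 2)) \<partial>lborel) + (\<integral>\<^sup>+x. ennreal (norm (exp (- \<bar>x\<bar>) * v x) powr ?P) \<partial>lborel)"
      by (rule nn_integral_add) measurable
    also have "\<dots> < \<infinity>" using nn_integral_exp_half in_Lp_finite[OF Lp False] by simp
    finally show ?thesis .
  qed
qed

text \<open>Young's inequality for an L^p kernel acting on an L^1 density. Splitting the kernel
  pointwise by \<open>powr_le_split\<close> gives
  \<open>Y a powr p \<le> (H + 1) powr p * W a\<close>, and Fubini integrates
  \<open>W\<close>.\<close>

lemma Lp_convolution_bound:
  fixes Y \<kappa> :: "real \<Rightarrow> real" and h :: "real \<Rightarrow> ennreal" and p :: real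
  assumes Y: "\<And>a. Y a \<ge> 0" "\<And>a. ennreal (Y a) \<le> (\<integral>\<^sup>+c. ennreal (\<kappa> (a - c)) * h c \<partial>lborel)"
    and [measurable]: "\<kappa> \<in> borel_measurable borel" "h \<in> borel_measurable borel" and \<kappa>0: "\<And>x. \<kappa> x \<ge> 0"
    and \<kappa>: "(\<integral>\<^sup>+x. ennreal (\<kappa> x powr p) \<partial>lborel) < \<infinity>" and h: "(\<integral>\<^sup>+c. h c \<partial>lborel) < \<infinity>" and p: "p \<ge> 1"
  shows "(\<integral>\<^sup>+a. ennreal (Y a powr p) \<partial>lborel) < \<infinity>"
proof -
  obtain H where H: "(\<integral>\<^sup>+c. h c \<partial>lborel) = ennreal H" "H \<ge> 0" using h by (cases "\<integral>\<^sup>+c. h c \<partial>lborel") auto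
  \<comment> \<open>The exponential summand only serves to keep \<open>W a\<close> positive.\<close>
  define W where "W a = (\<integral>\<^sup>+c. ennreal (\<kappa> (a - c) powr p) * h c \<partial>lborel) + ennreal (exp (- \<bar>a\<bar>))" for a
  have "ennreal (Y a powr p) \<le> ennreal ((H + 1) powr p) * W a" for a
  proof (cases "W a")
    case (real w)
    have w: "w > 0"
    proof -
      have "ennreal (exp (- \<bar>a\<bar>)) \<le> ennreal w" unfolding real(2)[symmetric] W_def by simp
      hence "exp (- \<bar>a\<bar>) \<le> w" using real(1) by (simp add: ennreal_le_iff)
      thus ?thesis using exp_gt_zero less_le_trans by blast
    qed
    \<comment> \<open>This choice balances the two parts of the splitting:
      \<open>l powr (1 - p) * w\<close> equals \<open>l\<close>, so both are multiples of
      \<open>l\<close>.\<close>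
    define l where "l = w powr (1 / p)"
    have l: "l > 0" using w by (simp add: l_def)
    have "ennreal (Y a) \<le> (\<integral>\<^sup>+c. ennreal (\<kappa> (a - c)) * h c \<partial>lborel)" by (rule Y)
    also have "\<dots> \<le> (\<integral>\<^sup>+c. ennreal l * h c + ennreal (l powr (1 - p)) * (ennreal (\<kappa> (a - c) powr p) * h c) \<partial>lborel)"
    proof (rule nn_integral_mono)
      fix c
      have "ennreal (\<kappa> (a - c)) \<le> ennreal l + ennreal (l powr (1 - p)) * ennreal (\<kappa> (a - c) powr p)"
        using powr_le_split[OF \<kappa>0 l p] l by (simp flip: ennreal_mult ennreal_plus add: ennreal_leI)
      from mult_right_mono[OF this, of "h c"]
      show "ennreal (\<kappa> (a - c)) * h c \<le> ennreal l * h c + ennreal (l powr (1 - p)) * (ennreal (\<kappa> (a - c) powr p) * h c)"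
        by (simp add: distrib_right mult.assoc)
    qed
    also have "\<dots> = ennreal l * ennreal H + ennreal (l powr (1 - p)) * (\<integral>\<^sup>+c. ennreal (\<kappa> (a - c) powr p) * h c \<partial>lborel)"
      by (simp add: nn_integral_add nn_integral_cmult H(1))
    also have "\<dots> \<le> ennreal l * ennreal H + ennreal (l powr (1 - p)) * W a"
      by (intro add_left_mono mult_left_mono) (auto simp: W_def)
    also have "\<dots> = ennreal (l * H + l powr (1 - p) * w)"
      using l H(2) w real(2) by (simp flip: ennreal_mult ennreal_plus)
    also have "l powr (1 - p) * w = l"
    proof -
      have "l powr p = w" using w p by (simp add: l_def powr_powr)
      hence "l powr (1 - p) * w = l powr (1 - p) * l powr p" by simp
      also have "\<dots> = l" using l by (simp flip: powr_add)
      finally show ?thesis .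
    qed
    finally have "Y a \<le> l * (H + 1)"
      using l H(2) by (subst (asm) ennreal_le_iff) (auto simp: algebra_simps)
    hence "Y a powr p \<le> (l * (H + 1)) powr p" using Y(1) p by (intro powr_mono2) auto
    also have "\<dots> = (H + 1) powr p * w"
      using l H(2) w p by (simp add: powr_mult l_def powr_powr)
    finally show ?thesis using real w by (simp add: ennreal_leI flip: ennreal_mult)
  next
    case top
    have "(H + 1) powr p > 0" using H(2) by simp
    thus ?thesis using top by (simp add: ennreal_mult_top)
  qed
  hence "(\<integral>\<^sup>+a. ennreal (Y a powr p) \<partial>lborel) \<le> (\<integral>\<^sup>+a. ennreal ((H + 1) powr p) * W a \<partial>lborel)"
    by (rule nn_integral_mono)
  also have "\<dots> = ennreal ((H + 1) powr p) * (\<integral>\<^sup>+a. W a \<partial>lborel)"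
    unfolding W_def by (rule nn_integral_cmult) measurable
  also have "(\<integral>\<^sup>+a. W a \<partial>lborel) = (\<integral>\<^sup>+x. ennreal (\<kappa> x powr p) \<partial>lborel) * (\<integral>\<^sup>+c. h c \<partial>lborel) + (\<integral>\<^sup>+a. ennreal (exp (- \<bar>a\<bar>)) \<partial>lborel)"
    unfolding W_def using nn_integral_convolution[of "\<lambda>x. ennreal (\<kappa> x powr p)" h] by (simp add: nn_integral_add)
  also have "ennreal ((H + 1) powr p) * \<dots> < \<infinity>"
    using \<kappa> h integrable_exp_abs by (auto simp: ennreal_mult_less_top integrable_iff_bounded)
  finally show ?thesis .
qed

section \<open>Weighted square integrals\<close>

lemma borel_measurable_uncurry:
  fixes S :: "real \<Rightarrow> real \<Rightarrow> real"
  assumes "continuous_on UNIV (\<lambda>(t, a). S t a)" "F \<in> borel_measurable N" "G \<in> borel_measurable N"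
  shows "(\<lambda>x. S (F x) (G x)) \<in> borel_measurable N"
proof -
  have "(\<lambda>p. S (fst p) (snd p)) \<in> borel_measurable (borel \<Otimes>\<^sub>M borel)"
    using borel_measurable_continuous_onI[OF assms(1)] by (simp add: borel_prod case_prod_unfold)
  from measurable_compose[OF measurable_Pair[OF assms(2,3)] this] show ?thesis by simp
qed

lemma ennreal_pow2_sqrt_mult:
  assumes "y \<ge> 0"
  shows "ennreal y * I\<^sup>2 = (ennreal (sqrt y) * I)\<^sup>2"
  using assms by (simp add: power_mult_distrib ennreal_power)

text \<open>Taking roots in the moderateness condition moves \<open>sqrt (\<psi> a)\<close> inside
  the integral as \<open>sqrt (m (a - c)) * sqrt (\<psi> c)\<close>. What remains is an unweighted
  convolution with kernel \<open>sqrt (m x) * exp (- \<bar>x\<bar>)\<close>.\<close>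

lemma weighted_convolution_L2:
  fixes \<psi> m h :: "real \<Rightarrow> real"
  assumes [measurable]: "\<psi> \<in> borel_measurable borel" "m \<in> borel_measurable borel" "h \<in> borel_measurable borel"
    and \<psi>: "\<And>x. \<psi> x \<ge> 0" and m: "\<And>x. m x \<ge> 0" and h: "\<And>x. h x \<ge> 0"
    and moderate: "\<And>x y. \<psi> (x + y) \<le> m x * \<psi> y"
  shows "(\<integral>\<^sup>+a. ennreal (\<psi> a) * (\<integral>\<^sup>+c. ennreal (exp (- \<bar>a - c\<bar>) * h c) \<partial>lborel)\<^sup>2 \<partial>lborel)
    \<le> (\<integral>\<^sup>+x. ennreal (sqrt (m x) * exp (- \<bar>x\<bar>)) \<partial>lborel)\<^sup>2 * (\<integral>\<^sup>+c. ennreal (\<psi> c * (h c)\<^sup>2) \<partial>lborel)"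
proof -
  let ?\<kappa> = "\<lambda>x. sqrt (m x) * exp (- \<bar>x\<bar>)"
  let ?g = "\<lambda>c. sqrt (\<psi> c) * h c"
  have "ennreal (\<psi> a) * (\<integral>\<^sup>+c. ennreal (exp (- \<bar>a - c\<bar>) * h c) \<partial>lborel)\<^sup>2 \<le> (\<integral>\<^sup>+c. ennreal (?\<kappa> (a - c) * ?g c) \<partial>lborel)\<^sup>2" for a
  proof -
    have "ennreal (sqrt (\<psi> a)) * (\<integral>\<^sup>+c. ennreal (exp (- \<bar>a - c\<bar>) * h c) \<partial>lborel) =
        (\<integral>\<^sup>+c. ennreal (sqrt (\<psi> a)) * ennreal (exp (- \<bar>a - c\<bar>) * h c) \<partial>lborel)"
      by (rule nn_integral_cmult[symmetric]) measurable
    also have "\<dots> \<le> (\<integral>\<^sup>+c. ennreal (?\<kappa> (a - c) * ?g c) \<partial>lborel)"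
    proof (rule nn_integral_mono)
      fix c
      have "sqrt (\<psi> a) \<le> sqrt (m (a - c)) * sqrt (\<psi> c)"
        using moderate[of "a - c" c] by (simp flip: real_sqrt_mult)
      hence "sqrt (\<psi> a) * (exp (- \<bar>a - c\<bar>) * h c) \<le> (sqrt (m (a - c)) * sqrt (\<psi> c)) * (exp (- \<bar>a - c\<bar>) * h c)"
        using h by (intro mult_right_mono) auto
      thus "ennreal (sqrt (\<psi> a)) * ennreal (exp (- \<bar>a - c\<bar>) * h c) \<le> ennreal (?\<kappa> (a - c) * ?g c)"
        using \<psi> h by (simp flip: ennreal_mult add: mult_ac ennreal_leI)
    qed
    finally show ?thesis unfolding ennreal_pow2_sqrt_mult[OF \<psi>] by (rule power_mono_ennreal)
  qed
  hence "(\<integral>\<^sup>+a. ennreal (\<psi> a) * (\<integral>\<^sup>+c. ennreal (exp (- \<bar>a - c\<bar>) * h c) \<partial>lborel)\<^sup>2 \<partial>lborel) \<le>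
      (\<integral>\<^sup>+a. (\<integral>\<^sup>+c. ennreal (?\<kappa> (a - c) * ?g c) \<partial>lborel)\<^sup>2 \<partial>lborel)"
    by (rule nn_integral_mono)
  also have "\<dots> \<le> (\<integral>\<^sup>+x. ennreal (?\<kappa> x) \<partial>lborel)\<^sup>2 * (\<integral>\<^sup>+c. ennreal ((?g c)\<^sup>2) \<partial>lborel)"
    by (rule young_L2) (use \<psi> m h in auto)
  finally show ?thesis using \<psi> by (simp add: power_mult_distrib)
qed

text \<open>
  The cut-off weight is integrable, so weighted norms of bounded functions are finite a priori,
  and it is moderate with a majorant independent of \<open>n\<close>.
\<close>

lemma min_exp_moderate:
  fixes \<phi> v :: "real \<Rightarrow> real"
  assumes \<phi>: "\<And>x y. \<phi> (x + y) \<le> c0 * v x * \<phi> y" "\<And>x. \<phi> x > 0" and n: "n \<ge> 0"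
    and cv: "\<And>x. c0 * v x \<ge> 0"
  shows "min (\<phi> (x + y)) (n * exp (- \<bar>x + y\<bar>)) \<le> (c0 * v x + exp \<bar>x\<bar>) * min (\<phi> y) (n * exp (- \<bar>y\<bar>))"
proof -
  have "\<phi> (x + y) \<le> (c0 * v x + exp \<bar>x\<bar>) * \<phi> y"
    using \<phi>(1)[of x y] \<phi>(2)[of y] by (simp add: distrib_right add_increasing2)
  moreover have "n * exp (- \<bar>x + y\<bar>) \<le> (c0 * v x + exp \<bar>x\<bar>) * (n * exp (- \<bar>y\<bar>))"
  proof -
    have "exp (- \<bar>x + y\<bar>) \<le> exp \<bar>x\<bar> * exp (- \<bar>y\<bar>)" by (simp flip: exp_add)
    also have "\<dots> \<le> (c0 * v x + exp \<bar>x\<bar>) * exp (- \<bar>y\<bar>)" using cv by (intro mult_right_mono) auto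
    finally have "exp (- \<bar>x + y\<bar>) \<le> (c0 * v x + exp \<bar>x\<bar>) * exp (- \<bar>y\<bar>)" .
    from mult_left_mono[OF this n] show ?thesis by (simp add: mult_ac)
  qed
  ultimately show ?thesis by (simp add: min_def)
qed

text \<open>The majorant of the cut-off weight still has an integrable kernel: the root turns the
  added \<open>exp \<bar>x\<bar>\<close> into \<open>exp (\<bar>x\<bar> / 2)\<close>, which leaves
  \<open>exp (- \<bar>x\<bar> / 2)\<close>.\<close>

lemma nn_integral_sqrt_sum_weight:
  fixes v :: "real \<Rightarrow> real"
  assumes [measurable]: "v \<in> borel_measurable borel" and v: "\<And>x. v x > 0" and c0: "c0 > 0"
    and fin: "(\<integral>\<^sup>+x. ennreal (sqrt (v x) * exp (- \<bar>x\<bar>)) \<partial>lborel) < \<infinity>"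
  shows "(\<integral>\<^sup>+x. ennreal (sqrt (c0 * v x + exp \<bar>x\<bar>) * exp (- \<bar>x\<bar>)) \<partial>lborel) < \<infinity>"
proof -
  have "(\<integral>\<^sup>+x. ennreal (sqrt (c0 * v x + exp \<bar>x\<bar>) * exp (- \<bar>x\<bar>)) \<partial>lborel) \<le>
    (\<integral>\<^sup>+x. ennreal (sqrt c0) * ennreal (sqrt (v x) * exp (- \<bar>x\<bar>)) + ennreal (exp (- \<bar>x\<bar> / 2)) \<partial>lborel)"
  proof (rule nn_integral_mono)
    fix x :: real
    have e: "sqrt (exp \<bar>x\<bar>) = exp (\<bar>x\<bar> / 2)"
      by (rule real_sqrt_unique) (simp_all flip: exp_double)
    have "sqrt (c0 * v x + exp \<bar>x\<bar>) \<le> sqrt (c0 * v x) + sqrt (exp \<bar>x\<bar>)"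
      using v[of x] c0 by (intro sqrt_add_le_add_sqrt) auto
    hence "sqrt (c0 * v x + exp \<bar>x\<bar>) * exp (- \<bar>x\<bar>) \<le> (sqrt c0 * sqrt (v x) + exp (\<bar>x\<bar> / 2)) * exp (- \<bar>x\<bar>)"
      by (intro mult_right_mono) (auto simp: real_sqrt_mult e)
    also have "\<dots> = sqrt c0 * (sqrt (v x) * exp (- \<bar>x\<bar>)) + exp (- \<bar>x\<bar> / 2)"
      by (simp add: distrib_right mult_exp_exp)
    finally show "ennreal (sqrt (c0 * v x + exp \<bar>x\<bar>) * exp (- \<bar>x\<bar>)) \<le>
        ennreal (sqrt c0) * ennreal (sqrt (v x) * exp (- \<bar>x\<bar>)) + ennreal (exp (- \<bar>x\<bar> / 2))"
      using c0 v[of x] by (simp flip: ennreal_mult ennreal_plus add: ennreal_leI)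
  qed
  also have "\<dots> = ennreal (sqrt c0) * (\<integral>\<^sup>+x. ennreal (sqrt (v x) * exp (- \<bar>x\<bar>)) \<partial>lborel) + (\<integral>\<^sup>+x. ennreal (exp (- \<bar>x\<bar> / 2)) \<partial>lborel)"
    by (simp add: nn_integral_add nn_integral_cmult)
  also have "\<dots> < \<infinity>" using fin nn_integral_exp_half by (simp add: ennreal_mult_less_top)
  finally show ?thesis .
qed

lemma conv_exp_eq_nn_integral:
  fixes h :: "real \<Rightarrow> real"
  assumes [measurable]: "h \<in> borel_measurable borel" and h: "\<And>x. 0 \<le> h x" "\<And>x. h x \<le> B"
  shows "ennreal (conv (\<lambda>x. exp (- \<bar>x\<bar>)) h a) = (\<integral>\<^sup>+c. ennreal (exp (- \<bar>a - c\<bar>) * h c) \<partial>lborel)"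
    and "conv (\<lambda>x. exp (- \<bar>x\<bar>)) h a \<ge> 0"
proof -
  have "integrable lborel (\<lambda>c. exp (- \<bar>a - c\<bar>))"
    using lborel_integrable_real_affine[OF integrable_exp_abs, of "-1" a] by simp
  hence "integrable lborel (\<lambda>c. exp (- \<bar>a - c\<bar>) * h c)"
    by (rule integrable_mult_bounded[where C = B]) (use h in auto)
  thus "ennreal (conv (\<lambda>x. exp (- \<bar>x\<bar>)) h a) = (\<integral>\<^sup>+c. ennreal (exp (- \<bar>a - c\<bar>) * h c) \<partial>lborel)"
    unfolding conv_def using h by (intro nn_integral_eq_integral[symmetric]) auto
  show "conv (\<lambda>x. exp (- \<bar>x\<bar>)) h a \<ge> 0"
    unfolding conv_def using h by (intro Bochner_Integration.integral_nonneg) auto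
qed

text \<open>For each cut-off weight, integrating the pointwise inequality and bounding the
  convolution by \<open>weighted_convolution_L2\<close> gives a closed Gronwall inequality. Its
  constant does not depend on \<open>n\<close>, so monotone convergence recovers the weight
  \<open>\<phi>\<close>.\<close>

lemma weighted_L2_estimate:
  fixes S :: "real \<Rightarrow> real \<Rightarrow> real" and \<phi> v :: "real \<Rightarrow> real"
  assumes v: "weight_function v" and \<phi>: "weight_function \<phi>"
    and moderate: "\<And>x y. \<phi> (x + y) \<le> c0 * v x * \<phi> y" "c0 > 0"
    and sv: "(\<integral>\<^sup>+x. ennreal (sqrt (v x) * exp (- \<bar>x\<bar>)) \<partial>lborel) < \<infinity>"
    and contS: "continuous_on UNIV (\<lambda>(t, a). S t a)" and S: "\<And>t a. 0 \<le> S t a" "\<And>t a. S t a \<le> B"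
    and K: "K0 \<ge> 0" "K > 0"
    and ineq: "\<And>t a. t \<in> {0..T} \<Longrightarrow> (S t a)\<^sup>2 \<le> K0 * (S 0 a)\<^sup>2 +
      K * integral {0..t} (\<lambda>\<tau>. (S \<tau> a)\<^sup>2 + (conv (\<lambda>x. exp (- \<bar>x\<bar>)) (S \<tau>) a)\<^sup>2)"
  shows "\<exists>C::real. \<forall>t\<in>{0..T}. (\<integral>\<^sup>+a. ennreal (\<phi> a * (S t a)\<^sup>2) \<partial>lborel) \<le> ennreal C * (\<integral>\<^sup>+a. ennreal (\<phi> a * (S 0 a)\<^sup>2) \<partial>lborel)"
proof -
  have vpos: "v x > 0" and \<phi>pos: "\<phi> x > 0" for x using v \<phi> by (auto simp: weight_function_def)
  have [measurable]: "v \<in> borel_measurable borel" "\<phi> \<in> borel_measurable borel"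
    using v \<phi> by (auto simp: weight_function_def intro: borel_measurable_continuous_onI)
  note [measurable (raw)] = borel_measurable_uncurry[OF contS]
  let ?e = "\<lambda>x::real. exp (- \<bar>x\<bar>)"
  define m where "m x = c0 * v x + exp \<bar>x\<bar>" for x
  have [measurable]: "m \<in> borel_measurable borel" unfolding m_def[abs_def] by measurable
  have m0: "m x \<ge> 0" for x using vpos[of x] moderate(2) by (simp add: m_def less_imp_le)
  define \<Lambda> where "\<Lambda> = (\<integral>\<^sup>+x. ennreal (sqrt (m x) * ?e x) \<partial>lborel)"
  have "\<Lambda> < \<infinity>" unfolding \<Lambda>_def m_def
    by (rule nn_integral_sqrt_sum_weight[OF _ vpos moderate(2) sv]) measurable
  then obtain l where l: "\<Lambda>\<^sup>2 = ennreal l" "l \<ge> 0" by (cases "\<Lambda>\<^sup>2") (auto simp: power_eq_top_ennreal)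
  \<comment> \<open>The 1 stems from the term in \<open>S^2\<close>, and \<open>l\<close> from the
    convolution term, being the square of the L^1 norm of its kernel.\<close>
  define K' where "K' = K * (1 + l)"
  have K': "K' > 0" using K l(2) by (simp add: K'_def)
  define C where "C = exp (2 * K' * T) * (2 * K0)"
  have cS: "continuous_on UNIV (S t)" for t
    using continuous_on_slice[of UNIV UNIV S UNIV "\<lambda>_. t" "\<lambda>x. x"] contS by (simp add: continuous_on_id)
  have cI: "continuous_on UNIV (\<lambda>(t, a). conv ?e (S t) a)"
    using continuous_on_conv[of ?e UNIV S B] integrable_exp_abs contS S by simp
  note nnI = conv_exp_eq_nn_integral[of "S t" B for t, OF borel_measurable_continuous_onI[OF cS] S(1) S(2)]
  define I where "I t a = (\<integral>\<^sup>+c. ennreal (exp (- \<bar>a - c\<bar>) * S t c) \<partial>lborel)" for t a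
  have ineq': "ennreal ((S t a)\<^sup>2) \<le> ennreal K0 * ennreal ((S 0 a)\<^sup>2) +
      ennreal K * (\<integral>\<^sup>+\<tau>. indicator {0..t} \<tau> * (ennreal ((S \<tau> a)\<^sup>2) + (I \<tau> a)\<^sup>2) \<partial>lborel)" if t: "t \<in> {0..T}" for t a
  proof -
    let ?h = "\<lambda>\<tau>. (S \<tau> a)\<^sup>2 + (conv ?e (S \<tau>) a)\<^sup>2"
    have ch: "continuous_on {0..t} ?h"
      using continuous_on_slice[of UNIV UNIV S "{0..t}" "\<lambda>\<tau>. \<tau>" "\<lambda>_. a"] contS
        continuous_on_slice[of UNIV UNIV "\<lambda>t a. conv ?e (S t) a" "{0..t}" "\<lambda>\<tau>. \<tau>" "\<lambda>_. a"] cI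
      by (intro continuous_intros) (auto simp: continuous_on_id)
    have int0: "integral {0..t} ?h \<ge> 0" by (rule integral_nonneg[OF integrable_continuous_interval[OF ch]]) simp
    have "ennreal ((S t a)\<^sup>2) \<le> ennreal (K0 * (S 0 a)\<^sup>2 + K * integral {0..t} ?h)"
      by (rule ennreal_leI[OF ineq[OF t]])
    also have "\<dots> = ennreal K0 * ennreal ((S 0 a)\<^sup>2) + ennreal K * ennreal (integral {0..t} ?h)"
      using K int0 by (simp add: ennreal_mult)
    also have "ennreal (integral {0..t} ?h) = (\<integral>\<^sup>+\<tau>. indicator {0..t} \<tau> * ennreal (?h \<tau>) \<partial>lborel)"
      by (rule nn_integral_Icc_eq_integral[OF ch]) simp
    also have "\<dots> = (\<integral>\<^sup>+\<tau>. indicator {0..t} \<tau> * (ennreal ((S \<tau> a)\<^sup>2) + (I \<tau> a)\<^sup>2) \<partial>lborel)"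
      unfolding I_def nnI(1)[symmetric] by (simp add: ennreal_power nnI(2))
    finally show ?thesis .
  qed
  have main: "(\<integral>\<^sup>+a. ennreal (min (\<phi> a) (real n * ?e a) * (S t a)\<^sup>2) \<partial>lborel) \<le> ennreal C * (\<integral>\<^sup>+a. ennreal (\<phi> a * (S 0 a)\<^sup>2) \<partial>lborel)"
    if t: "t \<in> {0..T}" for n t
  proof -
    define \<psi> where "\<psi> a = min (\<phi> a) (real n * ?e a)" for a
    have [measurable]: "\<psi> \<in> borel_measurable borel" unfolding \<psi>_def[abs_def] by measurable
    have \<psi>0: "\<psi> a \<ge> 0" for a using \<phi>pos[of a] by (simp add: \<psi>_def)
    define E where "E t = (\<integral>\<^sup>+a. ennreal (\<psi> a * (S t a)\<^sup>2) \<partial>lborel)" for t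
    \<comment> \<open>The bound diverges as \<open>n\<close> grows; only its finiteness is used, to
      make Gronwall applicable.\<close>
    have E_bd: "E t \<le> ennreal (real n * B\<^sup>2 * 2)" for t
    proof -
      have "E t \<le> (\<integral>\<^sup>+a. ennreal (real n * B\<^sup>2) * ennreal (?e a) \<partial>lborel)"
        unfolding E_def
      proof (rule nn_integral_mono)
        fix a
        have "\<psi> a * (S t a)\<^sup>2 \<le> (real n * ?e a) * B\<^sup>2"
          using S[of t a] by (intro mult_mono power_mono) (auto simp: \<psi>_def)
        thus "ennreal (\<psi> a * (S t a)\<^sup>2) \<le> ennreal (real n * B\<^sup>2) * ennreal (?e a)"
          by (simp flip: ennreal_mult add: ennreal_leI mult_ac)
      qed
      also have "\<dots> = ennreal (real n * B\<^sup>2) * ennreal 2"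
        using integrable_exp_abs integral_exp_abs by (simp add: nn_integral_cmult nn_integral_eq_integral)
      finally show ?thesis by (simp add: ennreal_mult)
    qed
    have E_conv: "(\<integral>\<^sup>+a. ennreal (\<psi> a) * (I \<tau> a)\<^sup>2 \<partial>lborel) \<le> ennreal l * E \<tau>" for \<tau>
      unfolding I_def l(1)[symmetric] \<Lambda>_def E_def
    proof (rule weighted_convolution_L2)
      show "\<psi> (x + y) \<le> m x * \<psi> y" for x y
        unfolding \<psi>_def m_def using vpos moderate by (intro min_exp_moderate \<phi>pos) (auto simp: less_imp_le)
    qed (use S \<psi>0 m0 in auto)
    have E_ineq: "E t \<le> ennreal K0 * E 0 + ennreal K' * (\<integral>\<^sup>+\<tau>. indicator {0..t} \<tau> * E \<tau> \<partial>lborel)"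
      if t: "t \<in> {0..T}" for t
    proof -
      let ?i = "\<lambda>\<tau>. indicator {0..t} \<tau> :: ennreal"
      let ?g = "\<lambda>\<tau> a. ennreal (\<psi> a * (S \<tau> a)\<^sup>2) + ennreal (\<psi> a) * (I \<tau> a)\<^sup>2"
      let ?h = "\<lambda>\<tau> a. ennreal ((S \<tau> a)\<^sup>2) + (I \<tau> a)\<^sup>2"
      have [measurable]: "(\<lambda>x. I (F x) (G x)) \<in> borel_measurable N" if "F \<in> borel_measurable N" "G \<in> borel_measurable N"
        for F G :: "real \<times> real \<Rightarrow> real" and N
        unfolding I_def using that by measurable
      have "E t \<le> (\<integral>\<^sup>+a. ennreal K0 * ennreal (\<psi> a * (S 0 a)\<^sup>2) +
          ennreal K * (\<integral>\<^sup>+\<tau>. ?i \<tau> * ?g \<tau> a \<partial>lborel) \<partial>lborel)"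
        unfolding E_def
      proof (rule nn_integral_mono)
        fix a
        have I2: "(\<lambda>\<tau>. I \<tau> a) \<in> borel_measurable borel" unfolding I_def by measurable
        have "ennreal (\<psi> a * (S t a)\<^sup>2) = ennreal (\<psi> a) * ennreal ((S t a)\<^sup>2)" using \<psi>0 by (simp add: ennreal_mult)
        also have "\<dots> \<le> ennreal (\<psi> a) * (ennreal K0 * ennreal ((S 0 a)\<^sup>2) +
          ennreal K * (\<integral>\<^sup>+\<tau>. ?i \<tau> * ?h \<tau> a \<partial>lborel))"
          by (intro mult_left_mono ineq' t) simp
        also have "\<dots> = ennreal K0 * ennreal (\<psi> a * (S 0 a)\<^sup>2) +
          ennreal K * (ennreal (\<psi> a) * (\<integral>\<^sup>+\<tau>. ?i \<tau> * ?h \<tau> a \<partial>lborel))"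
          using \<psi>0 by (simp add: ennreal_mult distrib_left mult_ac)
        also have "ennreal (\<psi> a) * (\<integral>\<^sup>+\<tau>. ?i \<tau> * ?h \<tau> a \<partial>lborel) =
          (\<integral>\<^sup>+\<tau>. ennreal (\<psi> a) * (?i \<tau> * ?h \<tau> a) \<partial>lborel)"
          using I2 by (intro nn_integral_cmult[symmetric]) measurable
        also have "\<dots> = (\<integral>\<^sup>+\<tau>. ?i \<tau> * ?g \<tau> a \<partial>lborel)"
          using \<psi>0 by (intro nn_integral_cong) (simp add: ennreal_mult distrib_left mult_ac)
        finally show "ennreal (\<psi> a * (S t a)\<^sup>2) \<le> ennreal K0 * ennreal (\<psi> a * (S 0 a)\<^sup>2) +
          ennreal K * (\<integral>\<^sup>+\<tau>. ?i \<tau> * ?g \<tau> a \<partial>lborel)" .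
      qed
      also have "\<dots> = ennreal K0 * E 0 + ennreal K * (\<integral>\<^sup>+a. (\<integral>\<^sup>+\<tau>. ?i \<tau> * ?g \<tau> a \<partial>lborel) \<partial>lborel)"
        unfolding E_def I_def by (subst nn_integral_add; (subst nn_integral_cmult)?; measurable?) (simp add: nn_integral_cmult)
      also have "(\<integral>\<^sup>+a. (\<integral>\<^sup>+\<tau>. ?i \<tau> * ?g \<tau> a \<partial>lborel) \<partial>lborel)
        = (\<integral>\<^sup>+\<tau>. (\<integral>\<^sup>+a. ?i \<tau> * ?g \<tau> a \<partial>lborel) \<partial>lborel)"
        unfolding I_def by (rule lborel_pair.Fubini') measurable
      also have "\<dots> \<le> (\<integral>\<^sup>+\<tau>. ennreal (1 + l) * (?i \<tau> * E \<tau>) \<partial>lborel)"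
      proof (rule nn_integral_mono)
        fix \<tau>
        have I2: "(\<lambda>a. I \<tau> a) \<in> borel_measurable borel" unfolding I_def by measurable
        have "(\<integral>\<^sup>+a. ?i \<tau> * ?g \<tau> a \<partial>lborel) =
          ?i \<tau> * (E \<tau> + (\<integral>\<^sup>+a. ennreal (\<psi> a) * (I \<tau> a)\<^sup>2 \<partial>lborel))"
          unfolding E_def using I2 by (subst nn_integral_cmult; measurable?) (simp add: nn_integral_add)
        also have "\<dots> \<le> ?i \<tau> * (E \<tau> + ennreal l * E \<tau>)"
          by (intro mult_left_mono add_left_mono E_conv) simp
        also have "\<dots> = ennreal (1 + l) * (?i \<tau> * E \<tau>)"
          using l(2) by (simp add: distrib_left distrib_right mult_ac)
        finally show "(\<integral>\<^sup>+a. ?i \<tau> * ?g \<tau> a \<partial>lborel) \<le>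
          ennreal (1 + l) * (?i \<tau> * E \<tau>)" .
      qed
      also have "\<dots> = ennreal (1 + l) * (\<integral>\<^sup>+\<tau>. ?i \<tau> * E \<tau> \<partial>lborel)"
        unfolding E_def by (rule nn_integral_cmult) measurable
      finally show ?thesis
        using K l(2) by (simp add: K'_def ennreal_mult mult.assoc add_left_mono mult_left_mono)
    qed
    have "E t \<le> ennreal (exp (2 * K' * T)) * (2 * (ennreal K0 * E 0))"
      by (rule gronwall_nn_integral[OF E_bd K' E_ineq t])
    also have "\<dots> = ennreal C * E 0"
      using K by (simp add: C_def ennreal_mult mult.assoc)
    also have "\<dots> \<le> ennreal C * (\<integral>\<^sup>+a. ennreal (\<phi> a * (S 0 a)\<^sup>2) \<partial>lborel)"
      unfolding E_def by (intro mult_left_mono nn_integral_mono ennreal_leI mult_right_mono) (auto simp: \<psi>_def)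
    finally show ?thesis by (simp add: E_def \<psi>_def)
  qed
  have "(\<integral>\<^sup>+a. ennreal (\<phi> a * (S t a)\<^sup>2) \<partial>lborel) \<le> ennreal C * (\<integral>\<^sup>+a. ennreal (\<phi> a * (S 0 a)\<^sup>2) \<partial>lborel)"
    if t: "t \<in> {0..T}" for t
  proof (rule LIMSEQ_le_const2)
    let ?f = "\<lambda>n a. ennreal (min (\<phi> a) (real n * ?e a) * (S t a)\<^sup>2)"
    show "(\<lambda>n. \<integral>\<^sup>+a. ?f n a \<partial>lborel) \<longlonglongrightarrow> (\<integral>\<^sup>+a. ennreal (\<phi> a * (S t a)\<^sup>2) \<partial>lborel)"
    proof (rule nn_integral_LIMSEQ)
      show "incseq ?f"
        by (intro incseq_SucI le_funI ennreal_leI mult_right_mono min.mono) auto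
      show "(\<lambda>n. ?f n a) \<longlonglongrightarrow> ennreal (\<phi> a * (S t a)\<^sup>2)" for a
      proof (rule tendsto_eventually, rule eventually_sequentiallyI)
        \<comment> \<open>For such \<open>n\<close> the cut-off at the point \<open>a\<close> is
          inactive.\<close>
        fix n assume "nat \<lceil>\<phi> a * exp \<bar>a\<bar>\<rceil> \<le> n"
        hence "\<phi> a * exp \<bar>a\<bar> \<le> real n" by linarith
        hence "\<phi> a \<le> real n * ?e a" by (simp add: exp_minus field_simps)
        thus "?f n a = ennreal (\<phi> a * (S t a)\<^sup>2)" by (simp add: min_def)
      qed
    qed measurable
    show "\<exists>N. \<forall>n\<ge>N. (\<integral>\<^sup>+a. ?f n a \<partial>lborel) \<le> ennreal C * (\<integral>\<^sup>+a. ennreal (\<phi> a * (S 0 a)\<^sup>2) \<partial>lborel)"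
      using main[OF t] by blast
  qed
  thus ?thesis by blast
qed

section \<open>Weighted estimates along the flow\<close>

lemma powr_add_le:
  fixes x y p :: real
  assumes "x \<ge> 0" "y \<ge> 0" "p \<ge> 1"
  shows "(x + y) powr p \<le> 2 powr p * (x powr p + y powr p)"
proof -
  have "(x + y) powr p \<le> (2 * max x y) powr p" using assms by (intro powr_mono2) auto
  also have "\<dots> = 2 powr p * max x y powr p" using assms by (simp add: powr_mult)
  also have "max x y powr p \<le> x powr p + y powr p" by (simp add: max_def)
  finally show ?thesis by simp
qed

context regular_solution
begin

text \<open>Freezing time outside \<open>[0, T]\<close> makes \<open>S\<close> jointly continuous,
  hence Borel, on the whole plane, as the exchanges of integrals in time and label require.\<close>

definition clamp :: "real \<Rightarrow> real" where "clamp t = max 0 (min T t)"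

lemma clamp_in: "clamp t \<in> {0..T}" and clamp_id: "t \<in> {0..T} \<Longrightarrow> clamp t = t"
  using T by (auto simp: clamp_def)

definition S :: "real \<Rightarrow> real \<Rightarrow> real" where "S t a = \<bar>U (clamp t) a\<bar> + \<bar>V (clamp t) a\<bar>"

lemma S_eq: "t \<in> {0..T} \<Longrightarrow> S t a = \<bar>U t a\<bar> + \<bar>V t a\<bar>"
  by (simp add: S_def clamp_id)

lemma S_nonneg: "S t a \<ge> 0" and S_le: "S t a \<le> 2 * M"
  using U_bound[OF clamp_in, of t a] V_bound[OF clamp_in, of t a] by (auto simp: S_def)

lemma continuous_S: "continuous_on UNIV (\<lambda>(t, a). S t a)"
proof -
  have c: "continuous_on UNIV (\<lambda>z::real \<times> real. clamp (fst z))"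
    unfolding clamp_def by (intro continuous_intros)
  show ?thesis unfolding S_def case_prod_unfold
    by (intro continuous_intros continuous_on_slice[OF continuous_U c] continuous_on_slice[OF continuous_V c] clamp_in) auto
qed

lemma continuous_S_time: "continuous_on B (\<lambda>\<tau>. S \<tau> a)"
  using continuous_on_slice[of UNIV UNIV S B "\<lambda>\<tau>. \<tau>" "\<lambda>_. a"] continuous_S by (simp add: continuous_on_id)

lemmas measurable_S [measurable (raw)] = borel_measurable_uncurry[OF continuous_S]

definition R :: "real \<Rightarrow> real \<Rightarrow> real" where "R t a = conv (\<lambda>x. exp (- \<bar>x\<bar>)) (\<lambda>c. (S t c)\<^sup>2) a"

lemma S_power2_le: "(S t a)\<^sup>2 \<le> 2 * M * S t a"
  using mult_right_mono[OF S_le S_nonneg, of t a t a] by (simp add: power2_eq_square)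

lemma S_power2_bound: "(S t a)\<^sup>2 \<le> (2 * M)\<^sup>2"
  by (intro power_mono S_le S_nonneg)

lemma continuous_R_time: "continuous_on B (\<lambda>\<tau>. R \<tau> a)"
proof -
  have "continuous_on (UNIV \<times> UNIV) (\<lambda>(t, a). (S t a)\<^sup>2)"
    using continuous_on_power[OF continuous_S, of 2] by (simp add: case_prod_unfold)
  from continuous_on_conv[OF integrable_exp_abs this, of "(2 * M)\<^sup>2"] S_power2_bound
  have "continuous_on (UNIV \<times> UNIV) (\<lambda>(t, a). R t a)" unfolding R_def by simp
  from continuous_on_slice[OF this, of B "\<lambda>\<tau>. \<tau>" "\<lambda>_. a"] show ?thesis by (simp add: continuous_on_id)
qed

lemma R_nn: "ennreal (R t a) = (\<integral>\<^sup>+c. ennreal (exp (- \<bar>a - c\<bar>) * (S t c)\<^sup>2) \<partial>lborel)" and R_nonneg: "R t a \<ge> 0"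
  unfolding R_def by (rule conv_exp_eq_nn_integral[OF _ _ S_power2_bound]; simp)+

text \<open>One factor of \<open>S\<close> is sacrificed to the sup bound \<open>2 * M\<close>. This
  makes the nonlocal term linear in \<open>S\<close>, as the L^2 Gronwall argument demands.\<close>

lemma R_le: "R t a \<le> 2 * M * conv (\<lambda>x. exp (- \<bar>x\<bar>)) (S t) a"
  unfolding R_def conv_def integral_mult_right_zero[symmetric]
proof (rule integral_mono)
  show "integrable lborel (\<lambda>c. exp (- \<bar>a - c\<bar>) * (S t c)\<^sup>2)"
    by (rule integrable_mult_bounded[OF integrable_exp_shift, of _ "(2 * M)\<^sup>2"]) (use S_power2_bound in auto)
  show "integrable lborel (\<lambda>c. 2 * M * (exp (- \<bar>a - c\<bar>) * S t c))"
    by (intro integrable_mult_right integrable_mult_bounded[OF integrable_exp_shift, of _ "2 * M"])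
      (use S_le S_nonneg in \<open>auto simp: abs_of_nonneg\<close>)
  show "exp (- \<bar>a - c\<bar>) * (S t c)\<^sup>2 \<le> 2 * M * (exp (- \<bar>a - c\<bar>) * S t c)" for c
    using mult_left_mono[OF S_power2_le[of t c], of "exp (- \<bar>a - c\<bar>)"] by (simp add: mult_ac)
qed

end

locale quadratic_solution = regular_solution +
  fixes c :: real
  assumes c: "c \<ge> 0" and g_quadratic: "t \<in> {0..T} \<Longrightarrow> \<bar>g (u t x)\<bar> \<le> c * (u t x)\<^sup>2"
begin

lemma source_le:
  assumes t: "t \<in> {0..T}"
  shows "\<bar>source f g (U t a) (V t a)\<bar> \<le> (c + A) * (S t a)\<^sup>2"
proof -
  have "\<bar>source f g (U t a) (V t a)\<bar> \<le> \<bar>g (U t a)\<bar> + \<bar>deriv (deriv f) (U t a)\<bar> / 2 * (V t a)\<^sup>2"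
    unfolding source_def by (rule order_trans[OF abs_triangle_ineq]) (simp add: abs_mult)
  also have "\<dots> \<le> c * (U t a)\<^sup>2 + A * (V t a)\<^sup>2"
    using g_quadratic[OF t, of "X t a"] coeff_bound(2)[OF U_bound[OF t], of a]
    by (intro add_mono mult_right_mono) (auto simp: U_def)
  also have "\<dots> \<le> c * (S t a)\<^sup>2 + A * (S t a)\<^sup>2"
    using c A_nonneg by (intro add_mono mult_left_mono) (auto simp: S_eq[OF t] simp flip: abs_le_square_iff)
  finally show ?thesis by (simp add: distrib_right)
qed

text \<open>The factors of \<open>K1\<close> bound the Jacobian, the distortion of the kernel on
  passing to labels, and the source relative to \<open>S^2\<close>. \<open>K2\<close> adds the local
  terms of the equation for \<open>V\<close>, made linear by \<open>S \<le> 2 * M\<close>.\<close>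

definition K1 :: real where "K1 = exp ((A * M + 1) * T) * exp (2 * A * T) * (c + A)"
definition K2 :: real where "K2 = (c + 2 * A) * (2 * M) + K1"

lemma K1_nonneg: "K1 \<ge> 0" and K2_nonneg: "K2 \<ge> 0" and K1_le_K2: "K1 \<le> K2"
  using c A_nonneg M_nonneg by (auto simp: K1_def K2_def)

lemma kernel_bound:
  assumes t: "t \<in> {0..T}" and k: "k \<in> borel_measurable borel" "\<And>x. \<bar>k x\<bar> \<le> exp (- \<bar>x\<bar>) / 2"
  shows "\<bar>LINT d|lborel. J t d * (k (X t a - X t d) * source f g (U t d) (V t d))\<bar> \<le> K1 * R t a"
proof -
  have "norm (LINT d|lborel. J t d * (k (X t a - X t d) * source f g (U t d) (V t d))) \<le>
      (LINT d|lborel. K1 * (exp (- \<bar>a - d\<bar>) * (S t d)\<^sup>2))"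
  proof (rule Bochner_Integration.integral_norm_bound_integral[OF integrable_kernel[OF t k]])
    show "integrable lborel (\<lambda>d. K1 * (exp (- \<bar>a - d\<bar>) * (S t d)\<^sup>2))"
      by (intro integrable_mult_right integrable_mult_bounded[OF integrable_exp_shift, of _ "(2 * M)\<^sup>2"])
        (use S_power2_bound in auto)
    fix d
    have "\<bar>k (X t a - X t d)\<bar> \<le> exp (2 * A * T) * exp (- \<bar>a - d\<bar>)"
      using k(2)[of "X t a - X t d"] exp_X_diff_le[OF t, of a d] by simp
    hence "norm (J t d * (k (X t a - X t d) * source f g (U t d) (V t d))) \<le>
        exp ((A * M + 1) * T) * ((exp (2 * A * T) * exp (- \<bar>a - d\<bar>)) * ((c + A) * (S t d)\<^sup>2))"
      unfolding real_norm_def abs_mult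
      using J_le[OF t, of d] J_pos[of t d] by (intro mult_mono source_le t) auto
    thus "norm (J t d * (k (X t a - X t d) * source f g (U t d) (V t d))) \<le> K1 * (exp (- \<bar>a - d\<bar>) * (S t d)\<^sup>2)"
      by (simp add: K1_def mult_ac)
  qed
  thus ?thesis by (simp add: R_def conv_def)
qed

lemma dU_bound: "t \<in> {0..T} \<Longrightarrow> \<bar>- P t (X t a)\<bar> \<le> K2 * (S t a + R t a)"
proof -
  assume t: "t \<in> {0..T}"
  have "\<bar>- P t (X t a)\<bar> \<le> K1 * R t a" using kernel_bound[OF t dq_measurable abs_dq_le] by (simp add: P_X[OF t])
  also have "\<dots> \<le> K2 * (S t a + R t a)"
    using K1_le_K2 K1_nonneg K2_nonneg S_nonneg[of t a] R_nonneg[of t a] by (intro mult_mono) auto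
  finally show ?thesis .
qed

lemma dV_bound:
  assumes t: "t \<in> {0..T}"
  shows "\<bar>dV t a\<bar> \<le> K2 * (S t a + R t a)"
proof -
  have "\<bar>Q t (X t a)\<bar> \<le> K1 * R t a"
    using kernel_bound[OF t q_measurable, of a] abs_q by (simp add: Q_X[OF t])
  moreover have "\<bar>deriv (deriv f) (U t a) * (V t a)\<^sup>2\<bar> \<le> A * (S t a)\<^sup>2"
    unfolding abs_mult using A_nonneg
    by (intro mult_mono coeff_bound U_bound t) (auto simp: S_eq[OF t] simp flip: abs_le_square_iff)
  moreover note source_le[OF t, of a]
  ultimately have "\<bar>dV t a\<bar> \<le> (c + A) * (S t a)\<^sup>2 + A * (S t a)\<^sup>2 + K1 * R t a"
    unfolding dV_def by linarith
  also have "\<dots> = (c + 2 * A) * (S t a)\<^sup>2 + K1 * R t a" by (simp add: algebra_simps)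
  also have "\<dots> \<le> (c + 2 * A) * (2 * M * S t a) + K1 * R t a"
    using c A_nonneg S_power2_le by (intro add_right_mono mult_left_mono) auto
  also have "\<dots> \<le> ((c + 2 * A) * (2 * M) + K1) * S t a + K2 * R t a"
    using K1_nonneg K1_le_K2 S_nonneg[of t a] R_nonneg[of t a]
    by (intro add_mono mult_right_mono) (auto simp: algebra_simps)
  finally show ?thesis by (simp add: K2_def algebra_simps)
qed

lemma abs_FTC_le:
  fixes y y' h :: "real \<Rightarrow> real"
  assumes der: "\<And>t. t \<in> {0..T} \<Longrightarrow> (y has_real_derivative y' t) (at t within {0..T})"
    and h: "continuous_on {0..T} h" and le: "\<And>t. t \<in> {0..T} \<Longrightarrow> \<bar>y' t\<bar> \<le> h t" and t: "t \<in> {0..T}"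
  shows "\<bar>y t - y 0\<bar> \<le> integral {0..t} h"
proof -
  have i: "(y' has_integral (y t - y 0)) {0..t}"
    using t by (intro fundamental_theorem_of_calculus)
      (auto simp flip: has_real_derivative_iff_has_vector_derivative intro!: DERIV_subset[OF der])
  have "norm (integral {0..t} y') \<le> integral {0..t} h"
    using t le by (intro Henstock_Kurzweil_Integration.integral_norm_bound_integral has_integral_integrable[OF i]
        integrable_continuous_interval continuous_on_subset[OF h]) auto
  thus ?thesis using integral_unique[OF i] by simp
qed

text \<open>Gronwall in time for a fixed label, with \<open>R\<close> kept as a forcing that is
  still quadratic in \<open>S\<close>: in the L^p bound it becomes a convolution with the integrable
  density \<open>\<phi> * S^2\<close>. Integrating \<open>R\<close> over all of
  \<open>[0, T]\<close> gives one majorant for every \<open>t\<close>.\<close>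

lemma S_pointwise:
  assumes t: "t \<in> {0..T}"
  shows "S t a \<le> exp (2 * K2 * T) * (S 0 a + 2 * K2 * integral {0..T} (\<lambda>\<tau>. R \<tau> a))"
proof -
  let ?c = "S 0 a + 2 * K2 * integral {0..T} (\<lambda>\<tau>. R \<tau> a)"
  have iR: "(\<lambda>\<tau>. R \<tau> a) integrable_on {0..t}" for t by (intro integrable_continuous_interval continuous_R_time)
  have iS: "(\<lambda>\<tau>. S \<tau> a) integrable_on {0..t}" for t by (intro integrable_continuous_interval continuous_S_time)
  have c0: "?c \<ge> 0"
    using K2_nonneg S_nonneg R_nonneg by (intro add_nonneg_nonneg mult_nonneg_nonneg integral_nonneg iR) auto
  have "S t a \<le> ?c + (2 * K2) * integral {0..t} (\<lambda>\<tau>. S \<tau> a)" if t: "t \<in> {0..T}" for t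
  proof -
    let ?h = "\<lambda>\<tau>. K2 * (S \<tau> a + R \<tau> a)"
    have ch: "continuous_on {0..T} ?h" by (intro continuous_intros continuous_S_time continuous_R_time)
    have "\<bar>U t a - U 0 a\<bar> \<le> integral {0..t} ?h"
      by (rule abs_FTC_le[OF deriv_U ch dU_bound t])
    moreover have "\<bar>V t a - V 0 a\<bar> \<le> integral {0..t} ?h"
      by (rule abs_FTC_le[OF deriv_V ch dV_bound t])
    moreover have "S t a = \<bar>U t a\<bar> + \<bar>V t a\<bar>" "S 0 a = \<bar>U 0 a\<bar> + \<bar>V 0 a\<bar>"
      using t T by (auto simp: S_eq)
    ultimately have *: "S t a \<le> S 0 a + 2 * integral {0..t} ?h" by linarith
    have hsum: "integral {0..t} ?h = K2 * (integral {0..t} (\<lambda>\<tau>. S \<tau> a) + integral {0..t} (\<lambda>\<tau>. R \<tau> a))"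
      using Henstock_Kurzweil_Integration.integral_add[OF iS iR, of t] by simp
    have "integral {0..t} (\<lambda>\<tau>. R \<tau> a) \<le> integral {0..T} (\<lambda>\<tau>. R \<tau> a)"
      using t R_nonneg by (intro integral_subset_le iR) auto
    from mult_left_mono[OF this K2_nonneg] * show ?thesis
      unfolding hsum by (simp add: distrib_left)
  qed
  hence "S t a \<le> ?c * exp (2 * K2 * t)"
    using K2_nonneg by (intro gronwall_real[OF continuous_S_time _ _ t]) auto
  also have "\<dots> \<le> ?c * exp (2 * K2 * T)"
    using c0 K2_nonneg t by (intro mult_left_mono) (auto intro: mult_left_mono)
  finally show ?thesis by (simp add: mult.commute)
qed

text \<open>The factor 2 is the price of \<open>S^2 \<le> 2 * (U^2 + V^2)\<close>, the term
  \<open>(2 * M)^2\<close> comes from \<open>R_le\<close>, and the final 1 secures strict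
  positivity.\<close>

definition K3 :: real where "K3 = 2 * K2 * (3 + (2 * M)\<^sup>2) + 1"

lemma K3_pos: "K3 > 0"
  using K2_nonneg by (simp add: K3_def add_nonneg_pos)

text \<open>\<open>S\<close> contains absolute values and is not differentiable in time, so the
  energy identity is applied to \<open>U^2 + V^2\<close>, which is comparable with
  \<open>S^2\<close>.\<close>

lemma S_quadratic:
  assumes t: "t \<in> {0..T}"
  shows "(S t a)\<^sup>2 \<le> 2 * (S 0 a)\<^sup>2 +
    K3 * integral {0..t} (\<lambda>\<tau>. (S \<tau> a)\<^sup>2 + (conv (\<lambda>x. exp (- \<bar>x\<bar>)) (S \<tau>) a)\<^sup>2)"
proof -
  let ?I = "\<lambda>\<tau>. conv (\<lambda>x. exp (- \<bar>x\<bar>)) (S \<tau>) a"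
  let ?w = "\<lambda>\<tau>. (U \<tau> a)\<^sup>2 + (V \<tau> a)\<^sup>2"
  let ?h = "\<lambda>\<tau>. K2 * (3 * (S \<tau> a)\<^sup>2 + (R \<tau> a)\<^sup>2)"
  have ch: "continuous_on B ?h" for B by (intro continuous_intros continuous_S_time continuous_R_time)
  have cI: "continuous_on B ?I" for B
  proof -
    have "continuous_on (UNIV \<times> UNIV) (\<lambda>(t, a). conv (\<lambda>x. exp (- \<bar>x\<bar>)) (S t) a)"
      using continuous_on_conv[OF integrable_exp_abs, of UNIV S "2 * M"] continuous_S S_nonneg S_le by simp
    from continuous_on_slice[OF this, of B "\<lambda>\<tau>. \<tau>" "\<lambda>_. a"] show ?thesis by (simp add: continuous_on_id)
  qed
  have "\<bar>?w t - ?w 0\<bar> \<le> integral {0..t} ?h"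
  proof (rule abs_FTC_le[OF _ ch _ t])
    fix \<tau> assume \<tau>: "\<tau> \<in> {0..T}"
    show "(?w has_real_derivative 2 * (U \<tau> a * - P \<tau> (X \<tau> a)) + 2 * (V \<tau> a * dV \<tau> a)) (at \<tau> within {0..T})"
      using deriv_U[OF \<tau>, of a] deriv_V[OF \<tau>, of a] by (auto intro!: derivative_eq_intros)
    let ?D = "K2 * (S \<tau> a + R \<tau> a)"
    have "\<bar>2 * (U \<tau> a * - P \<tau> (X \<tau> a)) + 2 * (V \<tau> a * dV \<tau> a)\<bar> \<le>
        2 * (\<bar>U \<tau> a\<bar> * \<bar>- P \<tau> (X \<tau> a)\<bar>) + 2 * (\<bar>V \<tau> a\<bar> * \<bar>dV \<tau> a\<bar>)"
      unfolding abs_mult[symmetric] by linarith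
    also have "\<dots> \<le> 2 * (\<bar>U \<tau> a\<bar> * ?D) + 2 * (\<bar>V \<tau> a\<bar> * ?D)"
      using dU_bound[OF \<tau>, of a] dV_bound[OF \<tau>, of a] by (intro add_mono mult_left_mono) auto
    also have "\<dots> = K2 * (2 * (S \<tau> a)\<^sup>2 + 2 * S \<tau> a * R \<tau> a)"
      by (simp add: S_eq[OF \<tau>] power2_eq_square algebra_simps)
    \<comment> \<open>\<open>2 * S * R \<le> S^2 + R^2\<close> accounts for the coefficient
      3.\<close>
    also have "\<dots> \<le> ?h \<tau>"
      using K2_nonneg zero_le_power2[of "S \<tau> a - R \<tau> a"]
      by (intro mult_left_mono) (auto simp: power2_eq_square algebra_simps)
    finally show "\<bar>2 * (U \<tau> a * - P \<tau> (X \<tau> a)) + 2 * (V \<tau> a * dV \<tau> a)\<bar> \<le> ?h \<tau>" .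
  qed
  also have "\<dots> \<le> integral {0..t} (\<lambda>\<tau>. (K2 * (3 + (2 * M)\<^sup>2)) * ((S \<tau> a)\<^sup>2 + (?I \<tau>)\<^sup>2))"
  proof (rule integral_le)
    show "?h integrable_on {0..t}" by (intro integrable_continuous_interval ch)
    show "(\<lambda>\<tau>. (K2 * (3 + (2 * M)\<^sup>2)) * ((S \<tau> a)\<^sup>2 + (?I \<tau>)\<^sup>2)) integrable_on {0..t}"
      by (intro integrable_continuous_interval continuous_intros continuous_S_time cI)
    fix \<tau>
    have "(R \<tau> a)\<^sup>2 \<le> (2 * M * ?I \<tau>)\<^sup>2" by (intro power_mono R_le R_nonneg)
    hence "3 * (S \<tau> a)\<^sup>2 + (R \<tau> a)\<^sup>2 \<le> 3 * (S \<tau> a)\<^sup>2 + (2 * M)\<^sup>2 * (?I \<tau>)\<^sup>2" by (simp add: power_mult_distrib)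
    also have "\<dots> \<le> (3 + (2 * M)\<^sup>2) * ((S \<tau> a)\<^sup>2 + (?I \<tau>)\<^sup>2)"
      by (simp add: algebra_simps)
    finally have "3 * (S \<tau> a)\<^sup>2 + (R \<tau> a)\<^sup>2 \<le> (3 + (2 * M)\<^sup>2) * ((S \<tau> a)\<^sup>2 + (?I \<tau>)\<^sup>2)" .
    from mult_left_mono[OF this K2_nonneg]
    show "?h \<tau> \<le> (K2 * (3 + (2 * M)\<^sup>2)) * ((S \<tau> a)\<^sup>2 + (?I \<tau>)\<^sup>2)" by (simp add: mult.assoc)
  qed
  also have "\<dots> = K2 * (3 + (2 * M)\<^sup>2) * integral {0..t} (\<lambda>\<tau>. (S \<tau> a)\<^sup>2 + (?I \<tau>)\<^sup>2)" by simp
  finally have w: "?w t \<le> ?w 0 + K2 * (3 + (2 * M)\<^sup>2) * integral {0..t} (\<lambda>\<tau>. (S \<tau> a)\<^sup>2 + (?I \<tau>)\<^sup>2)"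
    by linarith
  have "(S t a)\<^sup>2 \<le> 2 * ?w t"
    unfolding S_eq[OF t] using zero_le_power2[of "\<bar>U t a\<bar> - \<bar>V t a\<bar>"]
    by (simp add: power2_eq_square algebra_simps)
  moreover have "?w 0 \<le> (S 0 a)\<^sup>2"
    using S_eq[of 0 a] T by (simp add: power2_eq_square algebra_simps)
  moreover have "2 * (K2 * (3 + (2 * M)\<^sup>2) * integral {0..t} (\<lambda>\<tau>. (S \<tau> a)\<^sup>2 + (?I \<tau>)\<^sup>2)) \<le>
      K3 * integral {0..t} (\<lambda>\<tau>. (S \<tau> a)\<^sup>2 + (?I \<tau>)\<^sup>2)"
  proof -
    have "integral {0..t} (\<lambda>\<tau>. (S \<tau> a)\<^sup>2 + (?I \<tau>)\<^sup>2) \<ge> 0"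
      by (intro integral_nonneg integrable_continuous_interval continuous_intros continuous_S_time cI) auto
    from mult_right_mono[OF _ this, of "2 * (K2 * (3 + (2 * M)\<^sup>2))" K3] show ?thesis by (simp add: K3_def mult.assoc)
  qed
  moreover have "x \<le> 2 * s + k" if "x \<le> 2 * w" "w0 \<le> s" "2 * d \<le> k" "w \<le> w0 + d" for x w w0 s d k :: real
    using that by linarith
  ultimately show ?thesis using w by blast
qed

end

section \<open>Moderate weights along the flow and return to Eulerian coordinates\<close>

lemma Lp_norm_le_integral:
  assumes "p \<noteq> \<infinity>" "(\<integral>\<^sup>+x. ennreal (norm (h x) powr enn2real p) \<partial>lborel) \<le> ennreal B" "B \<ge> 0"
  shows "Lp_norm p h \<le> ennreal (B powr (1 / enn2real p))"
proof -
  let ?I = "\<integral>\<^sup>+x. ennreal (norm (h x) powr enn2real p) \<partial>lborel"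
  have "?I < \<infinity>" using assms(2) by (rule le_less_trans) simp
  moreover have "enn2real ?I \<le> B" using assms(2,3) by (intro enn2real_leI)
  hence "enn2real ?I powr (1 / enn2real p) \<le> B powr (1 / enn2real p)"
    by (intro powr_mono2) auto
  ultimately show ?thesis using assms(1) by (auto simp: Lp_norm_def Let_def intro: ennreal_leI)
qed

context quadratic_solution
begin

context
  fixes \<phi> v :: "real \<Rightarrow> real" and c0 :: real
  assumes v: "weight_function v" and \<phi>: "weight_function \<phi>"
    and moderate: "\<And>x y. \<phi> (x + y) \<le> c0 * v x * \<phi> y" and c0: "c0 > 0"
begin

lemma v_pos: "v x > 0" and \<phi>_pos: "\<phi> x > 0"
  using v \<phi> by (auto simp: weight_function_def)

lemma measurable_weights [measurable]: "v \<in> borel_measurable borel" "\<phi> \<in> borel_measurable borel"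
  using v \<phi> by (auto simp: weight_function_def intro: borel_measurable_continuous_onI)

text \<open>The displacement \<open>X t a - a\<close> stays in the compact interval of radius
  \<open>A * T\<close>, on which the continuous function \<open>v\<close> is bounded.\<close>

lemma weight_transport: "\<exists>C>0. \<forall>t\<in>{0..T}. \<forall>a. \<phi> (X t a) \<le> C * \<phi> a"
proof -
  have "compact (v ` {- (A * T)..A * T})"
    using v by (intro compact_continuous_image) (auto simp: weight_function_def intro: continuous_on_subset)
  from compact_imp_bounded[OF this] obtain D where "D > 0" "\<forall>y\<in>v ` {- (A * T)..A * T}. norm y \<le> D"
    unfolding bounded_pos by blast
  hence D: "D > 0" "\<And>x. x \<in> {- (A * T)..A * T} \<Longrightarrow> \<bar>v x\<bar> \<le> D" by auto
  have "\<phi> (X t a) \<le> c0 * D * \<phi> a" if t: "t \<in> {0..T}" for t a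
  proof -
    have "\<phi> (X t a) \<le> c0 * v (X t a - a) * \<phi> a" using moderate[of "X t a - a" a] by simp
    also have "\<dots> \<le> c0 * D * \<phi> a"
      using X_displacement[OF t, of a] D(2)[of "X t a - a"] c0 \<phi>_pos[of a]
      by (intro mult_right_mono mult_left_mono) (auto simp: abs_le_iff less_imp_le)
    finally show ?thesis .
  qed
  thus ?thesis using D(1) c0 by (intro exI[of _ "c0 * D"]) auto
qed

lemma S_0: "S 0 a = \<bar>u 0 a\<bar> + \<bar>ux 0 a\<bar>"
  using T by (simp add: S_eq U_def V_def X_0)

lemma u_le_S:
  assumes "t \<in> {0..T}"
  shows "\<bar>u t (X t a)\<bar> \<le> S t a" "\<bar>ux t (X t a)\<bar> \<le> S t a"
  using assms by (auto simp: S_eq U_def V_def)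

lemma measurable_u:
  assumes t: "t \<in> {0..T}"
  shows "u t \<in> borel_measurable borel" "ux t \<in> borel_measurable borel"
proof -
  show "u t \<in> borel_measurable borel"
    by (intro borel_measurable_continuous_onI continuous_on_slice[OF cont_u]) (use t in \<open>auto intro: continuous_intros\<close>)
  show "ux t \<in> borel_measurable borel"
    by (intro borel_measurable_continuous_onI continuous_on_slice[OF cont_ux]) (use t in \<open>auto intro: continuous_intros\<close>)
qed

lemma S_L2_bound:
  assumes sv: "(\<integral>\<^sup>+x. ennreal (sqrt (v x) * exp (- \<bar>x\<bar>)) \<partial>lborel) < \<infinity>"
    and init: "(\<integral>\<^sup>+x. ennreal (\<phi> x * (u 0 x)\<^sup>2) \<partial>lborel) < \<infinity>" "(\<integral>\<^sup>+x. ennreal (\<phi> x * (ux 0 x)\<^sup>2) \<partial>lborel) < \<infinity>"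
  shows "\<exists>C\<ge>0. \<forall>t\<in>{0..T}. (\<integral>\<^sup>+a. ennreal (\<phi> a * (S t a)\<^sup>2) \<partial>lborel) \<le> ennreal C"
proof -
  have [measurable]: "u 0 \<in> borel_measurable borel" "ux 0 \<in> borel_measurable borel"
    using measurable_u[of 0] T by auto
  have "(\<integral>\<^sup>+a. ennreal (\<phi> a * (S 0 a)\<^sup>2) \<partial>lborel) \<le> (\<integral>\<^sup>+a. 2 * ennreal (\<phi> a * (u 0 a)\<^sup>2) + 2 * ennreal (\<phi> a * (ux 0 a)\<^sup>2) \<partial>lborel)"
  proof (rule nn_integral_mono)
    fix a
    have "(S 0 a)\<^sup>2 \<le> 2 * (u 0 a)\<^sup>2 + 2 * (ux 0 a)\<^sup>2"
      unfolding S_0 using zero_le_power2[of "\<bar>u 0 a\<bar> - \<bar>ux 0 a\<bar>"] by (simp add: power2_eq_square algebra_simps)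
    hence "\<phi> a * (S 0 a)\<^sup>2 \<le> \<phi> a * (2 * (u 0 a)\<^sup>2 + 2 * (ux 0 a)\<^sup>2)"
      using \<phi>_pos[of a] by (intro mult_left_mono) auto
    hence "\<phi> a * (S 0 a)\<^sup>2 \<le> 2 * (\<phi> a * (u 0 a)\<^sup>2) + 2 * (\<phi> a * (ux 0 a)\<^sup>2)" by (simp add: algebra_simps)
    hence "ennreal (\<phi> a * (S 0 a)\<^sup>2) \<le> ennreal (2 * (\<phi> a * (u 0 a)\<^sup>2) + 2 * (\<phi> a * (ux 0 a)\<^sup>2))" by (rule ennreal_leI)
    thus "ennreal (\<phi> a * (S 0 a)\<^sup>2) \<le> 2 * ennreal (\<phi> a * (u 0 a)\<^sup>2) + 2 * ennreal (\<phi> a * (ux 0 a)\<^sup>2)"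
      using \<phi>_pos[of a] by (simp add: ennreal_mult less_imp_le)
  qed
  also have "\<dots> = 2 * (\<integral>\<^sup>+a. ennreal (\<phi> a * (u 0 a)\<^sup>2) \<partial>lborel) + 2 * (\<integral>\<^sup>+a. ennreal (\<phi> a * (ux 0 a)\<^sup>2) \<partial>lborel)"
    by (simp add: nn_integral_add nn_integral_cmult)
  also have "\<dots> < \<infinity>" using init by (simp add: ennreal_mult_less_top)
  finally obtain I0 where I0: "(\<integral>\<^sup>+a. ennreal (\<phi> a * (S 0 a)\<^sup>2) \<partial>lborel) = ennreal I0" "I0 \<ge> 0"
    by (cases "\<integral>\<^sup>+a. ennreal (\<phi> a * (S 0 a)\<^sup>2) \<partial>lborel") auto
  have "\<exists>C. \<forall>t\<in>{0..T}. (\<integral>\<^sup>+a. ennreal (\<phi> a * (S t a)\<^sup>2) \<partial>lborel) \<le> ennreal C * (\<integral>\<^sup>+a. ennreal (\<phi> a * (S 0 a)\<^sup>2) \<partial>lborel)"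
    by (rule weighted_L2_estimate[OF v \<phi> moderate c0 sv continuous_S S_nonneg S_le _ K3_pos S_quadratic]) auto
  then obtain C where C: "\<And>t. t \<in> {0..T} \<Longrightarrow> (\<integral>\<^sup>+a. ennreal (\<phi> a * (S t a)\<^sup>2) \<partial>lborel) \<le> ennreal C * ennreal I0"
    unfolding I0(1) by blast
  have "(\<integral>\<^sup>+a. ennreal (\<phi> a * (S t a)\<^sup>2) \<partial>lborel) \<le> ennreal (\<bar>C\<bar> * I0)" if "t \<in> {0..T}" for t
  proof -
    have "ennreal C * ennreal I0 \<le> ennreal \<bar>C\<bar> * ennreal I0" by (intro mult_right_mono ennreal_leI) auto
    with C[OF that] I0(2) show ?thesis by (simp add: ennreal_mult)
  qed
  thus ?thesis using I0(2) by (intro exI[of _ "\<bar>C\<bar> * I0"]) auto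
qed

lemma L2_bound:
  assumes C: "C \<ge> 0" "\<And>t. t \<in> {0..T} \<Longrightarrow> (\<integral>\<^sup>+a. ennreal (\<phi> a * (S t a)\<^sup>2) \<partial>lborel) \<le> ennreal C"
  shows "\<exists>K\<ge>0. \<forall>t\<in>{0..T}. Lp_norm 2 (\<lambda>x. sqrt (\<phi> x) * u t x) \<le> ennreal K \<and> Lp_norm 2 (\<lambda>x. sqrt (\<phi> x) * ux t x) \<le> ennreal K"
proof -
  obtain CV where CV: "CV > 0" "\<And>t a. t \<in> {0..T} \<Longrightarrow> \<phi> (X t a) \<le> CV * \<phi> a" using weight_transport by blast
  define B where "B = exp ((A * M + 1) * T) * CV * C"
  have B: "B \<ge> 0" using CV C by (simp add: B_def)
  \<comment> \<open>The integral is bounded by \<open>B\<close>; since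
    \<open>B \<le> (B + 1)^2\<close>, the value \<open>B + 1\<close> bounds the norm without
    extracting a root.\<close>
  have main: "Lp_norm 2 (\<lambda>x. sqrt (\<phi> x) * w x) \<le> ennreal (B + 1)"
    if t: "t \<in> {0..T}" and [measurable]: "w \<in> borel_measurable borel" and w: "\<And>a. \<bar>w (X t a)\<bar> \<le> S t a" for t w
    unfolding Lp_norm_2_le_iff
  proof -
    note [measurable] = measurable_X[OF t] measurable_J[OF t]
    have "(\<integral>\<^sup>+x. ennreal ((norm (sqrt (\<phi> x) * w x))\<^sup>2) \<partial>lborel) = (\<integral>\<^sup>+x. ennreal (\<phi> x * (w x)\<^sup>2) \<partial>lborel)"
      using \<phi>_pos by (simp add: power_mult_distrib less_imp_le)
    also have "\<dots> = (\<integral>\<^sup>+a. ennreal (J t a) * ennreal (\<phi> (X t a) * (w (X t a))\<^sup>2) \<partial>lborel)"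
      by (rule nn_integral_X[OF t]) measurable
    also have "\<dots> \<le> (\<integral>\<^sup>+a. ennreal (exp ((A * M + 1) * T) * CV) * ennreal (\<phi> a * (S t a)\<^sup>2) \<partial>lborel)"
    proof (rule nn_integral_mono)
      fix a
      have "(w (X t a))\<^sup>2 \<le> (S t a)\<^sup>2" using w[of a] S_nonneg[of t a] by (simp flip: abs_le_square_iff)
      hence "J t a * (\<phi> (X t a) * (w (X t a))\<^sup>2) \<le> exp ((A * M + 1) * T) * ((CV * \<phi> a) * (S t a)\<^sup>2)"
        using J_le[OF t, of a] J_pos[of t a] CV(2)[OF t, of a] \<phi>_pos[of a] \<phi>_pos[of "X t a"] CV(1)
        by (intro mult_mono) (auto simp: less_imp_le)
      thus "ennreal (J t a) * ennreal (\<phi> (X t a) * (w (X t a))\<^sup>2) \<le> ennreal (exp ((A * M + 1) * T) * CV) * ennreal (\<phi> a * (S t a)\<^sup>2)"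
        using J_pos[of t a] \<phi>_pos[of a] \<phi>_pos[of "X t a"] CV(1)
        by (subst (1 2) ennreal_mult[symmetric]) (auto simp: less_imp_le mult_ac intro!: ennreal_leI)
    qed
    also have "\<dots> = ennreal (exp ((A * M + 1) * T) * CV) * (\<integral>\<^sup>+a. ennreal (\<phi> a * (S t a)\<^sup>2) \<partial>lborel)"
      by (rule nn_integral_cmult) measurable
    also have "\<dots> \<le> ennreal (exp ((A * M + 1) * T) * CV) * ennreal C" by (intro mult_left_mono C t) simp
    also have "\<dots> = ennreal B" using CV C by (simp add: B_def ennreal_mult)
    also have "\<dots> \<le> (ennreal (B + 1))\<^sup>2"
    proof -
      have "B \<le> (B + 1)\<^sup>2" using B by (simp add: power2_eq_square algebra_simps)
      from ennreal_leI[OF this] show ?thesis using B by (subst ennreal_power) simp_all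
    qed
    finally show "(\<integral>\<^sup>+x. ennreal ((norm (sqrt (\<phi> x) * w x))\<^sup>2) \<partial>lborel) \<le> (ennreal (B + 1))\<^sup>2" .
  qed
  show ?thesis
    using B by (intro exI[of _ "B + 1"] conjI ballI main) (blast intro: measurable_u u_le_S add_nonneg_nonneg zero_le_one)+
qed

text \<open>The nonlocal contribution in \<open>S_pointwise\<close>, multiplied by the
  weight.\<close>

definition Y :: "real \<Rightarrow> real" where "Y a = 2 * K2 * \<phi> a * integral {0..T} (\<lambda>\<tau>. R \<tau> a)"

lemma Y_nonneg: "Y a \<ge> 0"
  unfolding Y_def using K2_nonneg \<phi>_pos[of a] R_nonneg
  by (intro mult_nonneg_nonneg integral_nonneg integrable_continuous_interval continuous_R_time) (auto simp: less_imp_le)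

lemma \<phi>_S_le: "t \<in> {0..T} \<Longrightarrow> \<phi> a * S t a \<le> exp (2 * K2 * T) * (\<phi> a * S 0 a + Y a)"
  using mult_left_mono[OF S_pointwise, of t "\<phi> a" a] \<phi>_pos[of a] by (simp add: Y_def less_imp_le algebra_simps)

text \<open>The L^1 density in the final convolution. It also carries the constants and the factor
  \<open>c0\<close> of moderateness, so that the kernel is exactly
  \<open>exp (- \<bar>x\<bar>) * v x\<close>.\<close>

definition H :: "real \<Rightarrow> ennreal" where
  "H d = (\<integral>\<^sup>+\<tau>. indicator {0..T} \<tau> * ennreal (2 * K2 * c0 * (\<phi> d * (S \<tau> d)\<^sup>2)) \<partial>lborel)"

lemma measurable_H [measurable]: "H \<in> borel_measurable borel"
  unfolding H_def[abs_def] by measurable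

text \<open>Moderateness replaces \<open>\<phi> a\<close> by
  \<open>c0 * v (a - d) * \<phi> d\<close> under the integral, and Tonelli carries the time
  integration inside, onto the density.\<close>

lemma Y_le_convolution: "ennreal (Y a) \<le> (\<integral>\<^sup>+d. ennreal (exp (- \<bar>a - d\<bar>) * v (a - d)) * H d \<partial>lborel)"
proof -
  let ?k = "\<lambda>d. exp (- \<bar>a - d\<bar>) * v (a - d)"
  let ?h = "\<lambda>\<tau> d. 2 * K2 * c0 * (\<phi> d * (S \<tau> d)\<^sup>2)"
  have k0: "2 * K2 * \<phi> a \<ge> 0" using K2_nonneg \<phi>_pos[of a] by simp
  have "ennreal (Y a) = ennreal (2 * K2 * \<phi> a) * ennreal (integral {0..T} (\<lambda>\<tau>. R \<tau> a))"
    unfolding Y_def using k0 by (rule ennreal_mult')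
  also have "ennreal (integral {0..T} (\<lambda>\<tau>. R \<tau> a)) = (\<integral>\<^sup>+\<tau>. indicator {0..T} \<tau> * ennreal (R \<tau> a) \<partial>lborel)"
    by (rule nn_integral_Icc_eq_integral[OF continuous_R_time R_nonneg])
  also have "ennreal (2 * K2 * \<phi> a) * \<dots> = (\<integral>\<^sup>+\<tau>. ennreal (2 * K2 * \<phi> a) * (indicator {0..T} \<tau> * ennreal (R \<tau> a)) \<partial>lborel)"
    unfolding R_nn by (rule nn_integral_cmult[symmetric]) measurable
  also have "\<dots> \<le> (\<integral>\<^sup>+\<tau>. (\<integral>\<^sup>+d. ennreal (?k d) * (indicator {0..T} \<tau> * ennreal (?h \<tau> d)) \<partial>lborel) \<partial>lborel)"
  proof (rule nn_integral_mono)
    fix \<tau>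
    have "ennreal (2 * K2 * \<phi> a) * (indicator {0..T} \<tau> * ennreal (R \<tau> a)) =
        (\<integral>\<^sup>+d. ennreal (2 * K2 * \<phi> a) * indicator {0..T} \<tau> * ennreal (exp (- \<bar>a - d\<bar>) * (S \<tau> d)\<^sup>2) \<partial>lborel)"
      unfolding R_nn by (subst nn_integral_cmult) (simp_all add: mult.assoc)
    also have "\<dots> \<le> (\<integral>\<^sup>+d. ennreal (?k d) * (indicator {0..T} \<tau> * ennreal (?h \<tau> d)) \<partial>lborel)"
    proof (rule nn_integral_mono)
      fix d
      have "(2 * K2 * (exp (- \<bar>a - d\<bar>) * (S \<tau> d)\<^sup>2)) * \<phi> a \<le> (2 * K2 * (exp (- \<bar>a - d\<bar>) * (S \<tau> d)\<^sup>2)) * (c0 * v (a - d) * \<phi> d)"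
        using moderate[of "a - d" d] K2_nonneg by (intro mult_left_mono) auto
      hence le: "2 * K2 * \<phi> a * (exp (- \<bar>a - d\<bar>) * (S \<tau> d)\<^sup>2) \<le> ?k d * ?h \<tau> d" by (simp add: mult_ac)
      have "ennreal (2 * K2 * \<phi> a) * ennreal (exp (- \<bar>a - d\<bar>) * (S \<tau> d)\<^sup>2) = ennreal (2 * K2 * \<phi> a * (exp (- \<bar>a - d\<bar>) * (S \<tau> d)\<^sup>2))"
        using k0 by (intro ennreal_mult'[symmetric])
      also have "\<dots> \<le> ennreal (?k d * ?h \<tau> d)" by (rule ennreal_leI[OF le])
      also have "\<dots> = ennreal (?k d) * ennreal (?h \<tau> d)" using v_pos[of "a - d"] by (intro ennreal_mult') (simp add: less_imp_le)
      finally show "ennreal (2 * K2 * \<phi> a) * indicator {0..T} \<tau> * ennreal (exp (- \<bar>a - d\<bar>) * (S \<tau> d)\<^sup>2) \<le>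
        ennreal (?k d) * (indicator {0..T} \<tau> * ennreal (?h \<tau> d))"
        by (simp add: indicator_def)
    qed
    finally show "ennreal (2 * K2 * \<phi> a) * (indicator {0..T} \<tau> * ennreal (R \<tau> a)) \<le>
      (\<integral>\<^sup>+d. ennreal (?k d) * (indicator {0..T} \<tau> * ennreal (?h \<tau> d)) \<partial>lborel)" .
  qed
  also have "\<dots> = (\<integral>\<^sup>+d. (\<integral>\<^sup>+\<tau>. ennreal (?k d) * (indicator {0..T} \<tau> * ennreal (?h \<tau> d)) \<partial>lborel) \<partial>lborel)"
    by (rule lborel_pair.Fubini') measurable
  also have "\<dots> = (\<integral>\<^sup>+d. ennreal (?k d) * H d \<partial>lborel)"
    unfolding H_def by (intro nn_integral_cong nn_integral_cmult) measurable
  finally show ?thesis .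
qed

text \<open>Here the weighted L^2 bound feeds into the L^p bound: uniform in time, it is integrated
  over the bounded interval \<open>[0, T]\<close>.\<close>

lemma H_finite:
  assumes C: "C \<ge> 0" "\<And>t. t \<in> {0..T} \<Longrightarrow> (\<integral>\<^sup>+a. ennreal (\<phi> a * (S t a)\<^sup>2) \<partial>lborel) \<le> ennreal C"
  shows "(\<integral>\<^sup>+d. H d \<partial>lborel) < \<infinity>"
proof -
  have k0: "2 * K2 * c0 \<ge> 0" using K2_nonneg c0 by simp
  have "(\<integral>\<^sup>+d. H d \<partial>lborel) = (\<integral>\<^sup>+\<tau>. (\<integral>\<^sup>+d. indicator {0..T} \<tau> * ennreal (2 * K2 * c0 * (\<phi> d * (S \<tau> d)\<^sup>2)) \<partial>lborel) \<partial>lborel)"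
    unfolding H_def by (rule lborel_pair.Fubini') measurable
  also have "\<dots> \<le> (\<integral>\<^sup>+\<tau>. ennreal (2 * K2 * c0 * C) * indicator {0..T} \<tau> \<partial>lborel)"
  proof (rule nn_integral_mono)
    fix \<tau>
    show "(\<integral>\<^sup>+d. indicator {0..T} \<tau> * ennreal (2 * K2 * c0 * (\<phi> d * (S \<tau> d)\<^sup>2)) \<partial>lborel) \<le> ennreal (2 * K2 * c0 * C) * indicator {0..T} \<tau>"
    proof (cases "\<tau> \<in> {0..T}")
      case True
      have "(\<integral>\<^sup>+d. ennreal (2 * K2 * c0 * (\<phi> d * (S \<tau> d)\<^sup>2)) \<partial>lborel) = ennreal (2 * K2 * c0) * (\<integral>\<^sup>+d. ennreal (\<phi> d * (S \<tau> d)\<^sup>2) \<partial>lborel)"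
        unfolding ennreal_mult'[OF k0] by (rule nn_integral_cmult) measurable
      also have "\<dots> \<le> ennreal (2 * K2 * c0) * ennreal C" by (intro mult_left_mono C True) simp
      finally show ?thesis using True by (simp add: ennreal_mult'[OF k0])
    qed simp
  qed
  also have "\<dots> = ennreal (2 * K2 * c0 * C) * emeasure lborel {0..T}" by (rule nn_integral_cmult_indicator) simp
  also have "\<dots> < \<infinity>" using T by (simp add: ennreal_mult_less_top)
  finally show ?thesis .
qed

text \<open>By \<open>\<phi>_S_le\<close> the weighted solution is dominated by the initial datum
  plus \<open>Y\<close>. The first is in L^p by assumption, the second by Young's inequality; the
  flow is then undone by the change of variables, or by surjectivity of \<open>X\<close> when
  \<open>p = \<infinity>\<close>.\<close>

lemma Lp_bound:
  assumes p: "2 \<le> p" and Lpv: "in_Lp p (\<lambda>x. exp (- \<bar>x\<bar>) * v x)"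
    and init: "in_Lp p (\<lambda>x. \<phi> x * u 0 x)" "in_Lp p (\<lambda>x. \<phi> x * ux 0 x)"
    and C: "C \<ge> 0" "\<And>t. t \<in> {0..T} \<Longrightarrow> (\<integral>\<^sup>+a. ennreal (\<phi> a * (S t a)\<^sup>2) \<partial>lborel) \<le> ennreal C"
  shows "\<exists>K\<ge>0. \<forall>t\<in>{0..T}. Lp_norm p (\<lambda>x. \<phi> x * u t x) \<le> ennreal K \<and> Lp_norm p (\<lambda>x. \<phi> x * ux t x) \<le> ennreal K"
proof -
  obtain CV where CV: "CV > 0" "\<And>t a. t \<in> {0..T} \<Longrightarrow> \<phi> (X t a) \<le> CV * \<phi> a" using weight_transport by blast
  let ?E = "exp (2 * K2 * T)"
  have H: "(\<integral>\<^sup>+d. H d \<partial>lborel) < \<infinity>" by (rule H_finite[OF C])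
  have pw: "\<phi> (X t a) * \<bar>w (X t a)\<bar> \<le> CV * ?E * (\<phi> a * S 0 a + Y a)"
    if t: "t \<in> {0..T}" and w: "\<bar>w (X t a)\<bar> \<le> S t a" for t a and w :: "real \<Rightarrow> real"
  proof -
    have "\<phi> (X t a) * \<bar>w (X t a)\<bar> \<le> (CV * \<phi> a) * S t a"
      using CV(1) CV(2)[OF t, of a] w \<phi>_pos[of a] by (intro mult_mono) (auto simp: less_imp_le)
    also have "\<dots> \<le> CV * (?E * (\<phi> a * S 0 a + Y a))"
      using mult_left_mono[OF \<phi>_S_le[OF t, of a], of CV] CV(1) by (simp add: mult.assoc)
    finally show ?thesis by (simp add: mult.assoc)
  qed
  have cu: "continuous_on UNIV (u 0)" "continuous_on UNIV (ux 0)"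
    using T by (auto intro!: continuous_on_slice[OF cont_u] continuous_on_slice[OF cont_ux] continuous_intros)
  have vc: "continuous_on UNIV v" and \<phi>c: "continuous_on UNIV \<phi>" using v \<phi> by (auto simp: weight_function_def)
  show ?thesis
  proof (cases "p = \<infinity>")
    case True
    have cont: "continuous_on UNIV (\<lambda>x. exp (- \<bar>x\<bar>) * v x)" "continuous_on UNIV (\<lambda>x. \<phi> x * u 0 x)"
      "continuous_on UNIV (\<lambda>x. \<phi> x * ux 0 x)"
      using vc \<phi>c cu by (auto intro!: continuous_intros)
    obtain D where D: "D \<ge> 0" "\<And>x. \<bar>exp (- \<bar>x\<bar>) * v x\<bar> \<le> D"
      using in_Lp_infinity[OF Lpv[unfolded True] cont(1)] by blast
    obtain D1 where D1: "D1 \<ge> 0" "\<And>x. \<bar>\<phi> x * u 0 x\<bar> \<le> D1"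
      using in_Lp_infinity[OF init(1)[unfolded True] cont(2)] by blast
    obtain D2 where D2: "D2 \<ge> 0" "\<And>x. \<bar>\<phi> x * ux 0 x\<bar> \<le> D2"
      using in_Lp_infinity[OF init(2)[unfolded True] cont(3)] by blast
    obtain I where I: "(\<integral>\<^sup>+d. H d \<partial>lborel) = ennreal I" "I \<ge> 0" using H by (cases "\<integral>\<^sup>+d. H d \<partial>lborel") auto
    \<comment> \<open>The endpoint case of Young's inequality: supremum of the kernel times total
      mass of the density.\<close>
    have Y: "Y a \<le> D * I" for a
    proof -
      have "ennreal (Y a) \<le> (\<integral>\<^sup>+d. ennreal D * H d \<partial>lborel)"
        by (rule order_trans[OF Y_le_convolution])
          (intro nn_integral_mono mult_right_mono ennreal_leI order_trans[OF abs_ge_self D(2)], simp)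
      also have "\<dots> = ennreal (D * I)" using D I by (simp add: nn_integral_cmult ennreal_mult)
      finally show ?thesis using D I by (simp add: ennreal_le_iff)
    qed
    have S0: "\<phi> a * S 0 a \<le> D1 + D2" for a
      using D1(2)[of a] D2(2)[of a] \<phi>_pos[of a] by (simp add: S_0 distrib_left abs_mult)
    define K where "K = CV * ?E * (D1 + D2 + D * I)"
    have "Lp_norm p (\<lambda>x. \<phi> x * w x) \<le> ennreal K"
      if t: "t \<in> {0..T}" and [measurable]: "w \<in> borel_measurable borel" and w: "\<And>a. \<bar>w (X t a)\<bar> \<le> S t a" for t w
      unfolding True
    proof (rule Lp_norm_infinity_le)
      fix x
      obtain a where a: "X t a = x" by (rule X_surj[OF t])
      have "norm (\<phi> x * w x) = \<phi> (X t a) * \<bar>w (X t a)\<bar>" using \<phi>_pos[of x] by (simp add: a abs_mult)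
      also have "\<dots> \<le> CV * ?E * (\<phi> a * S 0 a + Y a)" by (rule pw[where w = w and a = a, OF t w])
      also have "\<dots> \<le> K" unfolding K_def using CV(1) by (intro mult_left_mono add_mono S0 Y) auto
      finally show "norm (\<phi> x * w x) \<le> K" .
    qed measurable
    moreover have "K \<ge> 0" using CV(1) D D1 D2 I by (simp add: K_def)
    ultimately show ?thesis by (intro exI[of _ K] conjI ballI) (blast intro: measurable_u u_le_S)+
  next
    case False
    define r where "r = enn2real p"
    have r: "r \<ge> 2" using p False unfolding r_def by (cases p) (auto simp flip: ennreal_numeral)
    have [measurable]: "u 0 \<in> borel_measurable borel" "ux 0 \<in> borel_measurable borel"
      using cu by (auto intro: borel_measurable_continuous_onI)
    have Yfin: "(\<integral>\<^sup>+a. ennreal (Y a powr r) \<partial>lborel) < \<infinity>"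
    proof (rule Lp_convolution_bound[OF Y_nonneg Y_le_convolution])
      show "(\<integral>\<^sup>+x. ennreal ((exp (- \<bar>x\<bar>) * v x) powr r) \<partial>lborel) < \<infinity>"
        using in_Lp_finite[OF Lpv False] v_pos by (simp add: r_def abs_mult less_imp_le)
    qed (use v_pos H r in \<open>auto simp: less_imp_le\<close>)
    have S0fin: "(\<integral>\<^sup>+a. ennreal ((\<phi> a * S 0 a) powr r) \<partial>lborel) < \<infinity>"
    proof -
      have "(\<integral>\<^sup>+a. ennreal ((\<phi> a * S 0 a) powr r) \<partial>lborel) \<le>
        (\<integral>\<^sup>+a. ennreal (2 powr r) * (ennreal (norm (\<phi> a * u 0 a) powr r) + ennreal (norm (\<phi> a * ux 0 a) powr r)) \<partial>lborel)"
      proof (rule nn_integral_mono)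
        fix a
        have "\<phi> a * S 0 a = norm (\<phi> a * u 0 a) + norm (\<phi> a * ux 0 a)"
          using \<phi>_pos[of a] by (simp add: S_0 distrib_left abs_mult)
        hence "(\<phi> a * S 0 a) powr r \<le> 2 powr r * (norm (\<phi> a * u 0 a) powr r + norm (\<phi> a * ux 0 a) powr r)"
          using powr_add_le[of "norm (\<phi> a * u 0 a)" "norm (\<phi> a * ux 0 a)" r] r by simp
        thus "ennreal ((\<phi> a * S 0 a) powr r) \<le> ennreal (2 powr r) * (ennreal (norm (\<phi> a * u 0 a) powr r) + ennreal (norm (\<phi> a * ux 0 a) powr r))"
          by (simp flip: ennreal_mult ennreal_plus add: ennreal_leI)
      qed
      also have "\<dots> = ennreal (2 powr r) * ((\<integral>\<^sup>+a. ennreal (norm (\<phi> a * u 0 a) powr r) \<partial>lborel) + (\<integral>\<^sup>+a. ennreal (norm (\<phi> a * ux 0 a) powr r) \<partial>lborel))"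
        by (subst nn_integral_cmult) (simp_all add: nn_integral_add)
      also have "\<dots> < \<infinity>"
        using in_Lp_finite[OF init(1) False] in_Lp_finite[OF init(2) False] by (simp add: r_def ennreal_mult_less_top)
      finally show ?thesis .
    qed
    define I where "I = (\<integral>\<^sup>+a. ennreal ((\<phi> a * S 0 a) powr r) + ennreal (Y a powr r) \<partial>lborel)"
    \<comment> \<open>Measurability in the label is seen by rewriting the gauge integral in time as
      a nonnegative Lebesgue integral of a jointly measurable function.\<close>
    have Ym: "Y \<in> borel_measurable borel"
    proof -
      define G where "G a = (\<integral>\<^sup>+\<tau>. indicator {0..T} \<tau> * ennreal (R \<tau> a) \<partial>lborel)" for a
      have [measurable]: "G \<in> borel_measurable borel"
        unfolding G_def[abs_def] R_nn by measurable
      have "Y = (\<lambda>a. 2 * K2 * \<phi> a * enn2real (G a))"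
      proof
        fix a
        have "integral {0..T} (\<lambda>\<tau>. R \<tau> a) \<ge> 0"
          using R_nonneg by (intro integral_nonneg integrable_continuous_interval continuous_R_time) auto
        thus "Y a = 2 * K2 * \<phi> a * enn2real (G a)"
          unfolding Y_def G_def nn_integral_Icc_eq_integral[OF continuous_R_time R_nonneg, symmetric] by simp
      qed
      thus ?thesis by (simp only:) measurable
    qed
    have "I < \<infinity>" unfolding I_def using Yfin S0fin Ym by (subst nn_integral_add) auto
    then obtain i where i: "I = ennreal i" "i \<ge> 0" by (cases I) auto
    \<comment> \<open>In order: the Jacobian of the change of variables, the pointwise constant
      raised to the power \<open>r\<close>, the loss \<open>2 powr r\<close> for the power of a sum,
      and the integral \<open>i\<close> of the majorant.\<close>
    define B where "B = exp ((A * M + 1) * T) * ((CV * ?E) powr r * 2 powr r) * i"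
    have B: "B \<ge> 0" using i by (simp add: B_def)
    have main: "Lp_norm p (\<lambda>x. \<phi> x * w x) \<le> ennreal (B powr (1 / enn2real p))"
      if t: "t \<in> {0..T}" and [measurable]: "w \<in> borel_measurable borel" and w: "\<And>a. \<bar>w (X t a)\<bar> \<le> S t a" for t w
    proof (rule Lp_norm_le_integral[OF False _ B], fold r_def)
      note [measurable] = measurable_X[OF t] measurable_J[OF t]
      have "(\<integral>\<^sup>+x. ennreal (norm (\<phi> x * w x) powr r) \<partial>lborel) = (\<integral>\<^sup>+a. ennreal (J t a) * ennreal (norm (\<phi> (X t a) * w (X t a)) powr r) \<partial>lborel)"
        by (rule nn_integral_X[OF t]) measurable
      also have "\<dots> \<le> (\<integral>\<^sup>+a. ennreal (exp ((A * M + 1) * T) * ((CV * ?E) powr r * 2 powr r)) *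
          (ennreal ((\<phi> a * S 0 a) powr r) + ennreal (Y a powr r)) \<partial>lborel)"
      proof (rule nn_integral_mono)
        fix a
        have n0: "\<phi> a * S 0 a \<ge> 0" using \<phi>_pos[of a] S_nonneg by (simp add: less_imp_le)
        have "norm (\<phi> (X t a) * w (X t a)) powr r \<le> (CV * ?E * (\<phi> a * S 0 a + Y a)) powr r"
          using pw[where w = w and a = a, OF t w] \<phi>_pos[of "X t a"] r by (intro powr_mono2) (auto simp: abs_mult)
        also have "\<dots> = (CV * ?E) powr r * (\<phi> a * S 0 a + Y a) powr r"
          by (rule powr_mult)
        also have "\<dots> \<le> (CV * ?E) powr r * (2 powr r * ((\<phi> a * S 0 a) powr r + Y a powr r))"
          using n0 Y_nonneg[of a] r by (intro mult_left_mono powr_add_le) auto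
        finally have "J t a * norm (\<phi> (X t a) * w (X t a)) powr r \<le>
          exp ((A * M + 1) * T) * ((CV * ?E) powr r * (2 powr r * ((\<phi> a * S 0 a) powr r + Y a powr r)))"
          using J_le[OF t, of a] J_pos[of t a] by (intro mult_mono) (auto simp: less_imp_le)
        hence "J t a * norm (\<phi> (X t a) * w (X t a)) powr r \<le>
          (exp ((A * M + 1) * T) * ((CV * ?E) powr r * 2 powr r)) * ((\<phi> a * S 0 a) powr r + Y a powr r)"
          by (simp add: mult.assoc)
        from ennreal_leI[OF this]
        show "ennreal (J t a) * ennreal (norm (\<phi> (X t a) * w (X t a)) powr r) \<le>
          ennreal (exp ((A * M + 1) * T) * ((CV * ?E) powr r * 2 powr r)) * (ennreal ((\<phi> a * S 0 a) powr r) + ennreal (Y a powr r))"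
          using J_pos[of t a] by (simp add: ennreal_mult less_imp_le)
      qed
      also have "\<dots> = ennreal (exp ((A * M + 1) * T) * ((CV * ?E) powr r * 2 powr r)) * ennreal i"
        unfolding i(1)[symmetric] I_def using Ym by (intro nn_integral_cmult) measurable
      also have "\<dots> = ennreal B" using i(2) by (simp add: B_def ennreal_mult)
      finally show "(\<integral>\<^sup>+x. ennreal (norm (\<phi> x * w x) powr r) \<partial>lborel) \<le> ennreal B" by simp
    qed
    show ?thesis
      by (intro exI[of _ "B powr (1 / enn2real p)"] conjI ballI main) (blast intro: measurable_u u_le_S powr_ge_zero)+
  qed
qed

end

end

section \<open>From Sobolev solutions to regular solutions, and conclusion\<close>

lemma regular_solutionI:
  assumes f: "smooth f" and g: "smooth g" and T: "T > 0" and s: "s > 3 / 2" and u: "is_solution f g T s u0 u"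
    and M: "\<And>t x. t \<in> {0..T} \<Longrightarrow> \<bar>u t x\<bar> \<le> M \<and> \<bar>deriv (u t) x\<bar> \<le> M"
    and A: "coefficients_bounded f g M A"
  shows "regular_solution f g T M A u (\<lambda>t. deriv (u t))"
proof -
  have C0: "C0_sobolev T s u" and cont: "\<And>t. t \<in> {0..T} \<Longrightarrow> continuous_on UNIV (u t)"
    using u by (auto simp: is_solution_def)
  show ?thesis
  proof
    fix t x assume t: "t \<in> {0..T}"
    obtain ut where ut: "((\<lambda>\<tau>. u \<tau> x) has_real_derivative ut) (at t within {0..T})"
      "ut + deriv f (u t x) * deriv (u t) x + conv dq (\<lambda>y. g (u t y) + (deriv ^^ 2) f (u t y) / 2 * (deriv (u t) y)\<^sup>2) x = 0"
      using u t unfolding is_solution_def by blast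
    from ut(2) have "ut = - deriv f (u t x) * deriv (u t) x - conv dq (\<lambda>y. source f g (u t y) (deriv (u t) y)) x"
      by (simp add: source_def numeral_2_eq_2)
    with ut(1) show "((\<lambda>\<tau>. u \<tau> x) has_real_derivative
      - deriv f (u t x) * deriv (u t) x - conv dq (\<lambda>y. source f g (u t y) (deriv (u t) y)) x) (at t within {0..T})" by simp
  qed (use f g T M A solution_regularity[OF s C0 cont] in auto)
qed

lemma coefficient_bound:
  assumes f: "smooth f" and g: "smooth g"
  shows "\<exists>A. coefficients_bounded f g M A"
proof -
  obtain A1 A2 A3 A4 A5 where
    "\<forall>z\<in>{-M..M}. \<bar>(deriv ^^ 1) f z\<bar> \<le> A1" "\<forall>z\<in>{-M..M}. \<bar>(deriv ^^ 2) f z\<bar> \<le> A2"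
    "\<forall>z\<in>{-M..M}. \<bar>(deriv ^^ 3) f z\<bar> \<le> A3" "\<forall>z\<in>{-M..M}. \<bar>(deriv ^^ 0) g z\<bar> \<le> A4" "\<forall>z\<in>{-M..M}. \<bar>(deriv ^^ 1) g z\<bar> \<le> A5"
    using smooth_bounded[OF f, of M 1] smooth_bounded[OF f, of M 2] smooth_bounded[OF f, of M 3]
      smooth_bounded[OF g, of M 0] smooth_bounded[OF g, of M 1] by blast
  thus ?thesis unfolding coefficients_bounded_def
    by (intro exI[of _ "max A1 (max A2 (max A3 (max A4 A5)))"])
      (auto simp: numeral_2_eq_2 numeral_3_eq_3 abs_le_iff le_max_iff_disj)
qed

lemma solution_bounded:
  assumes s: "s > 3 / 2" and u: "is_solution f g T s u0 u"
  shows "\<exists>M. \<forall>t\<in>{0..T}. \<forall>x. \<bar>u t x\<bar> \<le> M \<and> \<bar>deriv (u t) x\<bar> \<le> M"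
  by (rule solution_regularity(4)[OF s]) (use u in \<open>auto simp: is_solution_def\<close>)

text \<open>The two exponents may differ, because \<open>K\<close> has to be fixed before
  \<open>s\<close> is known. Both solutions are placed under the larger sup bound and a common
  coefficient bound.\<close>

lemma solution_unique:
  assumes f: "smooth f" and g: "smooth g" and T: "T > 0"
    and s: "s > 3 / 2" "is_solution f g T s u0 u" and s': "s' > 3 / 2" "is_solution f g T s' u0 w" and t: "t \<in> {0..T}"
  shows "u t = w t"
proof -
  obtain M1 where M1: "\<forall>t\<in>{0..T}. \<forall>x. \<bar>u t x\<bar> \<le> M1 \<and> \<bar>deriv (u t) x\<bar> \<le> M1" using solution_bounded[OF s] by blast
  obtain M2 where M2: "\<forall>t\<in>{0..T}. \<forall>x. \<bar>w t x\<bar> \<le> M2 \<and> \<bar>deriv (w t) x\<bar> \<le> M2" using solution_bounded[OF s'] by blast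
  let ?M = "max M1 M2"
  obtain A where A: "coefficients_bounded f g ?M A"
    using coefficient_bound[OF f g, of ?M] by blast
  have R1: "regular_solution f g T ?M A u (\<lambda>t. deriv (u t))"
    by (rule regular_solutionI[OF f g T s _ A]) (use M1 in \<open>auto simp: le_max_iff_disj\<close>)
  have R2: "regular_solution f g T ?M A w (\<lambda>t. deriv (w t))"
    by (rule regular_solutionI[OF f g T s' _ A]) (use M2 in \<open>auto simp: le_max_iff_disj\<close>)
  have "u 0 x = w 0 x" for x using s(2) s'(2) by (simp add: is_solution_def)
  from regular_solution_unique[OF R1 R2 this t] have "u t x = w t x" for x .
  thus ?thesis by (rule ext)
qed

theorem theorem2p5:
  fixes f g :: "real \<Rightarrow> real"
    and v \<phi> :: "real \<Rightarrow> real"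
    and u0 :: "real \<Rightarrow> real"
    and T :: real
    and p :: ennreal
  assumes "smooth f" and "smooth g"
    and "f 0 = 0" and "\<forall>x. (deriv ^^ 2) f x \<ge> 0"
    and "\<forall>x. g x \<ge> 0" and "\<forall>x. g x = 0 \<longleftrightarrow> x = 0"
    and "T > 0" and "2 \<le> p"
    and "weight_function v" and "weight_function \<phi>" and "moderate v \<phi>"
    and "continuous_on UNIV u0"
    and "in_Lp 2 (\<lambda>x. sqrt (\<phi> x) * u0 x)"
    and "in_Lp 2 (\<lambda>x. sqrt (\<phi> x) * deriv u0 x)"
    and "in_Lp p (\<lambda>x. \<phi> x * u0 x)"
    and "in_Lp p (\<lambda>x. \<phi> x * deriv u0 x)"
    and "in_Lp p (\<lambda>x. exp (- \<bar>x\<bar>) * v x)"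
  shows "\<exists>K::real. K > 0 \<and>
    (\<forall>(s::real) u. s > 3 / 2 \<longrightarrow> u0 \<in> sobolev s \<longrightarrow> is_solution f g T s u0 u \<longrightarrow>
       (\<exists>c>0. \<forall>t\<in>{0..T}. \<forall>x. g (u t x) \<le> c * (u t x)\<^sup>2) \<longrightarrow>
       (SUP t\<in>{0..T}. Lp_norm 2 (\<lambda>x. sqrt (\<phi> x) * u t x)
                        + Lp_norm 2 (\<lambda>x. sqrt (\<phi> x) * deriv (u t) x)) \<le> ennreal K \<and>
       (SUP t\<in>{0..T}. Lp_norm p (\<lambda>x. \<phi> x * u t x)
                        + Lp_norm p (\<lambda>x. \<phi> x * deriv (u t) x)) < \<infinity>)"
proof (cases "\<exists>s u c. s > 3 / 2 \<and> is_solution f g T s u0 u \<and> c > 0 \<and> (\<forall>t\<in>{0..T}. \<forall>x. g (u t x) \<le> c * (u t x)\<^sup>2)")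
  \<comment> \<open>The constant must precede the solution. Without an admissible solution any
    positive number will do; otherwise one solution is fixed and the constants are read off from
    it.\<close>
  case False
  thus ?thesis by (intro exI[of _ 1]) (metis zero_less_one)
next
  case True
  then obtain s u c where s: "s > 3 / 2" "is_solution f g T s u0 u"
    and c: "c > 0" "\<forall>t\<in>{0..T}. \<forall>x. g (u t x) \<le> c * (u t x)\<^sup>2" by blast
  obtain M where M: "\<forall>t\<in>{0..T}. \<forall>x. \<bar>u t x\<bar> \<le> M \<and> \<bar>deriv (u t) x\<bar> \<le> M" using solution_bounded[OF s] by blast
  obtain A where A: "coefficients_bounded f g M A"
    using coefficient_bound[OF assms(1,2), of M] by blast
  interpret regular_solution f g T M A u "\<lambda>t. deriv (u t)"
    by (rule regular_solutionI[OF assms(1,2,7) s _ A]) (use M in auto)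
  \<comment> \<open>Nonnegativity of \<open>g\<close> turns the one-sided quadratic bound into a
    bound on its absolute value.\<close>
  interpret quadratic_solution f g T M A u "\<lambda>t. deriv (u t)" c
    by unfold_locales (use c assms(5) in auto)
  have \<phi>pos: "\<phi> x > 0" for x using assms(10) by (simp add: weight_function_def)
  obtain c0 where c0: "c0 > 0" "\<And>x y. \<phi> (x + y) \<le> c0 * v x * \<phi> y" using assms(11) by (auto simp: moderate_def)
  have u_0: "u 0 = u0" using s(2) by (auto simp: is_solution_def)
  have sq: "(norm (sqrt (\<phi> x) * y))\<^sup>2 = \<phi> x * y\<^sup>2" for x y
    using \<phi>pos[of x] by (simp add: power_mult_distrib less_imp_le)
  have init: "(\<integral>\<^sup>+x. ennreal (\<phi> x * (u 0 x)\<^sup>2) \<partial>lborel) < \<infinity>" "(\<integral>\<^sup>+x. ennreal (\<phi> x * (deriv (u 0) x)\<^sup>2) \<partial>lborel) < \<infinity>"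
    using assms(13,14) unfolding in_Lp_def Lp_norm_2_finite_iff sq u_0 by auto
  note wt = assms(9,10) c0(2,1)
  obtain C where C: "C \<ge> 0" "\<And>t. t \<in> {0..T} \<Longrightarrow> (\<integral>\<^sup>+a. ennreal (\<phi> a * (S t a)\<^sup>2) \<partial>lborel) \<le> ennreal C"
    using S_L2_bound[OF wt nn_integral_sqrt_weight[OF assms(9,8,17)] init] by blast
  obtain K where K: "K \<ge> 0" "\<And>t. t \<in> {0..T} \<Longrightarrow> Lp_norm 2 (\<lambda>x. sqrt (\<phi> x) * u t x) \<le> ennreal K \<and>
      Lp_norm 2 (\<lambda>x. sqrt (\<phi> x) * deriv (u t) x) \<le> ennreal K"
    using L2_bound[OF wt C] by blast
  obtain K' where K': "K' \<ge> 0" "\<And>t. t \<in> {0..T} \<Longrightarrow> Lp_norm p (\<lambda>x. \<phi> x * u t x) \<le> ennreal K' \<and>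
      Lp_norm p (\<lambda>x. \<phi> x * deriv (u t) x) \<le> ennreal K'"
    using Lp_bound[OF wt assms(8,17) _ _ C] assms(15,16) unfolding u_0 by blast
  have b1: "(SUP t\<in>{0..T}. Lp_norm 2 (\<lambda>x. sqrt (\<phi> x) * u t x) + Lp_norm 2 (\<lambda>x. sqrt (\<phi> x) * deriv (u t) x)) \<le> ennreal (2 * K + 1)"
  proof (rule SUP_least)
    fix t assume "t \<in> {0..T}"
    from K(2)[OF this] have "Lp_norm 2 (\<lambda>x. sqrt (\<phi> x) * u t x) + Lp_norm 2 (\<lambda>x. sqrt (\<phi> x) * deriv (u t) x) \<le> ennreal K + ennreal K"
      by (intro add_mono) auto
    also have "\<dots> \<le> ennreal (2 * K + 1)" using K(1) by (simp flip: ennreal_plus add: ennreal_leI)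
    finally show "Lp_norm 2 (\<lambda>x. sqrt (\<phi> x) * u t x) + Lp_norm 2 (\<lambda>x. sqrt (\<phi> x) * deriv (u t) x) \<le> ennreal (2 * K + 1)" .
  qed
  have "(SUP t\<in>{0..T}. Lp_norm p (\<lambda>x. \<phi> x * u t x) + Lp_norm p (\<lambda>x. \<phi> x * deriv (u t) x)) \<le> ennreal K' + ennreal K'"
    using K'(2) by (intro SUP_least add_mono) auto
  also have "\<dots> < \<infinity>" by simp
  finally have b2: "(SUP t\<in>{0..T}. Lp_norm p (\<lambda>x. \<phi> x * u t x) + Lp_norm p (\<lambda>x. \<phi> x * deriv (u t) x)) < \<infinity>" .
  show ?thesis
  proof (intro exI[of _ "2 * K + 1"] conjI allI impI)
    show "0 < 2 * K + 1" using K(1) by simp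
    fix s' w assume s': "s' > 3 / 2" "is_solution f g T s' u0 w"
    \<comment> \<open>Any other admissible solution agrees with the fixed one on
      \<open>[0, T]\<close>, so it inherits both suprema, including those of the space
      derivative.\<close>
    have eq: "w t = u t" if "t \<in> {0..T}" for t
      using solution_unique[OF assms(1,2,7) s' s that] .
    have "(SUP t\<in>{0..T}. Lp_norm 2 (\<lambda>x. sqrt (\<phi> x) * w t x) + Lp_norm 2 (\<lambda>x. sqrt (\<phi> x) * deriv (w t) x)) =
        (SUP t\<in>{0..T}. Lp_norm 2 (\<lambda>x. sqrt (\<phi> x) * u t x) + Lp_norm 2 (\<lambda>x. sqrt (\<phi> x) * deriv (u t) x))"
      by (rule SUP_cong[OF refl]) (simp only: eq)
    thus "(SUP t\<in>{0..T}. Lp_norm 2 (\<lambda>x. sqrt (\<phi> x) * w t x) + Lp_norm 2 (\<lambda>x. sqrt (\<phi> x) * deriv (w t) x)) \<le> ennreal (2 * K + 1)"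
      using b1 by (simp only:)
    have "(SUP t\<in>{0..T}. Lp_norm p (\<lambda>x. \<phi> x * w t x) + Lp_norm p (\<lambda>x. \<phi> x * deriv (w t) x)) =
        (SUP t\<in>{0..T}. Lp_norm p (\<lambda>x. \<phi> x * u t x) + Lp_norm p (\<lambda>x. \<phi> x * deriv (u t) x))"
      by (rule SUP_cong[OF refl]) (simp only: eq)
    thus "(SUP t\<in>{0..T}. Lp_norm p (\<lambda>x. \<phi> x * w t x) + Lp_norm p (\<lambda>x. \<phi> x * deriv (w t) x)) < \<infinity>"
      using b2 by (simp only:)
  qed
qed

end
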